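(* Let $T,\lambda\in(0,\infty)$, let $J(N,W)=\int_0^T N(t-)\,\mathrm{d}W(t)$, and for $n\in\mathbb{N}$ let $$\mathcal{A}^T_n(N,W)=\sum_{i=0}^{n-1}\tfrac12\big(W(t_{i+1})-W(t_i)\big)\big(N(t_{i+1})+N(t_i)\big)$$ be the trapezoidal method based on the equidistant mesh $t_i=iT/n$, $i\in\{0,1,\dots,n\}$. Then $$\lim_{n\to\infty}n^{1/2}\,\big\|J(N,W)-\mathcal{A}^T_n(N,W)\big\|_2=\lim_{n\to\infty}n^{1/2}\inf_{\mathcal{A}_n}\big\|J(N,W)-\mathcal{A}_n(N,W)\big\|_2=\frac{\lambda^{1/2}T}{2},$$ where the infimum is over all methods $\mathcal{A}_n$ using $n$ evaluations of $N$ and of $W$ as described in the context. Hence, in this sense, $\mathcal{A}^T_n(N,W)$ is the optimal method among all such methods.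
   Context: $(\Omega,\mathcal{F},(\mathcal{F}_t)_{t\ge0},\mathbb{P})$ is a filtered probability space whose filtration satisfies the usual conditions; $W=(W(t))_{t\in[0,T]}$ is a standard scalar Wiener process and $N=(N(t))_{t\in[0,T]}$ a homogeneous Poisson process with intensity $\lambda>0$, both with respect to this filtration (so $W$ and $N$ are independent). $\|\cdot\|_2$ is the $L^2(\Omega)$-norm. $J(N,W)$ is the jump-diffusion Lévy's area $$J(N,W)=\int_0^T\int_0^{t-}\mathrm{d}N(s)\,\mathrm{d}W(t)=\int_0^TN(t-)\,\mathrm{d}W(t)=\int_0^TN(t)\,\mathrm{d}W(t).$$ A method $\mathcal{A}_n$ is given by a discretization $0=t_0<t_1<\dots<t_n=T$ of $[0,T]$ (deterministic) and a Borel-measurable function $\varphi_n:\mathbb{R}^{2n}\to\mathbb{R}$, via $$\mathcal{A}_n(N,W)=\varphi_n\big(N(t_1),\dots,N(t_n),W(t_1),\dots,W(t_n)\big).$$ The infimum over $\mathcal{A}_n$ is over all such discretizations and all such $\varphi_n$. *)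

theory Defs
  imports "HOL-Probability.Probability"
begin

(* The library's filtrations are indexed by a whole linearly ordered type.  Only the times t >= 0
   matter: every filtration on [0,\<infinity>) extends by F t = F 0 for t < 0. *)
locale filtered_prob_space = prob_space M + filtration "space M" F
  for M :: "'a measure" and F :: "real \<Rightarrow> 'a measure" +
  assumes sets_F_subset: "\<And>t. 0 \<le> t \<Longrightarrow> sets (F t) \<subseteq> sets M"

definition usual_conditions :: "'a measure \<Rightarrow> (real \<Rightarrow> 'a measure) \<Rightarrow> bool" where
  "usual_conditions M F \<longleftrightarrow>
     complete_measure M \<and> null_sets M \<subseteq> sets (F 0) \<and>
     (\<forall>t\<ge>0. sets (F t) = (\<Inter>s\<in>{t<..}. sets (F s)))"

definition increments_independent ::
    "'a measure \<Rightarrow> (real \<Rightarrow> 'a measure) \<Rightarrow> real \<Rightarrow> (real \<Rightarrow> 'a \<Rightarrow> real) \<Rightarrow> bool" where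
  "increments_independent M F T X \<longleftrightarrow>
     (\<forall>s t. 0 \<le> s \<and> s < t \<and> t \<le> T \<longrightarrow>
        prob_space.indep_set M (sets (F s))
          (sets (vimage_algebra (space M) (\<lambda>\<omega>. X t \<omega> - X s \<omega>) borel)))"

definition adapted_on :: "(real \<Rightarrow> 'a measure) \<Rightarrow> real \<Rightarrow> (real \<Rightarrow> 'a \<Rightarrow> real) \<Rightarrow> bool" where
  "adapted_on F T X \<longleftrightarrow> (\<forall>t\<in>{0..T}. X t \<in> borel_measurable (F t))"

definition wiener_process ::
    "'a measure \<Rightarrow> (real \<Rightarrow> 'a measure) \<Rightarrow> real \<Rightarrow> (real \<Rightarrow> 'a \<Rightarrow> real) \<Rightarrow> bool" where
  "wiener_process M F T W \<longleftrightarrow>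
     adapted_on F T W \<and>
     (AE \<omega> in M. W 0 \<omega> = 0) \<and>
     increments_independent M F T W \<and>
     (\<forall>s t. 0 \<le> s \<and> s < t \<and> t \<le> T \<longrightarrow>
        distributed M lborel (\<lambda>\<omega>. W t \<omega> - W s \<omega>) (normal_density 0 (sqrt (t - s)))) \<and>
     (AE \<omega> in M. continuous_on {0..T} (\<lambda>t. W t \<omega>))"

definition cadlag_on :: "real \<Rightarrow> (real \<Rightarrow> real) \<Rightarrow> bool" where
  "cadlag_on T x \<longleftrightarrow>
     (\<forall>t\<in>{0..<T}. (x \<longlongrightarrow> x t) (at_right t)) \<and>
     (\<forall>t\<in>{0<..T}. \<exists>l. (x \<longlongrightarrow> l) (at_left t))"

definition poisson_process ::
    "'a measure \<Rightarrow> (real \<Rightarrow> 'a measure) \<Rightarrow> real \<Rightarrow> real \<Rightarrow> (real \<Rightarrow> 'a \<Rightarrow> real) \<Rightarrow> bool" where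
  "poisson_process M F T intensity N \<longleftrightarrow>
     adapted_on F T N \<and>
     (AE \<omega> in M. N 0 \<omega> = 0) \<and>
     increments_independent M F T N \<and>
     (\<forall>s t. 0 \<le> s \<and> s < t \<and> t \<le> T \<longrightarrow>
        distr M borel (\<lambda>\<omega>. N t \<omega> - N s \<omega>) =
        distr (measure_pmf (poisson_pmf (intensity * (t - s)))) borel real) \<and>
     (AE \<omega> in M. cadlag_on T (\<lambda>t. N t \<omega>))"

(* Extended-valued, so that a random variable outside L2 has norm \<infinity>. *)
definition L2_norm :: "'a measure \<Rightarrow> ('a \<Rightarrow> real) \<Rightarrow> ennreal" where
  "L2_norm M X =
     (let I = (\<integral>\<^sup>+\<omega>. ennreal ((X \<omega>)\<^sup>2) \<partial>M) in if I = \<top> then \<top> else ennreal (sqrt (enn2real I)))"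

(* A triple (m, s, \<xi>) encodes the simple process \<Sum>i<m. \<xi> i * 1_(s i, s (i+1)]. *)
type_synonym 'a simple_data = "nat \<times> (nat \<Rightarrow> real) \<times> (nat \<Rightarrow> 'a \<Rightarrow> real)"

definition simple_integrands ::
    "'a measure \<Rightarrow> (real \<Rightarrow> 'a measure) \<Rightarrow> real \<Rightarrow> 'a simple_data set" where
  "simple_integrands M F T = {(m, s, \<xi>).
     0 \<le> s 0 \<and> s m \<le> T \<and> (\<forall>i<m. s i < s (Suc i)) \<and>
     (\<forall>i<m. \<xi> i \<in> borel_measurable (F (s i)) \<and> (\<exists>C. \<forall>\<omega>\<in>space M. \<bar>\<xi> i \<omega>\<bar> \<le> C))}"

fun simple_process :: "'a simple_data \<Rightarrow> real \<Rightarrow> 'a \<Rightarrow> real" where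
  "simple_process (m, s, \<xi>) t \<omega> = (\<Sum>i<m. \<xi> i \<omega> * indicator {s i<..s (Suc i)} t)"

fun simple_integral :: "(real \<Rightarrow> 'a \<Rightarrow> real) \<Rightarrow> 'a simple_data \<Rightarrow> 'a \<Rightarrow> real" where
  "simple_integral W (m, s, \<xi>) \<omega> = (\<Sum>i<m. \<xi> i \<omega> * (W (s (Suc i)) \<omega> - W (s i) \<omega>))"

(* I is a version of the Ito integral of H over [0,T].  The integrands are the members of the closure
   of the simple predictable processes in L2([0,T] \<times> \<Omega>, dt \<otimes> P); measurability of H is with respect to
   the completed product, because the path properties of W and N are only assumed almost surely. *)
definition has_ito_integral ::
    "'a measure \<Rightarrow> (real \<Rightarrow> 'a measure) \<Rightarrow> real \<Rightarrow> (real \<Rightarrow> 'a \<Rightarrow> real) \<Rightarrow>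
     (real \<Rightarrow> 'a \<Rightarrow> real) \<Rightarrow> ('a \<Rightarrow> real) \<Rightarrow> bool" where
  "has_ito_integral M F T W H I \<longleftrightarrow>
     (\<lambda>(t, \<omega>). H t \<omega>)
       \<in> borel_measurable (completion (restrict_space lborel {0..T} \<Otimes>\<^sub>M M)) \<and>
     I \<in> borel_measurable M \<and>
     (\<exists>S :: nat \<Rightarrow> 'a simple_data.
        (\<forall>k. S k \<in> simple_integrands M F T) \<and>
        (\<lambda>k. L2_norm (completion (restrict_space lborel {0..T} \<Otimes>\<^sub>M M))
                (\<lambda>(t, \<omega>). H t \<omega> - simple_process (S k) t \<omega>)) \<longlonglongrightarrow> 0 \<and>
        (\<lambda>k. L2_norm M (\<lambda>\<omega>. I \<omega> - simple_integral W (S k) \<omega>)) \<longlonglongrightarrow> 0)"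

definition ito_integral ::
    "'a measure \<Rightarrow> (real \<Rightarrow> 'a measure) \<Rightarrow> real \<Rightarrow> (real \<Rightarrow> 'a \<Rightarrow> real) \<Rightarrow>
     (real \<Rightarrow> 'a \<Rightarrow> real) \<Rightarrow> 'a \<Rightarrow> real" where
  "ito_integral M F T W H = (SOME I. has_ito_integral M F T W H I)"

(* N(t-), with the convention N(0-) = 0 *)
definition left_limit_process :: "(real \<Rightarrow> 'a \<Rightarrow> real) \<Rightarrow> real \<Rightarrow> 'a \<Rightarrow> real" where
  "left_limit_process N t \<omega> = (if t = 0 then 0 else Lim (at_left t) (\<lambda>s. N s \<omega>))"

definition levy_area ::
    "'a measure \<Rightarrow> (real \<Rightarrow> 'a measure) \<Rightarrow> real \<Rightarrow>
     (real \<Rightarrow> 'a \<Rightarrow> real) \<Rightarrow> (real \<Rightarrow> 'a \<Rightarrow> real) \<Rightarrow> 'a \<Rightarrow> real" where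
  "levy_area M F T N W = ito_integral M F T W (left_limit_process N)"

definition discretizations :: "real \<Rightarrow> nat \<Rightarrow> (nat \<Rightarrow> real) set" where
  "discretizations T n = {t. t 0 = 0 \<and> t n = T \<and> (\<forall>i<n. t i < t (Suc i))}"

(* \<real>^(2n) is the product of 2n copies of the Borel space \<real>, with coordinates 1, ..., 2n. *)
definition methods :: "real \<Rightarrow> nat \<Rightarrow> ((nat \<Rightarrow> real) \<times> ((nat \<Rightarrow> real) \<Rightarrow> real)) set" where
  "methods T n = discretizations T n \<times> borel_measurable (Pi\<^sub>M {1..2 * n} (\<lambda>_. borel))"

definition sample_vector ::
    "nat \<Rightarrow> (nat \<Rightarrow> real) \<Rightarrow> (real \<Rightarrow> 'a \<Rightarrow> real) \<Rightarrow> (real \<Rightarrow> 'a \<Rightarrow> real) \<Rightarrow> 'a \<Rightarrow> nat \<Rightarrow> real" where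
  "sample_vector n t N W \<omega> =
     (\<lambda>i\<in>{1..2 * n}. if i \<le> n then N (t i) \<omega> else W (t (i - n)) \<omega>)"

definition method_value ::
    "nat \<Rightarrow> (nat \<Rightarrow> real) \<times> ((nat \<Rightarrow> real) \<Rightarrow> real) \<Rightarrow>
     (real \<Rightarrow> 'a \<Rightarrow> real) \<Rightarrow> (real \<Rightarrow> 'a \<Rightarrow> real) \<Rightarrow> 'a \<Rightarrow> real" where
  "method_value n A N W \<omega> = snd A (sample_vector n (fst A) N W \<omega>)"

definition trapezoidal ::
    "real \<Rightarrow> nat \<Rightarrow> (real \<Rightarrow> 'a \<Rightarrow> real) \<Rightarrow> (real \<Rightarrow> 'a \<Rightarrow> real) \<Rightarrow> 'a \<Rightarrow> real" where
  "trapezoidal T n N W \<omega> =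
     (let t = (\<lambda>i::nat. real i * T / real n)
      in \<Sum>i<n. 1 / 2 * (W (t (i + 1)) \<omega> - W (t i) \<omega>) * (N (t (i + 1)) \<omega> + N (t i) \<omega>))"

end

theory Submission
  imports Defs
begin

text \<open>Let \<open>A\<close> be the trapezoidal sum on a mesh \<open>0 = t\<^sub>0 < \<dots> < t\<^sub>n = T\<close> with cell lengths \<open>h\<^sub>i\<close>.  Reversing time
inside every cell, that is, reversing the order in which the increments of \<open>N\<close> and \<open>W\<close> occur there,
preserves the joint law of the two processes and leaves all samples \<open>N(t\<^sub>i)\<close>, \<open>W(t\<^sub>i)\<close> as they are, but it
turns the error \<open>J - A\<close> into its negative, because \<open>N\<close> and \<open>W\<close> have no quadratic covariation.  Therefore \<open>J - A\<close> is
orthogonal in \<open>L\<^sup>2\<close> to every function of the samples, and by Pythagoras \<open>A\<close> is the best approximation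
that can be obtained from its mesh (\<open>method_error_ge\<close>).  It remains to compare meshes.  Given \<open>N\<close>, the error
is a Wiener integral, and its second moment lies between \<open>rate / 4 * \<Sum>h\<^sub>i\<^sup>2\<close> and
\<open>rate / 4 * \<Sum>h\<^sub>i\<^sup>2 + rate\<^sup>2 / 4 * \<Sum>h\<^sub>i\<^sup>3\<close> (\<open>trapezoid_error_bounds\<close>).  The first sum is at least \<open>T\<^sup>2 / n\<close> by the
Cauchy-Schwarz inequality, with equality for the equidistant mesh, for which the second sum is of order
\<open>1 / n\<^sup>2\<close>.  Both limits follow.

Two facts have to be supplied before this argument can be run.

First, the law of the pair \<open>(N, W)\<close> has to be known, whereas the hypotheses only speak of the increments of each process
separately.  Two such processes for the same filtration are independent (\<open>increments_factorize\<close>): if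
\<open>X\<close> and \<open>Y\<close> are transforms of the two increments over a short interval of length \<open>h\<close>, with means \<open>a\<close> and
\<open>b\<close>, then \<open>E (X Y | F) - a b = E ((X - a) (Y - b) | F)\<close>, where \<open>F\<close> denotes the past, and this is \<open>o(h)\<close> because \<open>Y - b\<close> is of
order \<open>h\<close> in the mean and \<open>X - a\<close> is small outside an event of negligible probability; adding up over a fine
partition gives exact factorization.

Second, the time reversal is carried out on finitely many increments.  Each cell is divided into \<open>K\<close>
equal parts and \<open>J\<close> is replaced by the left-endpoint sum on the refined grid, which by the Ito isometry
converges to \<open>J\<close> in \<open>L\<^sup>2\<close> as \<open>K\<close> grows (\<open>levy_area_approx\<close>).  The reversal
symmetry then holds up to the discrete quadratic covariation of \<open>N\<close> and \<open>W\<close> (\<open>cross_sum_reverse\<close>), whose second moment is of order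
\<open>1 / K\<close>.\<close>

section \<open>Square-integrable functions\<close>

definition sq_integrable :: "'b measure \<Rightarrow> ('b \<Rightarrow> real) \<Rightarrow> bool" where
  "sq_integrable M f \<longleftrightarrow> f \<in> borel_measurable M \<and> integrable M (\<lambda>x. (f x)\<^sup>2)"

lemma sq_integrable_measurable: "sq_integrable M f \<Longrightarrow> f \<in> borel_measurable M"
  and sq_integrable_integrable: "sq_integrable M f \<Longrightarrow> integrable M (\<lambda>x. (f x)\<^sup>2)"
  by (auto simp: sq_integrable_def)

lemma sq_integrable_mult:
  assumes "sq_integrable M f" "sq_integrable M g"
  shows "integrable M (\<lambda>x. f x * g x)"
proof (rule Bochner_Integration.integrable_bound)
  show "integrable M (\<lambda>x. (f x)\<^sup>2 + (g x)\<^sup>2)"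
    using assms by (auto simp: sq_integrable_def)
  show "(\<lambda>x. f x * g x) \<in> borel_measurable M"
    using assms by (auto simp: sq_integrable_def)
  show "AE x in M. norm (f x * g x) \<le> norm ((f x)\<^sup>2 + (g x)\<^sup>2)"
  proof (rule AE_I2)
    fix x
    have "2 * (\<bar>f x\<bar> * \<bar>g x\<bar>) \<le> \<bar>f x\<bar>\<^sup>2 + \<bar>g x\<bar>\<^sup>2"
      using sum_squares_bound[of "\<bar>f x\<bar>" "\<bar>g x\<bar>"] by (simp add: mult.assoc)
    moreover have "0 \<le> \<bar>f x\<bar> * \<bar>g x\<bar>" by simp
    ultimately show "norm (f x * g x) \<le> norm ((f x)\<^sup>2 + (g x)\<^sup>2)"
      unfolding real_norm_def abs_mult power2_abs by (smt (verit))
  qed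
qed

lemma sq_integrable_add:
  assumes f: "sq_integrable M f" and g: "sq_integrable M g"
  shows "sq_integrable M (\<lambda>x. f x + g x)"
proof -
  have "integrable M (\<lambda>x. (f x)\<^sup>2 + (g x)\<^sup>2 + 2 * (f x * g x))"
    using f g sq_integrable_mult[OF f g] by (intro Bochner_Integration.integrable_add integrable_mult_right)
      (auto simp: sq_integrable_def)
  then show ?thesis
    using f g by (auto simp: sq_integrable_def power2_sum mult.assoc)
qed

lemma sq_integrable_cmult: "sq_integrable M f \<Longrightarrow> sq_integrable M (\<lambda>x. c * f x)"
  by (auto simp: sq_integrable_def power_mult_distrib)

lemma sq_integrable_diff:
  "sq_integrable M f \<Longrightarrow> sq_integrable M g \<Longrightarrow> sq_integrable M (\<lambda>x. f x - g x)"
  using sq_integrable_add[of M f "\<lambda>x. - 1 * g x"] sq_integrable_cmult[of M g "- 1"] by simp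

lemma sq_integrable_zero: "sq_integrable M (\<lambda>x. 0)"
  by (simp add: sq_integrable_def)

lemma sq_integrable_sum:
  "(\<And>i. i \<in> I \<Longrightarrow> sq_integrable M (f i)) \<Longrightarrow> sq_integrable M (\<lambda>x. \<Sum>i\<in>I. f i x)"
  by (induction I rule: infinite_finite_induct)
    (auto intro: sq_integrable_add sq_integrable_zero)

lemma (in finite_measure) sq_integrable_imp_integrable:
  "sq_integrable M f \<Longrightarrow> integrable M f"
  using sq_integrable_mult[of M f "\<lambda>_. 1"] by (simp add: sq_integrable_def)

lemma sq_integrable_cong_AE:
  assumes "sq_integrable M f" "g \<in> borel_measurable M" "AE x in M. f x = g x"
  shows "sq_integrable M g"
proof -
  have "integrable M (\<lambda>x. (g x)\<^sup>2) \<longleftrightarrow> integrable M (\<lambda>x. (f x)\<^sup>2)"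
    by (rule integrable_cong_AE) (use assms in \<open>auto simp: sq_integrable_def\<close>)
  then show ?thesis using assms by (auto simp: sq_integrable_def)
qed

lemma sq_integrable_iff_nn_integral:
  assumes "f \<in> borel_measurable M"
  shows "sq_integrable M f \<longleftrightarrow> (\<integral>\<^sup>+x. ennreal ((f x)\<^sup>2) \<partial>M) < \<infinity>"
  using assms by (simp add: sq_integrable_def integrable_iff_bounded)

lemma L2_norm_eq_sqrt_integral:
  assumes "sq_integrable M f"
  shows "L2_norm M f = ennreal (sqrt (\<integral>x. (f x)\<^sup>2 \<partial>M))"
proof -
  have "(\<integral>\<^sup>+x. ennreal ((f x)\<^sup>2) \<partial>M) = ennreal (\<integral>x. (f x)\<^sup>2 \<partial>M)"
    using assms by (intro nn_integral_eq_integral) (auto simp: sq_integrable_def)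
  then show ?thesis
    by (simp add: L2_norm_def Let_def)
qed

lemma L2_norm_eq_top:
  assumes "f \<in> borel_measurable M" "\<not> sq_integrable M f"
  shows "L2_norm M f = \<top>"
  using assms sq_integrable_iff_nn_integral[OF assms(1)]
  by (simp add: L2_norm_def Let_def less_top)

lemma L2_norm_cong_AE:
  assumes "AE x in M. f x = g x"
  shows "L2_norm M f = L2_norm M g"
proof -
  have "(\<integral>\<^sup>+x. ennreal ((f x)\<^sup>2) \<partial>M) = (\<integral>\<^sup>+x. ennreal ((g x)\<^sup>2) \<partial>M)"
    by (intro nn_integral_cong_AE) (use assms in auto)
  then show ?thesis by (simp add: L2_norm_def)
qed

text \<open>Second moments, unlike the norm, can be handled with Tonelli's theorem and Fatou's lemma.\<close>

lemma L2_norm_tendsto_zero_iff: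
  "(\<lambda>k. L2_norm M (f k)) \<longlonglongrightarrow> 0 \<longleftrightarrow> (\<lambda>k::nat. \<integral>\<^sup>+x. ennreal ((f k x)\<^sup>2) \<partial>M) \<longlonglongrightarrow> 0"
proof -
  define g where "g k = (\<integral>\<^sup>+x. ennreal ((f k x)\<^sup>2) \<partial>M)" for k
  define root where "root y = (if y = \<top> then \<top> else ennreal (sqrt (enn2real y)))" for y :: ennreal
  have sq: "root y * root y = y" for y
    by (cases y rule: ennreal_cases) (auto simp: root_def ennreal_mult[symmetric])
  have eq: "L2_norm M (f k) = root (g k)" for k
    by (simp add: L2_norm_def root_def g_def Let_def)
  show ?thesis
  proof
    assume "(\<lambda>k. L2_norm M (f k)) \<longlonglongrightarrow> 0"
    then have "(\<lambda>k. root (g k)) \<longlonglongrightarrow> 0" by (simp add: eq)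
    then have "(\<lambda>k. root (g k) * root (g k)) \<longlonglongrightarrow> 0 * 0"
      by (intro tendsto_mult_ennreal) auto
    then show "(\<lambda>k. \<integral>\<^sup>+x. ennreal ((f k x)\<^sup>2) \<partial>M) \<longlonglongrightarrow> 0" by (simp add: sq g_def)
  next
    assume "(\<lambda>k. \<integral>\<^sup>+x. ennreal ((f k x)\<^sup>2) \<partial>M) \<longlonglongrightarrow> 0"
    then have g: "g \<longlonglongrightarrow> 0" by (simp add: g_def[abs_def])
    show "(\<lambda>k. L2_norm M (f k)) \<longlonglongrightarrow> 0"
    proof (rule order_tendstoI)
      fix a :: ennreal assume "0 < a"
      then have "0 < a * a" by (auto simp: zero_less_iff_neq_zero)
      with g have "eventually (\<lambda>k. g k < a * a) sequentially" by (rule order_tendstoD)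
      then show "eventually (\<lambda>k. L2_norm M (f k) < a) sequentially"
      proof eventually_elim
        case (elim k)
        have "\<not> a \<le> root (g k)"
          using elim mult_mono[of a "root (g k)" a "root (g k)"] by (auto simp: sq)
        then show ?case by (simp add: eq)
      qed
    qed auto
  qed
qed

lemma Cauchy_Schwarz_integral:
  assumes f: "sq_integrable M f" and g: "sq_integrable M g"
  shows "\<bar>\<integral>x. f x * g x \<partial>M\<bar> \<le> sqrt (\<integral>x. (f x)\<^sup>2 \<partial>M) * sqrt (\<integral>x. (g x)\<^sup>2 \<partial>M)"
proof -
  note [measurable] = sq_integrable_measurable[OF f] sq_integrable_measurable[OF g]
  have i: "integrable M (\<lambda>x. \<bar>f x * g x\<bar>)"
    using sq_integrable_mult[OF f g] by auto
  have "(\<integral>\<^sup>+x. ennreal \<bar>f x\<bar> * ennreal \<bar>g x\<bar> \<partial>M)\<^sup>2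
      \<le> (\<integral>\<^sup>+x. (ennreal \<bar>f x\<bar>)\<^sup>2 \<partial>M) * (\<integral>\<^sup>+x. (ennreal \<bar>g x\<bar>)\<^sup>2 \<partial>M)"
    by (rule Cauchy_Schwarz_nn_integral) auto
  also have "(\<integral>\<^sup>+x. ennreal \<bar>f x\<bar> * ennreal \<bar>g x\<bar> \<partial>M) = ennreal (\<integral>x. \<bar>f x * g x\<bar> \<partial>M)"
    using i by (subst nn_integral_eq_integral[symmetric]) (auto simp: ennreal_mult abs_mult)
  also have "(\<integral>\<^sup>+x. (ennreal \<bar>f x\<bar>)\<^sup>2 \<partial>M) = ennreal (\<integral>x. (f x)\<^sup>2 \<partial>M)"
    using sq_integrable_integrable[OF f]
    by (subst nn_integral_eq_integral[symmetric]) (auto simp: ennreal_power)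
  also have "(\<integral>\<^sup>+x. (ennreal \<bar>g x\<bar>)\<^sup>2 \<partial>M) = ennreal (\<integral>x. (g x)\<^sup>2 \<partial>M)"
    using sq_integrable_integrable[OF g]
    by (subst nn_integral_eq_integral[symmetric]) (auto simp: ennreal_power)
  finally have "(\<integral>x. \<bar>f x * g x\<bar> \<partial>M)\<^sup>2 \<le> (\<integral>x. (f x)\<^sup>2 \<partial>M) * (\<integral>x. (g x)\<^sup>2 \<partial>M)"
    by (simp add: ennreal_power ennreal_mult[symmetric] ennreal_le_iff)
  then have "(\<integral>x. \<bar>f x * g x\<bar> \<partial>M) \<le> sqrt ((\<integral>x. (f x)\<^sup>2 \<partial>M) * (\<integral>x. (g x)\<^sup>2 \<partial>M))"
    by (rule real_le_rsqrt)
  moreover have "\<bar>\<integral>x. f x * g x \<partial>M\<bar> \<le> (\<integral>x. \<bar>f x * g x\<bar> \<partial>M)"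
    using integral_norm_bound[of M "\<lambda>x. f x * g x"] by simp
  ultimately show ?thesis unfolding real_sqrt_mult by linarith
qed

text \<open>Both limits come from the Cauchy-Schwarz inequality applied to the difference \<open>f k - f'\<close>.\<close>

lemma
  assumes fk: "\<And>k. sq_integrable M (f k)" and f: "sq_integrable M f'"
    and lim: "(\<lambda>k::nat. \<integral>x. (f k x - f' x)\<^sup>2 \<partial>M) \<longlonglongrightarrow> 0"
  shows L2_tendsto_integral_mult:
      "sq_integrable M g \<Longrightarrow> (\<lambda>k. \<integral>x. f k x * g x \<partial>M) \<longlonglongrightarrow> (\<integral>x. f' x * g x \<partial>M)"
    and L2_tendsto_second_moment: "(\<lambda>k. \<integral>x. (f k x)\<^sup>2 \<partial>M) \<longlonglongrightarrow> (\<integral>x. (f' x)\<^sup>2 \<partial>M)"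
proof -
  have d: "sq_integrable M (\<lambda>x. f k x - f' x)" for k
    using fk f by (rule sq_integrable_diff)
  have weak: "(\<lambda>k. \<integral>x. (f k x - f' x) * g x \<partial>M) \<longlonglongrightarrow> 0" if g: "sq_integrable M g" for g
  proof (rule Lim_null_comparison)
    show "\<forall>\<^sub>F k in sequentially. norm (\<integral>x. (f k x - f' x) * g x \<partial>M)
        \<le> sqrt (\<integral>x. (f k x - f' x)\<^sup>2 \<partial>M) * sqrt (\<integral>x. (g x)\<^sup>2 \<partial>M)"
      using Cauchy_Schwarz_integral[OF d g] by simp
    have "(\<lambda>k. sqrt (\<integral>x. (f k x - f' x)\<^sup>2 \<partial>M)) \<longlonglongrightarrow> 0"
      using tendsto_real_sqrt[OF lim] by simp
    then show "(\<lambda>k. sqrt (\<integral>x. (f k x - f' x)\<^sup>2 \<partial>M) * sqrt (\<integral>x. (g x)\<^sup>2 \<partial>M)) \<longlonglongrightarrow> 0"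
      by (rule tendsto_mult_left_zero)
  qed
  show "(\<lambda>k. \<integral>x. f k x * g x \<partial>M) \<longlonglongrightarrow> (\<integral>x. f' x * g x \<partial>M)" if g: "sq_integrable M g"
  proof -
    have "(\<integral>x. f k x * g x \<partial>M) = (\<integral>x. (f k x - f' x) * g x \<partial>M) + (\<integral>x. f' x * g x \<partial>M)" for k
      using sq_integrable_mult[OF d g] sq_integrable_mult[OF f g]
      by (subst Bochner_Integration.integral_add[symmetric]) (auto simp: algebra_simps)
    then show ?thesis
      using tendsto_add[OF weak[OF g] tendsto_const[of "\<integral>x. f' x * g x \<partial>M"]] by simp
  qed
  have "(\<integral>x. (f k x)\<^sup>2 \<partial>M) = (\<integral>x. (f k x - f' x)\<^sup>2 \<partial>M)
      + 2 * (\<integral>x. (f k x - f' x) * f' x \<partial>M) + (\<integral>x. (f' x)\<^sup>2 \<partial>M)" for k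
  proof -
    have "(\<integral>x. (f k x)\<^sup>2 \<partial>M)
        = (\<integral>x. (f k x - f' x)\<^sup>2 + 2 * ((f k x - f' x) * f' x) + (f' x)\<^sup>2 \<partial>M)"
      by (intro Bochner_Integration.integral_cong) (auto simp: power2_eq_square algebra_simps)
    also have "\<dots> = (\<integral>x. (f k x - f' x)\<^sup>2 \<partial>M)
      + 2 * (\<integral>x. (f k x - f' x) * f' x \<partial>M) + (\<integral>x. (f' x)\<^sup>2 \<partial>M)"
      using sq_integrable_integrable[OF d[of k]] sq_integrable_mult[OF d[of k] f]
        sq_integrable_integrable[OF f] by simp
    finally show ?thesis .
  qed
  then show "(\<lambda>k. \<integral>x. (f k x)\<^sup>2 \<partial>M) \<longlonglongrightarrow> (\<integral>x. (f' x)\<^sup>2 \<partial>M)"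
    using tendsto_add[OF tendsto_add[OF lim tendsto_mult[OF tendsto_const[of 2] weak[OF f]]]
        tendsto_const[of "\<integral>x. (f' x)\<^sup>2 \<partial>M"]] by simp
qed

text \<open>A subsequence converges almost everywhere, and by Fatou's lemma its pointwise limit is also the
  limit in the second mean.\<close>

lemma (in finite_measure) L2_Cauchy_imp_convergent_subseq:
  assumes f: "\<And>k. sq_integrable M (f k)"
    and Cauchy: "\<And>e::real. e > 0 \<Longrightarrow> \<exists>n0. \<forall>i\<ge>n0. \<forall>j\<ge>n0. (\<integral>x. (f i x - f j x)\<^sup>2 \<partial>M) < e"
  obtains r g where "strict_mono (r :: nat \<Rightarrow> nat)" "g \<in> borel_measurable M"
    "(\<lambda>k. \<integral>\<^sup>+x. ennreal ((g x - f (r k) x)\<^sup>2) \<partial>M) \<longlonglongrightarrow> 0"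
proof -
  have [measurable]: "f k \<in> borel_measurable M" for k
    by (rule sq_integrable_measurable[OF f])
  have d: "sq_integrable M (\<lambda>x. f i x - f j x)" for i j
    using f f by (rule sq_integrable_diff)
  have L1: "\<exists>n0. \<forall>i\<ge>n0. \<forall>j\<ge>n0. (LINT x|M. norm (f i x - f j x)) < e" if e: "e > 0" for e :: real
  proof -
    \<comment> \<open>The summand \<open>1\<close> keeps the divisor positive when the space is null.\<close>
    define c where "c = measure M (space M) + 1"
    have c: "c > 0" by (simp add: c_def add_nonneg_pos)
    obtain n0 where n0: "(\<integral>x. (f i x - f j x)\<^sup>2 \<partial>M) < e\<^sup>2 / c" if "i \<ge> n0" "j \<ge> n0" for i j
      using Cauchy[of "e\<^sup>2 / c"] e c by auto
    have "(LINT x|M. norm (f i x - f j x)) < e" if "i \<ge> n0" "j \<ge> n0" for i j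
    proof -
      have one: "sq_integrable M (\<lambda>_. 1)" by (simp add: sq_integrable_def)
      have ab: "sq_integrable M (\<lambda>x. \<bar>f i x - f j x\<bar>)"
        using d[of i j] by (auto simp: sq_integrable_def)
      have "(LINT x|M. norm (f i x - f j x))
          \<le> sqrt (\<integral>x. (f i x - f j x)\<^sup>2 \<partial>M) * sqrt (measure M (space M))"
        using Cauchy_Schwarz_integral[OF ab one] by simp
      also have "\<dots> \<le> sqrt (\<integral>x. (f i x - f j x)\<^sup>2 \<partial>M) * sqrt c"
        by (intro mult_left_mono) (auto simp: c_def)
      also have "\<dots> < sqrt (e\<^sup>2 / c) * sqrt c"
        using n0[OF that] c by (intro mult_strict_right_mono) auto
      also have "\<dots> = e" using e c by (simp add: real_sqrt_divide)
      finally show ?thesis .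
    qed
    then show ?thesis by blast
  qed
  obtain r where r: "strict_mono r" and C: "AE x in M. Cauchy (\<lambda>i. f (r i) x)"
    using cauchy_L1_AE_cauchy_subseq[of M f] L1 sq_integrable_imp_integrable[OF f] by blast
  define g where "g x = lim (\<lambda>i. f (r i) x)" for x
  have gm[measurable]: "g \<in> borel_measurable M"
    unfolding g_def by measurable
  have g: "AE x in M. (\<lambda>i. f (r i) x) \<longlonglongrightarrow> g x"
    using C by eventually_elim (auto simp: g_def Cauchy_convergent_iff convergent_LIMSEQ_iff)
  have "(\<lambda>k. \<integral>\<^sup>+x. ennreal ((g x - f (r k) x)\<^sup>2) \<partial>M) \<longlonglongrightarrow> 0"
  proof (rule order_tendstoI)
    fix a :: ennreal assume "0 < a"
    have "\<exists>e>0. ennreal e < a"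
    proof (cases a rule: ennreal_cases)
      case (real s)
      with \<open>0 < a\<close> show ?thesis
        by (intro exI[of _ "s / 2"]) (auto simp: ennreal_less_iff)
    qed (auto intro!: exI[of _ 1] simp: less_top)
    then obtain e where e: "0 < e" "ennreal e < a" by blast
    obtain n0 where n0: "(\<integral>x. (f i x - f j x)\<^sup>2 \<partial>M) < e" if "i \<ge> n0" "j \<ge> n0" for i j
      using Cauchy[OF e(1)] by blast
    have "(\<integral>\<^sup>+x. ennreal ((g x - f (r k) x)\<^sup>2) \<partial>M) < a" if k: "k \<ge> n0" for k
    proof -
      have rk: "r m \<ge> n0" if "m \<ge> n0" for m using seq_suble[OF r, of m] that by simp
      have "(\<integral>\<^sup>+x. ennreal ((g x - f (r k) x)\<^sup>2) \<partial>M)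
          = (\<integral>\<^sup>+x. liminf (\<lambda>m. ennreal ((f (r m) x - f (r k) x)\<^sup>2)) \<partial>M)"
      proof (intro nn_integral_cong_AE, use g in eventually_elim)
        case (elim x)
        have "(\<lambda>m. ennreal ((f (r m) x - f (r k) x)\<^sup>2)) \<longlonglongrightarrow> ennreal ((g x - f (r k) x)\<^sup>2)"
          by (intro tendsto_intros elim)
        then show ?case by (intro lim_imp_Liminf[symmetric]) auto
      qed
      also have "\<dots> \<le> liminf (\<lambda>m. \<integral>\<^sup>+x. ennreal ((f (r m) x - f (r k) x)\<^sup>2) \<partial>M)"
        by (intro nn_integral_liminf) measurable
      also have "\<dots> \<le> limsup (\<lambda>m. \<integral>\<^sup>+x. ennreal ((f (r m) x - f (r k) x)\<^sup>2) \<partial>M)"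
        by (rule Liminf_le_Limsup) auto
      also have "\<dots> \<le> ennreal e"
      proof (rule Limsup_bounded, rule eventually_sequentiallyI[of n0])
        fix m assume "n0 \<le> m"
        then show "(\<integral>\<^sup>+x. ennreal ((f (r m) x - f (r k) x)\<^sup>2) \<partial>M) \<le> ennreal e"
          using n0[OF rk rk[OF k], of m] sq_integrable_integrable[OF d[of "r m" "r k"]]
          by (subst nn_integral_eq_integral) (auto intro: ennreal_leI less_imp_le)
      qed
      finally show ?thesis using e(2) by simp
    qed
    then show "eventually (\<lambda>k. (\<integral>\<^sup>+x. ennreal ((g x - f (r k) x)\<^sup>2) \<partial>M) < a) sequentially"
      by (auto simp: eventually_sequentially)
  qed auto
  from that[OF r gm this] show ?thesis .
qed

section \<open>Increments of the Wiener and the Poisson process\<close>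

lemma
  fixes f :: "nat \<Rightarrow> real"
  assumes "summable (\<lambda>n. \<bar>pmf p n * f n\<bar>)"
  shows integrable_measure_pmf_nat: "integrable (measure_pmf p) f"
    and integral_measure_pmf_nat: "integral\<^sup>L (measure_pmf p) f = (\<Sum>n. pmf p n * f n)"
proof -
  have i: "integrable (count_space UNIV) (\<lambda>n. pmf p n * f n)"
    using assms by (simp add: integrable_count_space_nat_iff)
  then show "integrable (measure_pmf p) f"
    unfolding measure_pmf_eq_density by (subst integrable_density) auto
  show "integral\<^sup>L (measure_pmf p) f = (\<Sum>n. pmf p n * f n)"
    unfolding measure_pmf_eq_density using i
    by (subst integral_density) (auto simp: integral_count_space_nat)
qed

lemma
  fixes f :: "nat \<Rightarrow> real"
  assumes "\<And>n. 0 \<le> f n" "(\<lambda>n. pmf p n * f n) sums c"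
  shows integrable_measure_pmf_nat_sums: "integrable (measure_pmf p) f"
    and integral_measure_pmf_nat_sums: "integral\<^sup>L (measure_pmf p) f = c"
  using integrable_measure_pmf_nat[of p f] integral_measure_pmf_nat[of p f] assms
  by (auto simp: sums_iff)

lemma divide_fact_Suc_mult: "x / fact (Suc n) * real (Suc n) = (x / fact n :: real)"
  by (simp del: of_nat_Suc)

context
  fixes r :: real
  assumes r: "0 < r"
begin

lemma poisson_pmf_first_moment_sums: "(\<lambda>n. pmf (poisson_pmf r) n * real n) sums r"
proof -
  have "(\<lambda>n. pmf (poisson_pmf r) (Suc n) * real (Suc n)) = (\<lambda>n. r * exp (- r) * (r ^ n /\<^sub>R fact n))"
    unfolding pmf_poisson[OF r] using divide_fact_Suc_mult[of "r * r ^ n" n for n]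
    by (simp add: fun_eq_iff divide_inverse mult_ac del: fact_Suc of_nat_Suc)
  moreover have "(\<lambda>n. r * exp (- r) * (r ^ n /\<^sub>R fact n)) sums (r * exp (- r) * exp r)"
    by (intro sums_mult exp_converges)
  ultimately have "(\<lambda>n. pmf (poisson_pmf r) (Suc n) * real (Suc n)) sums r"
    by (simp only: mult_exp_exp mult.assoc) simp
  from this[unfolded sums_Suc_iff[of "\<lambda>n. pmf (poisson_pmf r) n * real n"]] show ?thesis
    by simp
qed

lemma poisson_pmf_second_moment_sums: "(\<lambda>n. pmf (poisson_pmf r) n * (real n)\<^sup>2) sums (r + r\<^sup>2)"
proof -
  let ?g = "\<lambda>n. pmf (poisson_pmf r) n * (real n * (real n - 1))"
  have "(\<lambda>n. ?g (Suc (Suc n))) = (\<lambda>n. r\<^sup>2 * exp (- r) * (r ^ n /\<^sub>R fact n))"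
  proof
    fix n
    have "?g (Suc (Suc n)) = exp (- r) * (r\<^sup>2 * r ^ n / fact (Suc (Suc n)) * real (Suc (Suc n)) * real (Suc n))"
      using r by (simp add: power2_eq_square del: fact_Suc)
    also have "\<dots> = r\<^sup>2 * exp (- r) * (r ^ n /\<^sub>R fact n)"
      unfolding divide_fact_Suc_mult by (simp add: divide_inverse mult_ac)
    finally show "?g (Suc (Suc n)) = r\<^sup>2 * exp (- r) * (r ^ n /\<^sub>R fact n)" .
  qed
  moreover have "(\<lambda>n. r\<^sup>2 * exp (- r) * (r ^ n /\<^sub>R fact n)) sums (r\<^sup>2 * exp (- r) * exp r)"
    by (intro sums_mult exp_converges)
  ultimately have "(\<lambda>n. ?g (Suc (Suc n))) sums r\<^sup>2"
    by (simp only: mult_exp_exp mult.assoc) simp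
  from this[unfolded sums_Suc_iff[of "\<lambda>n. ?g (Suc n)"] sums_Suc_iff[of ?g]] have "?g sums r\<^sup>2"
    by simp
  from sums_add[OF poisson_pmf_first_moment_sums this] show ?thesis
    by (simp add: algebra_simps power2_eq_square)
qed

end

text \<open>Independence of a \<sigma>-algebra and a random variable in terms of generated \<sigma>-algebras is turned here into
independence of random variables, the form in which expectations of products can be computed.  The
function \<open>f\<close> allows values outside the reals, such as complex exponentials.\<close>

lemma (in prob_space) indep_var_of_indep_set:
  assumes indep: "indep_set (sets G) (sets (vimage_algebra (space M) X borel))"
    and G: "space G = space M" "sets G \<subseteq> sets M"
    and X: "X \<in> borel_measurable M" and Z: "Z \<in> measurable G S" and f: "f \<in> measurable borel S'"
  shows "indep_var S Z S' (\<lambda>\<omega>. f (X \<omega>))"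
proof -
  have Z': "random_variable S Z"
    by (rule measurable_mono[THEN subsetD, OF _ _ _ _ Z]) (use G in auto)
  have "sigma_sets (space M) {Z -` A \<inter> space M | A. A \<in> sets S} \<subseteq> sets G"
    using sets.sigma_sets_subset[of "{Z -` A \<inter> space M | A. A \<in> sets S}" G] measurable_sets[OF Z] G
    by auto
  moreover have "{(\<lambda>\<omega>. f (X \<omega>)) -` A \<inter> space M | A. A \<in> sets S'}
      \<subseteq> sets (vimage_algebra (space M) X borel)"
  proof safe
    fix A assume "A \<in> sets S'"
    then have "f -` A \<inter> space borel \<in> sets borel" by (rule measurable_sets[OF f])
    then have "X -` (f -` A) \<inter> space M \<in> sets (vimage_algebra (space M) X borel)"
      by (intro in_vimage_algebra) simp
    then show "(\<lambda>\<omega>. f (X \<omega>)) -` A \<inter> space M \<in> sets (vimage_algebra (space M) X borel)"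
      by (simp add: vimage_def)
  qed
  then have "sigma_sets (space M) {(\<lambda>\<omega>. f (X \<omega>)) -` A \<inter> space M | A. A \<in> sets S'}
      \<subseteq> sets (vimage_algebra (space M) X borel)"
    using sets.sigma_sets_subset[of _ "vimage_algebra (space M) X borel"] by simp
  ultimately have "indep_set (sigma_sets (space M) {Z -` A \<inter> space M | A. A \<in> sets S})
      (sigma_sets (space M) {(\<lambda>\<omega>. f (X \<omega>)) -` A \<inter> space M | A. A \<in> sets S'})"
    unfolding indep_set_def
    by (intro indep_sets_mono_sets[OF indep[unfolded indep_set_def]]) (simp split: bool.split)
  then show ?thesis
    unfolding indep_var_eq using Z' measurable_compose[OF X f] by blast
qed

locale wiener_poisson = filtered_prob_space M F
  for M :: "'a measure" and F :: "real \<Rightarrow> 'a measure" +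
  fixes W N :: "real \<Rightarrow> 'a \<Rightarrow> real" and T rate :: real
  assumes T_pos: "0 < T" and rate_pos: "0 < rate"
    and wiener: "wiener_process M F T W" and poisson: "poisson_process M F T rate N"
begin

lemma measurable_F_mono:
  assumes "f \<in> measurable (F s) S" "s \<le> t"
  shows "f \<in> measurable (F t) S"
  by (rule measurable_mono[THEN subsetD, OF _ _ _ _ assms(1)]) (use assms sets_F_mono space_F in auto)

lemma measurable_F_imp_M:
  assumes "f \<in> measurable (F s) S" "0 \<le> s"
  shows "f \<in> measurable M S"
  by (rule measurable_mono[THEN subsetD, OF _ _ _ _ assms(1)]) (use assms sets_F_subset space_F in auto)

lemma W_measurable_F: "0 \<le> s \<Longrightarrow> s \<le> t \<Longrightarrow> s \<le> T \<Longrightarrow> W s \<in> borel_measurable (F t)"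
  using wiener measurable_F_mono[of "W s" s borel t] by (auto simp: wiener_process_def adapted_on_def)

lemma N_measurable_F: "0 \<le> s \<Longrightarrow> s \<le> t \<Longrightarrow> s \<le> T \<Longrightarrow> N s \<in> borel_measurable (F t)"
  using poisson measurable_F_mono[of "N s" s borel t] by (auto simp: poisson_process_def adapted_on_def)

lemma W_measurable: "0 \<le> s \<Longrightarrow> s \<le> T \<Longrightarrow> W s \<in> borel_measurable M"
  using W_measurable_F[of s s] measurable_F_imp_M by auto

lemma N_measurable: "0 \<le> s \<Longrightarrow> s \<le> T \<Longrightarrow> N s \<in> borel_measurable M"
  using N_measurable_F[of s s] measurable_F_imp_M by auto

lemma W_0: "AE \<omega> in M. W 0 \<omega> = 0"
  using wiener by (simp add: wiener_process_def)

lemma N_0: "AE \<omega> in M. N 0 \<omega> = 0"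
  using poisson by (simp add: poisson_process_def)

lemma indep_var_past_W:
  assumes "0 \<le> s" "s < t" "t \<le> T" "Z \<in> measurable (F s) S" "f \<in> measurable borel S'"
  shows "indep_var S Z S' (\<lambda>\<omega>. f (W t \<omega> - W s \<omega>))"
proof (rule indep_var_of_indep_set[where G="F s"])
  show "indep_set (sets (F s)) (sets (vimage_algebra (space M) (\<lambda>\<omega>. W t \<omega> - W s \<omega>) borel))"
    using wiener assms by (auto simp: wiener_process_def increments_independent_def)
qed (use assms sets_F_subset space_F W_measurable in auto)

lemma indep_var_past_N:
  assumes "0 \<le> s" "s < t" "t \<le> T" "Z \<in> measurable (F s) S" "f \<in> measurable borel S'"
  shows "indep_var S Z S' (\<lambda>\<omega>. f (N t \<omega> - N s \<omega>))"
proof (rule indep_var_of_indep_set[where G="F s"])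
  show "indep_set (sets (F s)) (sets (vimage_algebra (space M) (\<lambda>\<omega>. N t \<omega> - N s \<omega>) borel))"
    using poisson assms by (auto simp: poisson_process_def increments_independent_def)
qed (use assms sets_F_subset space_F N_measurable in auto)

context
  fixes s t :: real
  assumes st: "0 \<le> s" "s < t" "t \<le> T"
begin

lemma W_incr_measurable: "(\<lambda>\<omega>. W t \<omega> - W s \<omega>) \<in> borel_measurable M"
  using W_measurable st by auto

lemma N_incr_measurable: "(\<lambda>\<omega>. N t \<omega> - N s \<omega>) \<in> borel_measurable M"
  using N_measurable st by auto

lemma W_incr_distributed:
  "distributed M lborel (\<lambda>\<omega>. W t \<omega> - W s \<omega>) (normal_density 0 (sqrt (t - s)))"
  using wiener st by (auto simp: wiener_process_def)

lemma W_incr_even_moment: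
  "has_bochner_integral M (\<lambda>\<omega>. (W t \<omega> - W s \<omega>) ^ (2 * k)) (fact (2 * k) / ((2 / (t - s)) ^ k * fact k))"
proof -
  have *: "has_bochner_integral lborel (\<lambda>x. normal_density 0 (sqrt (t - s)) x * x ^ (2 * k))
      (fact (2 * k) / ((2 / (t - s)) ^ k * fact k))"
    using normal_moment_even[of "sqrt (t - s)" 0 k] st by simp
  show ?thesis
    unfolding has_bochner_integral_iff
    using distributed_integrable[OF W_incr_distributed, of "\<lambda>x. x ^ (2 * k)"]
      distributed_integral[OF W_incr_distributed, of "\<lambda>x. x ^ (2 * k)"] *
    by (auto simp: has_bochner_integral_iff)
qed

lemma W_incr_first_moment: "has_bochner_integral M (\<lambda>\<omega>. W t \<omega> - W s \<omega>) 0"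
proof -
  have "has_bochner_integral lborel (\<lambda>x. normal_density 0 (sqrt (t - s)) x * x) 0"
    using normal_moment_nz_1[of "sqrt (t - s)" 0] st by simp
  then show ?thesis
    unfolding has_bochner_integral_iff
    using distributed_integrable[OF W_incr_distributed, of "\<lambda>x. x"]
      distributed_integral[OF W_incr_distributed, of "\<lambda>x. x"]
    by (auto simp: has_bochner_integral_iff)
qed

lemma W_incr_second_moment: "has_bochner_integral M (\<lambda>\<omega>. (W t \<omega> - W s \<omega>)\<^sup>2) (t - s)"
  using W_incr_even_moment[of 1] by (simp add: diff_divide_distrib)

lemma W_incr_fourth_moment: "has_bochner_integral M (\<lambda>\<omega>. (W t \<omega> - W s \<omega>) ^ 4) (3 * (t - s)\<^sup>2)"
proof -
  have "fact (2 * 2) / ((2 / (t - s)) ^ 2 * fact 2) = 3 * (t - s)\<^sup>2"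
    using st by (simp add: field_simps power2_eq_square fact_numeral)
  then show ?thesis using W_incr_even_moment[of 2] by simp
qed

lemma N_incr_distr:
  "distr M borel (\<lambda>\<omega>. N t \<omega> - N s \<omega>) = distr (measure_pmf (poisson_pmf (rate * (t - s)))) borel real"
  using poisson st by (auto simp: poisson_process_def)

lemma N_incr_integrable_iff:
  fixes f :: "real \<Rightarrow> real"
  assumes [measurable]: "f \<in> borel_measurable borel"
  shows "integrable M (\<lambda>\<omega>. f (N t \<omega> - N s \<omega>))
    \<longleftrightarrow> integrable (measure_pmf (poisson_pmf (rate * (t - s)))) (\<lambda>n. f (real n))"
  using integrable_distr_eq[OF N_incr_measurable assms]
    integrable_distr_eq[of real "measure_pmf (poisson_pmf (rate * (t - s)))" borel f]
  by (simp add: N_incr_distr)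

lemma N_incr_integral:
  fixes f :: "real \<Rightarrow> real"
  assumes [measurable]: "f \<in> borel_measurable borel"
  shows "(\<integral>\<omega>. f (N t \<omega> - N s \<omega>) \<partial>M)
    = (\<integral>n. f (real n) \<partial>measure_pmf (poisson_pmf (rate * (t - s))))"
  using integral_distr[OF N_incr_measurable assms]
    integral_distr[of real "measure_pmf (poisson_pmf (rate * (t - s)))" borel f]
  by (simp add: N_incr_distr)

lemma N_incr_first_moment: "has_bochner_integral M (\<lambda>\<omega>. N t \<omega> - N s \<omega>) (rate * (t - s))"
proof -
  have "0 < rate * (t - s)" using st rate_pos by simp
  from poisson_pmf_first_moment_sums[OF this] show ?thesis
    unfolding has_bochner_integral_iff
    using N_incr_integrable_iff[of "\<lambda>x. x"] N_incr_integral[of "\<lambda>x. x"]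
      integrable_measure_pmf_nat_sums[of real] integral_measure_pmf_nat_sums[of real]
    by auto
qed

lemma N_incr_second_moment:
  "has_bochner_integral M (\<lambda>\<omega>. (N t \<omega> - N s \<omega>)\<^sup>2) (rate * (t - s) + (rate * (t - s))\<^sup>2)"
proof -
  have "0 < rate * (t - s)" using st rate_pos by simp
  from poisson_pmf_second_moment_sums[OF this] show ?thesis
    unfolding has_bochner_integral_iff
    using N_incr_integrable_iff[of "\<lambda>x. x\<^sup>2"] N_incr_integral[of "\<lambda>x. x\<^sup>2"]
      integrable_measure_pmf_nat_sums[of "\<lambda>n. (real n)\<^sup>2"]
      integral_measure_pmf_nat_sums[of "\<lambda>n. (real n)\<^sup>2"]
    by auto
qed

lemma N_incr_nat: "AE \<omega> in M. N t \<omega> - N s \<omega> \<in> \<nat>"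
proof -
  have [measurable]: "(\<nat> :: real set) \<in> sets borel"
    by (metis Nats_def borel_closed closed_of_nat_image)
  have "AE x in distr M borel (\<lambda>\<omega>. N t \<omega> - N s \<omega>). x \<in> \<nat>"
    unfolding N_incr_distr by (subst AE_distr_iff) auto
  then show ?thesis
    by (subst (asm) AE_distr_iff) (use N_incr_measurable in auto)
qed

lemma W_incr_sq_integrable: "sq_integrable M (\<lambda>\<omega>. W t \<omega> - W s \<omega>)"
  using W_incr_measurable W_incr_second_moment by (auto simp: sq_integrable_def has_bochner_integral_iff)

lemma N_incr_sq_integrable: "sq_integrable M (\<lambda>\<omega>. N t \<omega> - N s \<omega>)"
  using N_incr_measurable N_incr_second_moment by (auto simp: sq_integrable_def has_bochner_integral_iff)

end

lemma N_sq_integrable: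
  assumes "0 \<le> s" "s \<le> T"
  shows "sq_integrable M (N s)"
proof (cases "s = 0")
  case True
  then show ?thesis
    using sq_integrable_cong_AE[OF sq_integrable_zero, of "N 0" M] N_0 N_measurable[of 0] T_pos
    by (auto elim: AE_mp)
next
  case False
  then show ?thesis
    using sq_integrable_cong_AE[OF N_incr_sq_integrable[of 0 s], of "N s"] N_0 N_measurable[of s] assms
    by (auto elim: AE_mp)
qed

end

section \<open>Independence of the two processes\<close>

lemma (in prob_space) expectation_square_le:
  fixes f :: "'a \<Rightarrow> real"
  assumes "integrable M f" "integrable M (\<lambda>x. (f x)\<^sup>2)"
  shows "(expectation f)\<^sup>2 \<le> expectation (\<lambda>x. (f x)\<^sup>2)"
  using variance_eq[OF assms] variance_positive[of f] by simp

context wiener_poisson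
begin

context
  fixes s t :: real
  assumes st: "0 \<le> s" "s < t" "t \<le> T"
begin

lemma N_incr_nonneg: "AE \<omega> in M. 0 \<le> N t \<omega> - N s \<omega>"
  using N_incr_nat[OF st] by eventually_elim (auto simp: Nats_def)

lemma expectation_N_Laplace_bounds:
  assumes "0 \<le> \<theta>"
  shows "0 \<le> expectation (\<lambda>\<omega>. exp (- \<theta> * (N t \<omega> - N s \<omega>)))"
    and "expectation (\<lambda>\<omega>. exp (- \<theta> * (N t \<omega> - N s \<omega>))) \<le> 1"
    and "1 - expectation (\<lambda>\<omega>. exp (- \<theta> * (N t \<omega> - N s \<omega>))) \<le> \<theta> * rate * (t - s)"
    and "integrable M (\<lambda>\<omega>. exp (- \<theta> * (N t \<omega> - N s \<omega>)))"
proof -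
  note [measurable] = N_incr_measurable[OF st]
  let ?Y = "\<lambda>\<omega>. exp (- \<theta> * (N t \<omega> - N s \<omega>))"
  show i: "integrable M ?Y"
  proof (rule integrable_const_bound[where B=1])
    show "AE \<omega> in M. norm (?Y \<omega>) \<le> 1"
      using N_incr_nonneg by eventually_elim (use assms in simp)
  qed measurable
  show "0 \<le> expectation ?Y" by (intro integral_nonneg_AE) auto
  have "expectation ?Y \<le> (\<integral>\<omega>. 1 \<partial>M)"
    using N_incr_nonneg assms i by (intro integral_mono_AE) auto
  then show "expectation ?Y \<le> 1" by (simp add: prob_space)
  have "1 - expectation ?Y = (\<integral>\<omega>. 1 - ?Y \<omega> \<partial>M)"
    using i by (simp add: prob_space)
  also have "\<dots> \<le> (\<integral>\<omega>. \<theta> * (N t \<omega> - N s \<omega>) \<partial>M)"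
  proof (intro integral_mono_AE AE_I2)
    show "1 - ?Y \<omega> \<le> \<theta> * (N t \<omega> - N s \<omega>)" for \<omega>
      using exp_ge_add_one_self[of "- \<theta> * (N t \<omega> - N s \<omega>)"] by simp
  qed (use i N_incr_first_moment[OF st] in \<open>auto simp: has_bochner_integral_iff\<close>)
  also have "\<dots> = \<theta> * rate * (t - s)"
    using N_incr_first_moment[OF st] by (simp add: has_bochner_integral_iff)
  finally show "1 - expectation ?Y \<le> \<theta> * rate * (t - s)" .
qed

text \<open>The second moment of the deviation is only of order \<open>t - s\<close>, which does not suffice when the
contributions of all cells of a fine partition are added up; the fourth moment is of order \<open>(t - s)\<^sup>2\<close>.\<close>

lemma expectation_iexp_W_deviation:
  fixes u :: real
  defines "a \<equiv> (\<integral>\<omega>. iexp (u * (W t \<omega> - W s \<omega>)) \<partial>M)"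
  shows "(\<integral>\<omega>. cmod (iexp (u * (W t \<omega> - W s \<omega>)) - a) ^ 4 \<partial>M) \<le> 48 * u ^ 4 * (t - s)\<^sup>2"
    and "cmod a \<le> 1"
proof -
  have [measurable]: "W s \<in> borel_measurable M" "W t \<in> borel_measurable M"
    using W_measurable st by auto
  let ?X = "\<lambda>\<omega>. iexp (u * (W t \<omega> - W s \<omega>))"
  have iX: "integrable M ?X"
    by (rule integrable_const_bound[where B=1]) auto
  have i4: "integrable M (\<lambda>\<omega>. (u * (W t \<omega> - W s \<omega>)) ^ 4)"
    and e4: "(\<integral>\<omega>. (u * (W t \<omega> - W s \<omega>)) ^ 4 \<partial>M) = u ^ 4 * (3 * (t - s)\<^sup>2)"
    using W_incr_fourth_moment[OF st] by (auto simp: has_bochner_integral_iff power_mult_distrib)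
  have "cmod a \<le> (\<integral>\<omega>. cmod (?X \<omega>) \<partial>M)"
    unfolding a_def by (rule integral_norm_bound)
  then show a1: "cmod a \<le> 1" by (simp add: prob_space)
  have b1: "cmod (?X \<omega> - 1) \<le> \<bar>u * (W t \<omega> - W s \<omega>)\<bar>" for \<omega>
    using iexp_approx1[of "u * (W t \<omega> - W s \<omega>)" 0] by simp
  have i4b: "integrable M (\<lambda>\<omega>. cmod (?X \<omega> - 1) ^ 4)"
    by (rule integrable_const_bound[where B="2 ^ 4"])
      (auto intro!: power_mono norm_triangle_ineq4[THEN order_trans] simp del: power_numeral)
  have "(\<integral>\<omega>. cmod (?X \<omega> - 1) ^ 4 \<partial>M) \<le> (\<integral>\<omega>. (u * (W t \<omega> - W s \<omega>)) ^ 4 \<partial>M)"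
  proof (intro integral_mono i4 i4b)
    fix \<omega>
    have "cmod (?X \<omega> - 1) ^ 4 \<le> \<bar>u * (W t \<omega> - W s \<omega>)\<bar> ^ 4"
      by (intro power_mono b1) auto
    then show "cmod (?X \<omega> - 1) ^ 4 \<le> (u * (W t \<omega> - W s \<omega>)) ^ 4"
      by (simp add: power_even_abs)
  qed
  then have m4: "(\<integral>\<omega>. cmod (?X \<omega> - 1) ^ 4 \<partial>M) \<le> u ^ 4 * (3 * (t - s)\<^sup>2)"
    using e4 by simp
  have four: "(x + y) ^ 4 \<le> 8 * (x ^ 4 + y ^ 4)" for x y :: real
  proof -
    have "(x + y)\<^sup>2 \<le> 2 * (x\<^sup>2 + y\<^sup>2)"
      using sum_squares_bound[of x y] by (simp add: power2_sum)
    then have "((x + y)\<^sup>2)\<^sup>2 \<le> (2 * (x\<^sup>2 + y\<^sup>2))\<^sup>2"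
      by (intro power_mono) auto
    also have "\<dots> = 4 * (x\<^sup>2 + y\<^sup>2)\<^sup>2" by (simp only: power_mult_distrib) simp
    also have "\<dots> \<le> 4 * (2 * ((x\<^sup>2)\<^sup>2 + (y\<^sup>2)\<^sup>2))"
      using sum_squares_bound[of "x\<^sup>2" "y\<^sup>2"] by (simp add: power2_sum)
    finally show ?thesis by simp
  qed
  \<comment> \<open>Jensen's inequality for the fourth power, obtained by applying Jensen's inequality for squares twice.\<close>
  have "cmod (1 - a) ^ 4 \<le> (\<integral>\<omega>. cmod (?X \<omega> - 1) ^ 4 \<partial>M)"
  proof -
    have "1 - a = (\<integral>\<omega>. 1 - ?X \<omega> \<partial>M)" using iX by (simp add: a_def prob_space)
    then have "cmod (1 - a) \<le> (\<integral>\<omega>. cmod (1 - ?X \<omega>) \<partial>M)"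
      using integral_norm_bound[of M "\<lambda>\<omega>. 1 - ?X \<omega>"] by simp
    then have "cmod (1 - a) \<le> (\<integral>\<omega>. cmod (?X \<omega> - 1) \<partial>M)" by (simp add: norm_minus_commute)
    then have "cmod (1 - a) ^ 4 \<le> (\<integral>\<omega>. cmod (?X \<omega> - 1) \<partial>M) ^ 4"
      by (intro power_mono) auto
    also have "\<dots> = ((\<integral>\<omega>. cmod (?X \<omega> - 1) \<partial>M)\<^sup>2)\<^sup>2" by simp
    also have "\<dots> \<le> (\<integral>\<omega>. (cmod (?X \<omega> - 1))\<^sup>2 \<partial>M)\<^sup>2"
    proof (intro power_mono)
      have "integrable M (\<lambda>\<omega>. cmod (?X \<omega> - 1))"
        using iX by auto
      moreover have "integrable M (\<lambda>\<omega>. (cmod (?X \<omega> - 1))\<^sup>2)"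
        by (rule integrable_const_bound[where B="2 ^ 2"])
          (auto intro!: power_mono norm_triangle_ineq4[THEN order_trans] simp del: power_numeral)
      ultimately show "(\<integral>\<omega>. cmod (?X \<omega> - 1) \<partial>M)\<^sup>2 \<le> (\<integral>\<omega>. (cmod (?X \<omega> - 1))\<^sup>2 \<partial>M)"
        by (rule expectation_square_le)
    qed auto
    also have "\<dots> \<le> (\<integral>\<omega>. ((cmod (?X \<omega> - 1))\<^sup>2)\<^sup>2 \<partial>M)"
    proof -
      have "integrable M (\<lambda>\<omega>. (cmod (?X \<omega> - 1))\<^sup>2)"
        by (rule integrable_const_bound[where B="2 ^ 2"])
          (auto intro!: power_mono norm_triangle_ineq4[THEN order_trans] simp del: power_numeral)
      then show ?thesis
        by (rule expectation_square_le) (use i4b in simp)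
    qed
    also have "\<dots> = (\<integral>\<omega>. cmod (?X \<omega> - 1) ^ 4 \<partial>M)" by simp
    finally show ?thesis .
  qed
  then have a4: "cmod (1 - a) ^ 4 \<le> u ^ 4 * (3 * (t - s)\<^sup>2)" using m4 by simp
  have "(\<integral>\<omega>. cmod (?X \<omega> - a) ^ 4 \<partial>M) \<le> (\<integral>\<omega>. 8 * (cmod (?X \<omega> - 1) ^ 4 + cmod (1 - a) ^ 4) \<partial>M)"
  proof (intro integral_mono)
    show "integrable M (\<lambda>\<omega>. cmod (?X \<omega> - a) ^ 4)"
      by (rule integrable_const_bound[where B="2 ^ 4"])
        (use a1 in \<open>auto intro!: power_mono norm_triangle_ineq4[THEN order_trans] simp del: power_numeral\<close>)
    show "integrable M (\<lambda>\<omega>. 8 * (cmod (?X \<omega> - 1) ^ 4 + cmod (1 - a) ^ 4))"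
      using i4b by auto
    fix \<omega>
    have "cmod (?X \<omega> - a) \<le> cmod (?X \<omega> - 1) + cmod (1 - a)"
      using norm_triangle_ineq[of "?X \<omega> - 1" "1 - a"] by simp
    then have "cmod (?X \<omega> - a) ^ 4 \<le> (cmod (?X \<omega> - 1) + cmod (1 - a)) ^ 4"
      by (intro power_mono) auto
    also note four
    finally show "cmod (?X \<omega> - a) ^ 4 \<le> 8 * (cmod (?X \<omega> - 1) ^ 4 + cmod (1 - a) ^ 4)" .
  qed
  also have "\<dots> = 8 * ((\<integral>\<omega>. cmod (?X \<omega> - 1) ^ 4 \<partial>M) + cmod (1 - a) ^ 4)"
    using i4b by (simp add: prob_space)
  also have "\<dots> \<le> 8 * (u ^ 4 * (3 * (t - s)\<^sup>2) + u ^ 4 * (3 * (t - s)\<^sup>2))"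
    using m4 a4 by (intro mult_left_mono add_mono) auto
  also have "\<dots> = 48 * u ^ 4 * (t - s)\<^sup>2" by simp
  finally show "(\<integral>\<omega>. cmod (?X \<omega> - a) ^ 4 \<partial>M) \<le> 48 * u ^ 4 * (t - s)\<^sup>2" .
qed

text \<open>Since \<open>X\<close> and \<open>Y\<close> are separately independent of the past \<open>Z\<close>, only the product of their deviations from the
means survives.  The deviation of \<open>Y\<close> is of order \<open>t - s\<close> in the mean, the deviation of \<open>X\<close> is at most \<open>\<epsilon>\<close>
or else dominated by its fourth power over \<open>\<epsilon>\<^sup>3\<close>.  For fixed \<open>\<epsilon>\<close>, the bound is \<open>\<epsilon>\<close> times a multiple of \<open>t - s\<close>, up to a term
of second order in \<open>t - s\<close>.\<close>

lemma joint_transform_step: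
  fixes u \<theta> \<epsilon> :: real and Z :: "'a \<Rightarrow> complex"
  assumes Z: "Z \<in> borel_measurable (F s)" "AE \<omega> in M. cmod (Z \<omega>) \<le> 1"
    and \<theta>: "0 \<le> \<theta>" and \<epsilon>: "0 < \<epsilon>"
  defines "X \<equiv> \<lambda>\<omega>. iexp (u * (W t \<omega> - W s \<omega>))"
    and "Y \<equiv> \<lambda>\<omega>. exp (- \<theta> * (N t \<omega> - N s \<omega>))"
  shows "cmod ((\<integral>\<omega>. Z \<omega> * (X \<omega> * of_real (Y \<omega>)) \<partial>M)
      - (\<integral>\<omega>. Z \<omega> \<partial>M) * ((\<integral>\<omega>. X \<omega> \<partial>M) * of_real (expectation Y)))
    \<le> 2 * \<epsilon> * \<theta> * rate * (t - s) + 96 * u ^ 4 * (t - s)\<^sup>2 / \<epsilon> ^ 3"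
proof -
  note [measurable] = W_incr_measurable[OF st] N_incr_measurable[OF st]
    measurable_F_imp_M[OF Z(1) st(1)]
  define a where "a = (\<integral>\<omega>. X \<omega> \<partial>M)"
  define b where "b = expectation Y"
  have [measurable]: "X \<in> borel_measurable M" "Y \<in> borel_measurable M"
    unfolding X_def Y_def by measurable
  have b01: "0 \<le> b" "b \<le> 1" "1 - b \<le> \<theta> * rate * (t - s)" and iY: "integrable M Y"
    using expectation_N_Laplace_bounds[OF \<theta>] by (auto simp: b_def Y_def)
  have a1: "cmod a \<le> 1" and a4: "(\<integral>\<omega>. cmod (X \<omega> - a) ^ 4 \<partial>M) \<le> 48 * u ^ 4 * (t - s)\<^sup>2"
    using expectation_iexp_W_deviation[of u] by (auto simp: a_def X_def)
  have Y1: "AE \<omega> in M. 0 \<le> Y \<omega> \<and> Y \<omega> \<le> 1"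
    using N_incr_nonneg by eventually_elim (use \<theta> in \<open>simp add: Y_def\<close>)
  have X1: "cmod (X \<omega>) = 1" for \<omega> by (simp add: X_def)
  have iZ: "integrable M Z"
    using Z(2) by (intro integrable_const_bound[where B=1]) auto
  have iX: "integrable M X"
    by (intro integrable_const_bound[where B=1]) (auto simp: X1)
  have iXa: "integrable M (\<lambda>\<omega>. cmod (X \<omega> - a) ^ 4)"
    by (rule integrable_const_bound[where B="2 ^ 4"])
      (use a1 X1 in \<open>auto intro!: power_mono norm_triangle_ineq4[THEN order_trans] simp del: power_numeral\<close>)
  have iYc: "integrable M (\<lambda>\<omega>. complex_of_real (Y \<omega>))" using iY by auto
  have ZX: "indep_var borel Z borel X"
    unfolding X_def by (rule indep_var_past_W[OF st Z(1)]) measurable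
  have ZY: "indep_var borel Z borel (\<lambda>\<omega>. complex_of_real (Y \<omega>))"
    unfolding Y_def by (rule indep_var_past_N[OF st Z(1)]) measurable
  have eZX: "(\<integral>\<omega>. Z \<omega> * X \<omega> \<partial>M) = (\<integral>\<omega>. Z \<omega> \<partial>M) * a"
    unfolding a_def by (rule indep_var_lebesgue_integral[OF ZX iZ iX])
  have eZY: "(\<integral>\<omega>. Z \<omega> * of_real (Y \<omega>) \<partial>M) = (\<integral>\<omega>. Z \<omega> \<partial>M) * of_real b"
    using indep_var_lebesgue_integral[OF ZY iZ iYc] by (simp add: b_def)
  have iZX: "integrable M (\<lambda>\<omega>. Z \<omega> * X \<omega>)" by (rule indep_var_integrable[OF ZX iZ iX])
  have iZY: "integrable M (\<lambda>\<omega>. Z \<omega> * of_real (Y \<omega>))" by (rule indep_var_integrable[OF ZY iZ iYc])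
  have iZXY: "integrable M (\<lambda>\<omega>. Z \<omega> * (X \<omega> * of_real (Y \<omega>)))"
  proof (rule integrable_const_bound[where B=1])
    show "AE \<omega> in M. cmod (Z \<omega> * (X \<omega> * of_real (Y \<omega>))) \<le> 1"
      using Z(2) Y1 by eventually_elim (auto simp: norm_mult X1 mult_le_one)
  qed measurable
  have "(\<integral>\<omega>. Z \<omega> * ((X \<omega> - a) * of_real (Y \<omega> - b)) \<partial>M)
      = (\<integral>\<omega>. Z \<omega> * (X \<omega> * of_real (Y \<omega>)) - a * (Z \<omega> * of_real (Y \<omega>)) - of_real b * (Z \<omega> * X \<omega>)
          + of_real b * a * Z \<omega> \<partial>M)"
    by (intro Bochner_Integration.integral_cong) (auto simp: algebra_simps)
  also have "\<dots> = (\<integral>\<omega>. Z \<omega> * (X \<omega> * of_real (Y \<omega>)) \<partial>M) - a * (\<integral>\<omega>. Z \<omega> * of_real (Y \<omega>) \<partial>M)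
      - of_real b * (\<integral>\<omega>. Z \<omega> * X \<omega> \<partial>M) + of_real b * a * (\<integral>\<omega>. Z \<omega> \<partial>M)"
    using iZXY iZY iZX iZ by simp
  also have "\<dots> = (\<integral>\<omega>. Z \<omega> * (X \<omega> * of_real (Y \<omega>)) \<partial>M) - (\<integral>\<omega>. Z \<omega> \<partial>M) * (a * of_real b)"
    unfolding eZX eZY by (simp add: algebra_simps)
  finally have key: "(\<integral>\<omega>. Z \<omega> * (X \<omega> * of_real (Y \<omega>)) \<partial>M) - (\<integral>\<omega>. Z \<omega> \<partial>M) * (a * of_real b)
      = (\<integral>\<omega>. Z \<omega> * ((X \<omega> - a) * of_real (Y \<omega> - b)) \<partial>M)" by simp
  let ?R = "\<lambda>\<omega>. \<epsilon> * (1 - Y \<omega>) + \<epsilon> * (1 - b) + 2 * (cmod (X \<omega> - a) ^ 4 / \<epsilon> ^ 3)"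
  have "cmod (\<integral>\<omega>. Z \<omega> * ((X \<omega> - a) * of_real (Y \<omega> - b)) \<partial>M)
      \<le> (\<integral>\<omega>. cmod (Z \<omega> * ((X \<omega> - a) * of_real (Y \<omega> - b))) \<partial>M)"
    by (rule integral_norm_bound)
  also have "\<dots> \<le> (\<integral>\<omega>. ?R \<omega> \<partial>M)"
  proof (rule integral_mono_AE')
    show "integrable M ?R"
      using iXa iY by auto
    show "AE \<omega> in M. cmod (Z \<omega> * ((X \<omega> - a) * of_real (Y \<omega> - b))) \<le> ?R \<omega>"
      using Z(2) Y1
    proof eventually_elim
      case (elim \<omega>)
      define p where "p = cmod (X \<omega> - a)"
      have p0: "0 \<le> p" by (simp add: p_def)
      have p: "p \<le> \<epsilon> + 0 \<or> p \<le> p ^ 4 / \<epsilon> ^ 3"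
      proof (cases "p \<le> \<epsilon>")
        case False
        then have "p * \<epsilon> ^ 3 \<le> p * p ^ 3" using \<epsilon> by (intro mult_left_mono power_mono) auto
        also have "p * p ^ 3 = p ^ 4" by (simp add: power_eq_if)
        finally show ?thesis using \<epsilon> by (simp add: pos_le_divide_eq)
      qed simp
      have q0: "0 \<le> p ^ 4 / \<epsilon> ^ 3" using \<epsilon> p0 by auto
      have q: "p * c \<le> \<epsilon> * c + p ^ 4 / \<epsilon> ^ 3" if "0 \<le> c" "c \<le> 1" for c
        using p
      proof
        assume "p \<le> \<epsilon> + 0"
        then have "p * c \<le> \<epsilon> * c" using that by (intro mult_right_mono) auto
        then show ?thesis using q0 by linarith
      next
        assume "p \<le> p ^ 4 / \<epsilon> ^ 3"
        moreover have "p * c \<le> p" using that p0 by (simp add: mult_left_le)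
        moreover have "0 \<le> \<epsilon> * c" using that \<epsilon> by simp
        ultimately show ?thesis by linarith
      qed
      have "cmod (Z \<omega> * ((X \<omega> - a) * of_real (Y \<omega> - b))) = cmod (Z \<omega>) * (p * \<bar>Y \<omega> - b\<bar>)"
        by (simp add: norm_mult p_def del: of_real_diff)
      also have "\<dots> \<le> 1 * (p * \<bar>Y \<omega> - b\<bar>)"
        using elim p0 by (intro mult_right_mono) auto
      also have "\<dots> \<le> p * (1 - Y \<omega>) + p * (1 - b)"
        using p0 elim b01 by (simp add: distrib_left[symmetric] mult_left_mono abs_if)
      also have "\<dots> \<le> ?R \<omega>"
        using q[of "1 - Y \<omega>"] q[of "1 - b"] elim b01 by (simp add: p_def)
      finally show ?case .
    qed
    show "AE \<omega> in M. 0 \<le> ?R \<omega>"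
      using Y1 by eventually_elim (use \<epsilon> b01 in auto)
  qed
  also have "\<dots> = 2 * \<epsilon> * (1 - b) + 2 * ((\<integral>\<omega>. cmod (X \<omega> - a) ^ 4 \<partial>M) / \<epsilon> ^ 3)"
    using iXa iY by (simp add: prob_space b_def)
  also have "\<dots> \<le> 2 * \<epsilon> * (\<theta> * rate * (t - s)) + 2 * ((48 * u ^ 4 * (t - s)\<^sup>2) / \<epsilon> ^ 3)"
    using \<epsilon> a4 b01 by (intro add_mono mult_left_mono divide_right_mono) auto
  finally show ?thesis
    unfolding a_def[symmetric] b_def[symmetric] key by (simp add: mult.assoc)
qed

end

text \<open>Joint laws are identified through Fourier transforms in \<open>W\<close> but Laplace transforms in \<open>N\<close>: the latter are
nonnegative, so that they can serve as densities of measures to which Levy's uniqueness theorem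
applies.\<close>

definition W_char :: "real \<Rightarrow> real \<Rightarrow> real \<Rightarrow> 'a \<Rightarrow> complex" where
  "W_char u s t \<omega> = iexp (u * (W t \<omega> - W s \<omega>))"

definition N_Laplace :: "real \<Rightarrow> real \<Rightarrow> real \<Rightarrow> 'a \<Rightarrow> real" where
  "N_Laplace \<theta> s t \<omega> = exp (- \<theta> * (N t \<omega> - N s \<omega>))"

lemma W_char_measurable_F: "0 \<le> s \<Longrightarrow> s \<le> t \<Longrightarrow> t \<le> T \<Longrightarrow> W_char u s t \<in> borel_measurable (F t)"
  unfolding W_char_def
  using W_measurable_F[of s t] W_measurable_F[of t t] by measurable

lemma N_Laplace_measurable_F: "0 \<le> s \<Longrightarrow> s \<le> t \<Longrightarrow> t \<le> T \<Longrightarrow> N_Laplace \<theta> s t \<in> borel_measurable (F t)"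
  unfolding N_Laplace_def
  using N_measurable_F[of s t] N_measurable_F[of t t] by measurable

lemma W_char_mult: "W_char u r s \<omega> * W_char u s t \<omega> = W_char u r t \<omega>"
  by (simp add: W_char_def mult_exp_exp algebra_simps)

lemma N_Laplace_mult: "N_Laplace \<theta> r s \<omega> * N_Laplace \<theta> s t \<omega> = N_Laplace \<theta> r t \<omega>"
  by (simp add: N_Laplace_def mult_exp_exp algebra_simps)

lemma norm_W_char: "cmod (W_char u s t \<omega>) = 1"
  by (simp add: W_char_def)

lemma N_Laplace_le_1:
  assumes "0 \<le> s" "s \<le> t" "t \<le> T" "0 \<le> \<theta>"
  shows "AE \<omega> in M. 0 \<le> N_Laplace \<theta> s t \<omega> \<and> N_Laplace \<theta> s t \<omega> \<le> 1"
proof (cases "s = t")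
  case False
  then show ?thesis
    using N_incr_nonneg[of s t] assms by (auto simp: N_Laplace_def elim!: AE_mp)
qed (simp add: N_Laplace_def)

lemma W_char_integrable:
  assumes "0 \<le> s" "s \<le> t" "t \<le> T"
  shows "integrable M (W_char u s t)"
  using measurable_F_imp_M[OF W_char_measurable_F[OF assms]] assms
  by (intro integrable_const_bound[where B=1]) (auto simp: norm_W_char)

lemma N_Laplace_integrable:
  assumes "0 \<le> s" "s \<le> t" "t \<le> T" "0 \<le> \<theta>"
  shows "integrable M (N_Laplace \<theta> s t)"
proof (rule integrable_const_bound[where B=1])
  show "AE \<omega> in M. norm (N_Laplace \<theta> s t \<omega>) \<le> 1"
    using N_Laplace_le_1[OF assms] by eventually_elim auto
qed (use measurable_F_imp_M[OF N_Laplace_measurable_F[OF assms(1-3)]] assms in auto)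

lemma expectation_W_char_mult:
  assumes "0 \<le> r" "r \<le> s" "s < t" "t \<le> T"
  shows "(\<integral>\<omega>. W_char u r t \<omega> \<partial>M) = (\<integral>\<omega>. W_char u r s \<omega> \<partial>M) * (\<integral>\<omega>. W_char u s t \<omega> \<partial>M)"
proof -
  have "W_char u r s \<in> borel_measurable (F s)"
    using W_char_measurable_F assms by auto
  then have "indep_var borel (W_char u r s) borel (\<lambda>\<omega>. iexp (u * (W t \<omega> - W s \<omega>)))"
    using assms by (intro indep_var_past_W) auto
  then have "indep_var borel (W_char u r s) borel (W_char u s t)"
    by (simp add: W_char_def[abs_def])
  from indep_var_lebesgue_integral[OF this] show ?thesis
    using W_char_integrable assms by (simp add: W_char_mult)
qed

lemma expectation_N_Laplace_mult:
  assumes "0 \<le> r" "r \<le> s" "s < t" "t \<le> T" "0 \<le> \<theta>"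
  shows "expectation (N_Laplace \<theta> r t) = expectation (N_Laplace \<theta> r s) * expectation (N_Laplace \<theta> s t)"
proof -
  have "N_Laplace \<theta> r s \<in> borel_measurable (F s)"
    using N_Laplace_measurable_F assms by auto
  then have "indep_var borel (N_Laplace \<theta> r s) borel (\<lambda>\<omega>. exp (- \<theta> * (N t \<omega> - N s \<omega>)))"
    using assms by (intro indep_var_past_N) auto
  then have "indep_var borel (N_Laplace \<theta> r s) borel (N_Laplace \<theta> s t)"
    by (simp add: N_Laplace_def[abs_def])
  from indep_var_lebesgue_integral[OF this] show ?thesis
    using N_Laplace_integrable assms by (simp add: N_Laplace_mult)
qed

lemma cmod_expectation_W_char_le_1:
  assumes "0 \<le> s" "s \<le> t" "t \<le> T"
  shows "cmod (\<integral>\<omega>. W_char u s t \<omega> \<partial>M) \<le> 1"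
  using integral_norm_bound[of M "W_char u s t"] by (simp add: norm_W_char prob_space)

lemma expectation_N_Laplace_le_1:
  assumes "0 \<le> s" "s < t" "t \<le> T" "0 \<le> \<theta>"
  shows "0 \<le> expectation (N_Laplace \<theta> s t) \<and> expectation (N_Laplace \<theta> s t) \<le> 1"
  using expectation_N_Laplace_bounds(1,2)[OF assms(1-4)] by (simp add: N_Laplace_def[abs_def])

text \<open>Later steps multiply the error of the earlier ones by factors of modulus at most \<open>1\<close>, so that the
errors only add up.\<close>

lemma joint_transform_telescope:
  fixes u \<theta> \<epsilon> h :: real and Z :: "'a \<Rightarrow> complex"
  assumes s: "0 \<le> s" and h: "0 < h" and m: "s + real m * h \<le> T"
    and Z: "Z \<in> borel_measurable (F s)" "AE \<omega> in M. cmod (Z \<omega>) \<le> 1"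
    and \<theta>: "0 \<le> \<theta>" and \<epsilon>: "0 < \<epsilon>"
  shows "cmod ((\<integral>\<omega>. Z \<omega> * (W_char u s (s + m * h) \<omega> * of_real (N_Laplace \<theta> s (s + m * h) \<omega>)) \<partial>M)
      - (\<integral>\<omega>. Z \<omega> \<partial>M) * ((\<integral>\<omega>. W_char u s (s + m * h) \<omega> \<partial>M) * of_real (expectation (N_Laplace \<theta> s (s + m * h)))))
    \<le> real m * (2 * \<epsilon> * \<theta> * rate * h + 96 * u ^ 4 * h\<^sup>2 / \<epsilon> ^ 3)"
  using m
proof (induction m)
  case 0
  show ?case by (simp add: W_char_def N_Laplace_def prob_space)
next
  case (Suc m)
  let ?r = "s + real m * h" and ?t = "s + real (Suc m) * h"
  define \<delta> where "\<delta> = 2 * \<epsilon> * \<theta> * rate * h + 96 * u ^ 4 * h\<^sup>2 / \<epsilon> ^ 3"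
  have r: "s \<le> ?r" "?r < ?t" "?t \<le> T" "?r \<le> T" "0 \<le> ?r" "?t - ?r = h" "s < ?t"
    using Suc.prems h s by (auto simp: algebra_simps add_pos_nonneg)
  define Z' where "Z' \<omega> = Z \<omega> * (W_char u s ?r \<omega> * of_real (N_Laplace \<theta> s ?r \<omega>))" for \<omega>
  define x y x' y' where "x = (\<integral>\<omega>. W_char u s ?r \<omega> \<partial>M)" and "y = expectation (N_Laplace \<theta> s ?r)"
    and "x' = (\<integral>\<omega>. W_char u ?r ?t \<omega> \<partial>M)" and "y' = expectation (N_Laplace \<theta> ?r ?t)"
  have Z'm: "Z' \<in> borel_measurable (F ?r)"
    unfolding Z'_def[abs_def]
    using measurable_F_mono[OF Z(1) r(1)] W_char_measurable_F[OF s r(1,4), of u]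
      N_Laplace_measurable_F[OF s r(1,4), of \<theta>] by measurable
  have Z'1: "AE \<omega> in M. cmod (Z' \<omega>) \<le> 1"
    using Z(2) N_Laplace_le_1[OF s r(1,4) \<theta>]
    by eventually_elim (auto simp: Z'_def norm_mult norm_W_char mult_le_one)
  have step: "cmod ((\<integral>\<omega>. Z' \<omega> * (W_char u ?r ?t \<omega> * of_real (N_Laplace \<theta> ?r ?t \<omega>)) \<partial>M)
      - (\<integral>\<omega>. Z' \<omega> \<partial>M) * (x' * of_real y')) \<le> \<delta>"
    using joint_transform_step[OF r(5,2,3) Z'm Z'1 \<theta> \<epsilon>, of u]
    unfolding x'_def y'_def W_char_def[abs_def] N_Laplace_def[abs_def] \<delta>_def r(6) by simp
  have eq: "Z' \<omega> * (W_char u ?r ?t \<omega> * of_real (N_Laplace \<theta> ?r ?t \<omega>))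
      = Z \<omega> * (W_char u s ?t \<omega> * of_real (N_Laplace \<theta> s ?t \<omega>))" for \<omega>
    unfolding Z'_def W_char_mult[of u s ?r _ ?t, symmetric] N_Laplace_mult[of \<theta> s ?r _ ?t, symmetric]
    by simp
  have IH: "cmod ((\<integral>\<omega>. Z' \<omega> \<partial>M) - (\<integral>\<omega>. Z \<omega> \<partial>M) * (x * of_real y)) \<le> real m * \<delta>"
    using Suc.IH r(4) by (simp add: Z'_def x_def y_def \<delta>_def)
  have xy': "cmod (x' * of_real y') \<le> 1"
    using cmod_expectation_W_char_le_1[OF r(5) less_imp_le[OF r(2)] r(3), of u]
      expectation_N_Laplace_le_1[OF r(5,2,3) \<theta>]
    by (auto simp: x'_def y'_def norm_mult intro!: mult_le_one)
  have "cmod ((\<integral>\<omega>. Z' \<omega> \<partial>M) * (x' * of_real y') - (\<integral>\<omega>. Z \<omega> \<partial>M) * ((x * x') * of_real (y * y')))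
      = cmod ((\<integral>\<omega>. Z' \<omega> \<partial>M) - (\<integral>\<omega>. Z \<omega> \<partial>M) * (x * of_real y)) * cmod (x' * of_real y')"
    unfolding norm_mult[symmetric] by (simp add: algebra_simps)
  also have "\<dots> \<le> real m * \<delta> * 1"
    using IH xy' by (intro mult_mono) (auto intro: order_trans[OF norm_ge_zero])
  finally have "cmod ((\<integral>\<omega>. Z' \<omega> \<partial>M) * (x' * of_real y') - (\<integral>\<omega>. Z \<omega> \<partial>M) * ((x * x') * of_real (y * y')))
      \<le> real m * \<delta>" by simp
  with step have "cmod ((\<integral>\<omega>. Z' \<omega> * (W_char u ?r ?t \<omega> * of_real (N_Laplace \<theta> ?r ?t \<omega>)) \<partial>M)
      - (\<integral>\<omega>. Z \<omega> \<partial>M) * ((x * x') * of_real (y * y'))) \<le> \<delta> + real m * \<delta>"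
    by (rule norm_diff_triangle_le)
  also have "\<delta> + real m * \<delta> = real (Suc m) * \<delta>"
    by (simp add: algebra_simps)
  finally show ?case
    unfolding eq x_def x'_def y_def y'_def
      expectation_W_char_mult[OF s r(1-3), of u, symmetric]
      expectation_N_Laplace_mult[OF s r(1-3) \<theta>, symmetric] \<delta>_def .
qed

text \<open>With \<open>m\<close> steps of length \<open>(t - s) / m\<close> the accumulated error tends to a multiple of \<open>\<epsilon>\<close> as \<open>m\<close> grows, and
\<open>\<epsilon>\<close> is arbitrary.\<close>

lemma joint_transform:
  fixes u \<theta> :: real and Z :: "'a \<Rightarrow> complex"
  assumes st: "0 \<le> s" "s < t" "t \<le> T"
    and Z: "Z \<in> borel_measurable (F s)" "AE \<omega> in M. cmod (Z \<omega>) \<le> 1"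
    and \<theta>: "0 \<le> \<theta>"
  shows "(\<integral>\<omega>. Z \<omega> * (W_char u s t \<omega> * of_real (N_Laplace \<theta> s t \<omega>)) \<partial>M)
      = (\<integral>\<omega>. Z \<omega> \<partial>M) * ((\<integral>\<omega>. W_char u s t \<omega> \<partial>M) * of_real (expectation (N_Laplace \<theta> s t)))"
proof -
  define D where "D = cmod ((\<integral>\<omega>. Z \<omega> * (W_char u s t \<omega> * of_real (N_Laplace \<theta> s t \<omega>)) \<partial>M)
      - (\<integral>\<omega>. Z \<omega> \<partial>M) * ((\<integral>\<omega>. W_char u s t \<omega> \<partial>M) * of_real (expectation (N_Laplace \<theta> s t))))"
  define H where "H = t - s"
  have H: "0 < H" using st by (simp add: H_def)
  have D1: "D \<le> 2 * \<epsilon> * \<theta> * rate * H + (96 * u ^ 4 * H\<^sup>2 / \<epsilon> ^ 3) * inverse (real (Suc K))"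
    if \<epsilon>: "0 < \<epsilon>" for \<epsilon> K
  proof -
    define h where "h = H / real (Suc K)"
    have h: "0 < h" using H by (simp add: h_def)
    have t: "s + real (Suc K) * h = t" by (simp add: h_def H_def del: of_nat_Suc)
    have "D \<le> real (Suc K) * (2 * \<epsilon> * \<theta> * rate * h + 96 * u ^ 4 * h\<^sup>2 / \<epsilon> ^ 3)"
      using joint_transform_telescope[OF st(1) h _ Z \<theta> \<epsilon>, of "Suc K" u] st(3) unfolding t D_def by simp
    also have "\<dots> = 2 * \<epsilon> * \<theta> * rate * (real (Suc K) * h)
        + 96 * u ^ 4 * (real (Suc K) * h) * h / \<epsilon> ^ 3"
      by (simp add: algebra_simps power2_eq_square add_divide_distrib)
    also have "real (Suc K) * h = H" by (simp add: h_def del: of_nat_Suc)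
    also have "96 * u ^ 4 * H * h / \<epsilon> ^ 3 = (96 * u ^ 4 * H\<^sup>2 / \<epsilon> ^ 3) * inverse (real (Suc K))"
      by (simp add: h_def divide_inverse power2_eq_square)
    finally show ?thesis .
  qed
  have D2: "D \<le> 2 * \<epsilon> * \<theta> * rate * H" if \<epsilon>: "0 < \<epsilon>" for \<epsilon>
  proof (rule LIMSEQ_le_const)
    show "(\<lambda>K. 2 * \<epsilon> * \<theta> * rate * H + (96 * u ^ 4 * H\<^sup>2 / \<epsilon> ^ 3) * inverse (real (Suc K)))
        \<longlonglongrightarrow> 2 * \<epsilon> * \<theta> * rate * H"
      using tendsto_add[OF tendsto_const[of "2 * \<epsilon> * \<theta> * rate * H"]
          tendsto_mult[OF tendsto_const LIMSEQ_inverse_real_of_nat], of "96 * u ^ 4 * H\<^sup>2 / \<epsilon> ^ 3"]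
      by simp
  qed (use D1[OF \<epsilon>] in blast)
  have "D \<le> 0"
  proof (rule LIMSEQ_le_const)
    show "(\<lambda>K. 2 * inverse (real (Suc K)) * \<theta> * rate * H) \<longlonglongrightarrow> 0"
      using tendsto_mult[OF tendsto_const[of "2 * \<theta> * rate * H"] LIMSEQ_inverse_real_of_nat]
      by (simp add: algebra_simps)
    show "\<exists>N. \<forall>n\<ge>N. D \<le> 2 * inverse (real (Suc n)) * \<theta> * rate * H"
      using D2 by (auto simp del: of_nat_Suc)
  qed
  then show ?thesis by (simp add: D_def)
qed

end

lemma power_series_coeff_unique:
  fixes a b :: "nat \<Rightarrow> real"
  assumes a: "\<And>n. \<bar>a n\<bar> \<le> 1" and b: "\<And>n. \<bar>b n\<bar> \<le> 1"
    and eq: "\<And>z. 0 < z \<Longrightarrow> z < 1 \<Longrightarrow> (\<Sum>n. a n * z ^ n) = (\<Sum>n. b n * z ^ n)"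
  shows "a n = b n"
proof (induction n rule: less_induct)
  case (less n)
  define c where "c n = a n - b n" for n
  have sum1: "summable (\<lambda>m. d m * x ^ m)" if "\<bar>x\<bar> < 1" "\<And>m. \<bar>d m\<bar> \<le> 2" for d :: "nat \<Rightarrow> real" and x :: real
  proof (rule summable_comparison_test')
    show "summable (\<lambda>m. 2 * \<bar>x\<bar> ^ m)" using that by (intro summable_mult summable_geometric) auto
    show "norm (d m * x ^ m) \<le> 2 * \<bar>x\<bar> ^ m" if "m \<ge> 0" for m
      using \<open>\<bar>d m\<bar> \<le> 2\<close> by (simp add: abs_mult power_abs mult_right_mono)
  qed
  have c2: "\<bar>c m\<bar> \<le> 2" for m using a[of m] b[of m] by (simp add: c_def)
  have zero: "(\<Sum>m. c m * z ^ m) = 0" if "0 < z" "z < 1" for z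
  proof -
    have "(\<Sum>m. c m * z ^ m) = (\<Sum>m. a m * z ^ m) - (\<Sum>m. b m * z ^ m)"
      unfolding c_def left_diff_distrib
      using that by (intro suminf_diff[symmetric] sum1) (auto intro: order_trans[OF a] order_trans[OF b])
    then show ?thesis using eq[OF that] by simp
  qed
  \<comment> \<open>The series without its first \<open>n\<close> terms, which vanish, divided by \<open>x ^ n\<close>.\<close>
  define f where "f x = (\<Sum>m. c (m + n) * x ^ m)" for x
  have "f \<midarrow>0\<rightarrow> c (0 + n)"
  proof (rule powser_limit_0[where s=1])
    show "(\<lambda>m. c (m + n) * x ^ m) sums f x" if "norm x < 1" for x
      unfolding f_def using sum1[of x "\<lambda>m. c (m + n)"] that c2 by (auto simp: summable_sums)
  qed simp
  then have lim: "(f \<longlongrightarrow> c n) (at_right 0)"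
    by (auto intro: filterlim_mono[OF _ order_refl at_le])
  have "eventually (\<lambda>z. f z = 0) (at_right 0)"
    unfolding eventually_at_right_field
  proof (intro exI[of _ 1] conjI allI impI)
    fix z :: real assume z: "0 < z" "z < 1"
    have "(\<Sum>m. c m * z ^ m) = (\<Sum>m. c (m + n) * z ^ (m + n)) + (\<Sum>m<n. c m * z ^ m)"
      using sum1[of z c] z c2 by (intro suminf_split_initial_segment) auto
    also have "(\<Sum>m<n. c m * z ^ m) = 0"
      using less by (intro sum.neutral) (auto simp: c_def)
    also have "(\<Sum>m. c (m + n) * z ^ (m + n)) = z ^ n * f z"
      unfolding f_def using sum1[of z "\<lambda>m. c (m + n)"] z c2
      by (subst suminf_mult[symmetric]) (auto simp: power_add mult_ac)
    finally show "f z = 0" using zero[OF z] z by simp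
  qed simp
  then have "(f \<longlongrightarrow> 0) (at_right 0)"
    by (rule tendsto_eventually)
  then have "c n = 0"
    using lim by (intro tendsto_unique[of "at_right (0::real)"]) auto
  then show ?case by (simp add: c_def)
qed

context prob_space
begin

lemma prob_nat_generating_function:
  fixes \<kappa> :: "'a \<Rightarrow> nat"
  assumes C[measurable]: "C \<in> events" and \<kappa>[measurable]: "\<kappa> \<in> measurable M (count_space UNIV)"
    and z: "0 < z" "z < 1"
  shows "(\<Sum>n. prob (C \<inter> {\<omega>\<in>space M. \<kappa> \<omega> = n}) * z ^ n) = (\<integral>\<omega>. indicator C \<omega> * z ^ \<kappa> \<omega> \<partial>M)"
proof -
  define f where "f n \<omega> = indicator (C \<inter> {\<omega>\<in>space M. \<kappa> \<omega> = n}) \<omega> * z ^ n" for n \<omega>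
  have int: "(\<integral>\<omega>. f n \<omega> \<partial>M) = prob (C \<inter> {\<omega>\<in>space M. \<kappa> \<omega> = n}) * z ^ n"
    and i: "integrable M (f n)" for n
    by (auto simp: f_def[abs_def] Int_assoc[symmetric] sets.Int_space_eq2[OF C] emeasure_eq_measure)
  have f0: "norm (f n \<omega>) = f n \<omega>" for n \<omega> using z by (simp add: f_def)
  have fs: "(\<lambda>n. f n \<omega>) sums (indicator C \<omega> * z ^ \<kappa> \<omega>)" if "\<omega> \<in> space M" for \<omega>
  proof -
    have "(\<lambda>n. f n \<omega>) = (\<lambda>n. if n = \<kappa> \<omega> then indicator C \<omega> * z ^ \<kappa> \<omega> else 0)"
      using that by (auto simp: f_def indicator_def)
    then show ?thesis using sums_single[of "\<kappa> \<omega>" "\<lambda>n. indicator C \<omega> * z ^ \<kappa> \<omega>"] by simp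
  qed
  have "(\<lambda>n. \<integral>\<omega>. f n \<omega> \<partial>M) sums (\<integral>\<omega>. (\<Sum>n. f n \<omega>) \<partial>M)"
  proof (rule sums_integral[OF i])
    show "AE \<omega> in M. summable (\<lambda>n. norm (f n \<omega>))"
      unfolding f0 using fs by (auto simp: sums_iff)
    show "summable (\<lambda>n. \<integral>\<omega>. norm (f n \<omega>) \<partial>M)"
      unfolding f0 int
    proof (rule summable_comparison_test')
      show "summable (\<lambda>n. z ^ n)" using z by (intro summable_geometric) auto
      show "norm (prob (C \<inter> {\<omega> \<in> space M. \<kappa> \<omega> = n}) * z ^ n) \<le> z ^ n" if "n \<ge> 0" for n
        using z by (simp add: abs_mult mult_left_le_one_le)
    qed
  qed
  also have "(\<integral>\<omega>. (\<Sum>n. f n \<omega>) \<partial>M) = (\<integral>\<omega>. indicator C \<omega> * z ^ \<kappa> \<omega> \<partial>M)"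
    using fs by (intro Bochner_Integration.integral_cong) (auto simp: sums_iff)
  finally show ?thesis by (simp add: int sums_iff)
qed

lemma prob_nat_event_sums:
  fixes \<kappa> :: "'a \<Rightarrow> nat"
  assumes C[measurable]: "C \<in> events" and \<kappa>[measurable]: "\<kappa> \<in> measurable M (count_space UNIV)"
  shows "(\<lambda>n. of_bool (n \<in> E) * prob (C \<inter> {\<omega>\<in>space M. \<kappa> \<omega> = n})) sums prob (C \<inter> {\<omega>\<in>space M. \<kappa> \<omega> \<in> E})"
proof -
  let ?A = "\<lambda>n. if n \<in> E then C \<inter> {\<omega>\<in>space M. \<kappa> \<omega> = n} else {}"
  have "(\<lambda>n. prob (?A n)) sums prob (\<Union>n. ?A n)"
    by (rule finite_measure_UNION) (auto simp: disjoint_family_on_def)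
  moreover have "(\<lambda>n. prob (?A n)) = (\<lambda>n. of_bool (n \<in> E) * prob (C \<inter> {\<omega>\<in>space M. \<kappa> \<omega> = n}))"
    by auto
  moreover have "(\<Union>n. ?A n) = C \<inter> {\<omega>\<in>space M. \<kappa> \<omega> \<in> E}"
    by (auto split: if_splits)
  ultimately show ?thesis by simp
qed

text \<open>For a random variable with values in the natural numbers, the Laplace transform at \<open>- ln z\<close> is the
generating function at \<open>z\<close>, and the coefficients of a power series are determined by its values on
\<open>(0, 1)\<close>.\<close>

lemma prob_factorizes_if_Laplace_factorizes:
  assumes C[measurable]: "C \<in> events" and X[measurable]: "X \<in> borel_measurable M"
    and nat: "AE \<omega> in M. X \<omega> \<in> \<nat>" and A': "A' \<in> sets borel"
    and Laplace: "\<And>\<theta>. 0 \<le> \<theta> \<Longrightarrow>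
      (\<integral>\<omega>. indicator C \<omega> * exp (- \<theta> * X \<omega>) \<partial>M) = prob C * expectation (\<lambda>\<omega>. exp (- \<theta> * X \<omega>))"
  shows "prob (C \<inter> {\<omega>\<in>space M. X \<omega> \<in> A'}) = prob C * prob {\<omega>\<in>space M. X \<omega> \<in> A'}"
proof -
  note [measurable] = A'
  define \<kappa> where "\<kappa> \<omega> = nat \<lfloor>X \<omega>\<rfloor>" for \<omega>
  have [measurable]: "\<kappa> \<in> measurable M (count_space UNIV)"
    unfolding \<kappa>_def[abs_def] by measurable
  have \<kappa>: "AE \<omega> in M. X \<omega> = real (\<kappa> \<omega>)"
    using nat by eventually_elim (auto simp: \<kappa>_def Nats_def)
  have pow: "AE \<omega> in M. exp (- (- ln z) * X \<omega>) = z ^ \<kappa> \<omega>" if "0 < z" for z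
    using \<kappa> by eventually_elim (use that in \<open>simp add: exp_of_nat2_mult\<close>)
  have gf: "(\<integral>\<omega>. indicator D \<omega> * exp (- (- ln z) * X \<omega>) \<partial>M)
      = (\<Sum>n. prob (D \<inter> {\<omega>\<in>space M. \<kappa> \<omega> = n}) * z ^ n)"
    if z: "0 < z" "z < 1" and D[measurable]: "D \<in> events" for z D
    unfolding prob_nat_generating_function[OF D \<open>\<kappa> \<in> measurable M (count_space UNIV)\<close> z]
    by (rule integral_cong_AE) (use pow[OF z(1)] in auto)
  have coeff: "prob (C \<inter> {\<omega>\<in>space M. \<kappa> \<omega> = n}) = prob C * prob (space M \<inter> {\<omega>\<in>space M. \<kappa> \<omega> = n})" for n
  proof (rule power_series_coeff_unique[where
        a="\<lambda>n. prob (C \<inter> {\<omega>\<in>space M. \<kappa> \<omega> = n})" and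
        b="\<lambda>n. prob C * prob (space M \<inter> {\<omega>\<in>space M. \<kappa> \<omega> = n})"])
    fix z :: real assume z: "0 < z" "z < 1"
    have s: "summable (\<lambda>n. prob (space M \<inter> {\<omega>\<in>space M. \<kappa> \<omega> = n}) * z ^ n)"
    proof (rule summable_comparison_test')
      show "summable (\<lambda>n. z ^ n)" using z by (intro summable_geometric) auto
      show "norm (prob (space M \<inter> {\<omega> \<in> space M. \<kappa> \<omega> = n}) * z ^ n) \<le> z ^ n" if "n \<ge> 0" for n
        using z by (simp add: abs_mult mult_left_le_one_le)
    qed
    have "(\<Sum>n. prob (C \<inter> {\<omega>\<in>space M. \<kappa> \<omega> = n}) * z ^ n)
        = prob C * expectation (\<lambda>\<omega>. exp (- (- ln z) * X \<omega>))"
      using z gf[OF z C] Laplace[of "- ln z"] by simp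
    also have "expectation (\<lambda>\<omega>. exp (- (- ln z) * X \<omega>))
        = (\<integral>\<omega>. indicator (space M) \<omega> * exp (- (- ln z) * X \<omega>) \<partial>M)"
      by (intro Bochner_Integration.integral_cong) auto
    also have "\<dots> = (\<Sum>n. prob (space M \<inter> {\<omega>\<in>space M. \<kappa> \<omega> = n}) * z ^ n)"
      by (rule gf[OF z]) simp
    also have "prob C * \<dots> = (\<Sum>n. prob C * prob (space M \<inter> {\<omega>\<in>space M. \<kappa> \<omega> = n}) * z ^ n)"
      by (subst suminf_mult[OF s, symmetric]) (simp add: mult.assoc)
    finally show "(\<Sum>n. prob (C \<inter> {\<omega>\<in>space M. \<kappa> \<omega> = n}) * z ^ n)
      = (\<Sum>n. prob C * prob (space M \<inter> {\<omega>\<in>space M. \<kappa> \<omega> = n}) * z ^ n)" .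
  qed (auto simp: abs_mult intro!: mult_le_one)
  let ?E = "{n. real n \<in> A'}"
  have "prob (C \<inter> {\<omega>\<in>space M. \<kappa> \<omega> \<in> ?E}) = prob C * prob (space M \<inter> {\<omega>\<in>space M. \<kappa> \<omega> \<in> ?E})"
  proof (rule sums_unique2)
    show "(\<lambda>n. of_bool (n \<in> ?E) * prob (C \<inter> {\<omega>\<in>space M. \<kappa> \<omega> = n}))
        sums prob (C \<inter> {\<omega>\<in>space M. \<kappa> \<omega> \<in> ?E})"
      by (rule prob_nat_event_sums) auto
    have "(\<lambda>n. prob C * (of_bool (n \<in> ?E) * prob (space M \<inter> {\<omega>\<in>space M. \<kappa> \<omega> = n})))
        sums (prob C * prob (space M \<inter> {\<omega>\<in>space M. \<kappa> \<omega> \<in> ?E}))"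
      by (intro sums_mult prob_nat_event_sums) auto
    then show "(\<lambda>n. of_bool (n \<in> ?E) * prob (C \<inter> {\<omega>\<in>space M. \<kappa> \<omega> = n}))
        sums (prob C * prob (space M \<inter> {\<omega>\<in>space M. \<kappa> \<omega> \<in> ?E}))"
      unfolding coeff by (simp add: mult_ac)
  qed
  moreover have "prob (C \<inter> {\<omega>\<in>space M. \<kappa> \<omega> \<in> ?E}) = prob (C \<inter> {\<omega>\<in>space M. X \<omega> \<in> A'})"
    by (rule finite_measure_eq_AE) (use \<kappa> in \<open>auto elim!: AE_mp\<close>)
  moreover have "prob (space M \<inter> {\<omega>\<in>space M. \<kappa> \<omega> \<in> ?E}) = prob {\<omega>\<in>space M. X \<omega> \<in> A'}"
    by (rule finite_measure_eq_AE) (use \<kappa> in \<open>auto elim!: AE_mp\<close>)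
  ultimately show ?thesis by simp
qed

text \<open>Divided by its mean, \<open>g\<close> is a probability density; under it \<open>V\<close> has the same characteristic function as
under the original measure, hence the same law.\<close>

lemma weighted_prob_eq_if_char_eq:
  assumes V[measurable]: "V \<in> borel_measurable M" and g: "integrable M g" "AE \<omega> in M. 0 \<le> g \<omega>"
    and A: "A \<in> sets borel"
    and char: "\<And>u. (\<integral>\<omega>. of_real (g \<omega>) * iexp (u * V \<omega>) \<partial>M) = of_real (expectation g) * (\<integral>\<omega>. iexp (u * V \<omega>) \<partial>M)"
  shows "(\<integral>\<omega>. g \<omega> * indicator A (V \<omega>) \<partial>M) = expectation g * prob {\<omega>\<in>space M. V \<omega> \<in> A}"
proof -
  note [measurable] = A borel_measurable_integrable[OF g(1)]
  define c where "c = expectation g"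
  have c0: "0 \<le> c" unfolding c_def using g(2) by (rule integral_nonneg_AE)
  show ?thesis
  proof (cases "c = 0")
    case True
    then have "AE \<omega> in M. g \<omega> = 0"
      using integral_nonneg_eq_0_iff_AE[OF g] by (simp add: c_def)
    then have "(\<integral>\<omega>. g \<omega> * indicator A (V \<omega>) \<partial>M) = (\<integral>\<omega>. 0 \<partial>M)"
      by (intro integral_cong_AE) auto
    then show ?thesis using True by (simp add: c_def)
  next
    case False
    then have c: "0 < c" using c0 by simp
    define Q where "Q = density M (\<lambda>\<omega>. ennreal (g \<omega> / c))"
    have gc: "AE \<omega> in M. 0 \<le> g \<omega> / c" using g(2) by eventually_elim (use c in auto)
    have [measurable_cong]: "sets Q = sets M" by (simp add: Q_def)
    have "emeasure Q (space Q) = ennreal (\<integral>\<omega>. g \<omega> / c \<partial>M)"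
      unfolding Q_def using gc g(1)
      by (subst emeasure_density) (auto simp: nn_integral_eq_integral intro!: nn_integral_cong_AE[THEN trans])
    also have "(\<integral>\<omega>. g \<omega> / c \<partial>M) = 1" using c by (simp add: c_def)
    finally interpret Q: prob_space Q by (intro prob_spaceI) simp
    have rd: "real_distribution (distr Q borel V)" "real_distribution (distr M borel V)"
      by (auto intro!: Q.real_distribution_distr real_distribution_distr)
    have "char (distr Q borel V) = char (distr M borel V)"
    proof
      fix u
      have "char (distr Q borel V) u = (\<integral>\<omega>. iexp (u * V \<omega>) \<partial>Q)"
        unfolding char_def by (subst integral_distr) auto
      also have "\<dots> = (\<integral>\<omega>. (g \<omega> / c) *\<^sub>R iexp (u * V \<omega>) \<partial>M)"
        unfolding Q_def using gc by (subst integral_density) auto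
      also have "\<dots> = (\<integral>\<omega>. of_real (1 / c) * (of_real (g \<omega>) * iexp (u * V \<omega>)) \<partial>M)"
        by (intro Bochner_Integration.integral_cong) (auto simp: scaleR_conv_of_real)
      also have "\<dots> = of_real (1 / c) * (of_real c * (\<integral>\<omega>. iexp (u * V \<omega>) \<partial>M))"
        by (simp only: integral_mult_right_zero char c_def)
      also have "\<dots> = (\<integral>\<omega>. iexp (u * V \<omega>) \<partial>M)" using c by simp
      also have "\<dots> = char (distr M borel V) u"
        unfolding char_def by (subst integral_distr) auto
      finally show "char (distr Q borel V) u = char (distr M borel V) u" .
    qed
    then have eq: "distr Q borel V = distr M borel V"
      using rd by (intro Levy_uniqueness)
    have "prob {\<omega>\<in>space M. V \<omega> \<in> A} = (\<integral>x. indicator A x \<partial>distr M borel V)"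
      by (simp add: measure_distr vimage_def Int_def conj_commute)
    also have "\<dots> = (\<integral>\<omega>. indicator A (V \<omega>) \<partial>Q)"
      unfolding eq[symmetric] by (subst integral_distr) auto
    also have "\<dots> = (\<integral>\<omega>. (g \<omega> / c) *\<^sub>R indicator A (V \<omega>) \<partial>M)"
      unfolding Q_def using gc by (subst integral_density) auto
    also have "\<dots> = (\<integral>\<omega>. g \<omega> * indicator A (V \<omega>) \<partial>M) / c" by simp
    finally show ?thesis using c by (simp add: c_def)
  qed
qed

end

context wiener_poisson
begin

text \<open>Independence of \<open>W\<close> and \<open>N\<close>.  The transform identity holds for all frequencies and, for each fixed Laplace
parameter, is first inverted in \<open>W\<close>; the result, valid for all Laplace parameters, is then inverted in
\<open>N\<close>.\<close>

theorem increments_factorize: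
  assumes st: "0 \<le> s" "s < t" "t \<le> T"
    and B: "B \<in> sets (F s)" and A[measurable]: "A \<in> sets borel" and A'[measurable]: "A' \<in> sets borel"
  shows "prob (B \<inter> {\<omega>\<in>space M. W t \<omega> - W s \<omega> \<in> A} \<inter> {\<omega>\<in>space M. N t \<omega> - N s \<omega> \<in> A'})
      = prob B * prob {\<omega>\<in>space M. W t \<omega> - W s \<omega> \<in> A} * prob {\<omega>\<in>space M. N t \<omega> - N s \<omega> \<in> A'}"
proof -
  note [measurable] = W_incr_measurable[OF st] N_incr_measurable[OF st]
  have BM[measurable]: "B \<in> events" using sets_F_subset st B by auto
  define C where "C = B \<inter> {\<omega>\<in>space M. W t \<omega> - W s \<omega> \<in> A}"
  have [measurable]: "C \<in> events" unfolding C_def by measurable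
  have Z: "(\<lambda>\<omega>. complex_of_real (indicator B \<omega>)) \<in> borel_measurable (F s)"
    using B by measurable
  have main: "(\<integral>\<omega>. indicator C \<omega> * N_Laplace \<theta> s t \<omega> \<partial>M)
      = prob B * expectation (N_Laplace \<theta> s t) * prob {\<omega>\<in>space M. W t \<omega> - W s \<omega> \<in> A}" if \<theta>: "0 \<le> \<theta>" for \<theta>
  proof -
    note iY = N_Laplace_integrable[OF st(1) less_imp_le[OF st(2)] st(3) \<theta>]
    note Y1 = N_Laplace_le_1[OF st(1) less_imp_le[OF st(2)] st(3) \<theta>]
    have i: "integrable M (\<lambda>\<omega>. indicator B \<omega> * N_Laplace \<theta> s t \<omega>)"
      using integrable_real_mult_indicator[OF BM iY] by (simp add: mult.commute)
    have jt: "(\<integral>\<omega>. of_real (indicator B \<omega>) * (W_char u s t \<omega> * of_real (N_Laplace \<theta> s t \<omega>)) \<partial>M)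
      = of_real (prob B) * ((\<integral>\<omega>. W_char u s t \<omega> \<partial>M) * of_real (expectation (N_Laplace \<theta> s t)))" for u
    proof -
      have "AE \<omega> in M. cmod (complex_of_real (indicator B \<omega>)) \<le> 1"
        by (auto simp: indicator_def)
      moreover have "(\<integral>\<omega>. complex_of_real (indicator B \<omega>) \<partial>M) = of_real (prob B)"
        unfolding integral_of_real by simp
      ultimately show ?thesis using joint_transform[OF st Z _ \<theta>, of u] by metis
    qed
    have "(\<integral>\<omega>. of_real (indicator B \<omega>) * (W_char 0 s t \<omega> * of_real (N_Laplace \<theta> s t \<omega>)) \<partial>M)
      = (\<integral>\<omega>. complex_of_real (indicator B \<omega> * N_Laplace \<theta> s t \<omega>) \<partial>M)"
      by (intro Bochner_Integration.integral_cong) (auto simp: W_char_def)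
    also have "\<dots> = complex_of_real (\<integral>\<omega>. indicator B \<omega> * N_Laplace \<theta> s t \<omega> \<partial>M)"
      by (rule integral_of_real[OF i])
    finally have "(\<integral>\<omega>. of_real (indicator B \<omega>) * (W_char 0 s t \<omega> * of_real (N_Laplace \<theta> s t \<omega>)) \<partial>M)
      = complex_of_real (\<integral>\<omega>. indicator B \<omega> * N_Laplace \<theta> s t \<omega> \<partial>M)" .
    \<comment> \<open>At frequency \<open>0\<close> the factor of \<open>W\<close> disappears, which leaves the independence of \<open>B\<close> and the increment of \<open>N\<close>.\<close>
    with jt[of 0] have eB: "(\<integral>\<omega>. indicator B \<omega> * N_Laplace \<theta> s t \<omega> \<partial>M) = prob B * expectation (N_Laplace \<theta> s t)"
      unfolding of_real_eq_iff[symmetric, where 'a=complex] by (simp add: W_char_def prob_space)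
    have "(\<integral>\<omega>. indicator C \<omega> * N_Laplace \<theta> s t \<omega> \<partial>M)
        = (\<integral>\<omega>. (indicator B \<omega> * N_Laplace \<theta> s t \<omega>) * indicator A (W t \<omega> - W s \<omega>) \<partial>M)"
      by (intro Bochner_Integration.integral_cong) (auto simp: C_def indicator_def)
    also have "\<dots> = expectation (\<lambda>\<omega>. indicator B \<omega> * N_Laplace \<theta> s t \<omega>) * prob {\<omega>\<in>space M. W t \<omega> - W s \<omega> \<in> A}"
    proof (rule weighted_prob_eq_if_char_eq[OF _ i])
      show "AE \<omega> in M. 0 \<le> indicator B \<omega> * N_Laplace \<theta> s t \<omega>"
        using Y1 by eventually_elim auto
      show "(\<integral>\<omega>. of_real (indicator B \<omega> * N_Laplace \<theta> s t \<omega>) * iexp (u * (W t \<omega> - W s \<omega>)) \<partial>M)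
        = of_real (\<integral>\<omega>. indicator B \<omega> * N_Laplace \<theta> s t \<omega> \<partial>M) * (\<integral>\<omega>. iexp (u * (W t \<omega> - W s \<omega>)) \<partial>M)" for u
        using jt[of u] unfolding eB W_char_def by (simp add: mult_ac)
    qed auto
    finally show ?thesis unfolding eB .
  qed
  \<comment> \<open>At \<open>\<theta> = 0\<close> the factor of \<open>N\<close> disappears, which leaves the independence of \<open>B\<close> and the increment of \<open>W\<close>.\<close>
  have pC: "prob C = prob B * prob {\<omega>\<in>space M. W t \<omega> - W s \<omega> \<in> A}"
    using main[of 0] by (simp add: N_Laplace_def[abs_def] prob_space)
  have "prob (C \<inter> {\<omega>\<in>space M. N t \<omega> - N s \<omega> \<in> A'}) = prob C * prob {\<omega>\<in>space M. N t \<omega> - N s \<omega> \<in> A'}"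
  proof (rule prob_factorizes_if_Laplace_factorizes)
    show "AE \<omega> in M. N t \<omega> - N s \<omega> \<in> \<nat>" by (rule N_incr_nat[OF st])
    show "(\<integral>\<omega>. indicator C \<omega> * exp (- \<theta> * (N t \<omega> - N s \<omega>)) \<partial>M)
      = prob C * expectation (\<lambda>\<omega>. exp (- \<theta> * (N t \<omega> - N s \<omega>)))" if "0 \<le> \<theta>" for \<theta>
      using main[OF that] unfolding N_Laplace_def[abs_def] pC by (simp add: mult_ac)
  qed auto
  then show ?thesis unfolding pC unfolding C_def .
qed

text \<open>All increments over a grid form one family, in which the Boolean tells the process: \<open>True\<close> stands for
\<open>W\<close> and \<open>False\<close> for \<open>N\<close>.\<close>

definition increment :: "(nat \<Rightarrow> real) \<Rightarrow> nat \<times> bool \<Rightarrow> 'a \<Rightarrow> real" where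
  "increment \<tau> i \<omega> = (if snd i then W (\<tau> (Suc (fst i))) \<omega> - W (\<tau> (fst i)) \<omega>
     else N (\<tau> (Suc (fst i))) \<omega> - N (\<tau> (fst i)) \<omega>)"

definition grid :: "nat \<Rightarrow> (nat \<Rightarrow> real) \<Rightarrow> bool" where
  "grid L \<tau> \<longleftrightarrow> 0 \<le> \<tau> 0 \<and> \<tau> L \<le> T \<and> (\<forall>p<L. \<tau> p < \<tau> (Suc p))"

lemma grid_less:
  assumes "grid L \<tau>" "p < q" "q \<le> L"
  shows "\<tau> p < \<tau> q"
  using assms(2,3)
proof (induction q)
  case (Suc q)
  have "\<tau> q < \<tau> (Suc q)" using assms(1) Suc.prems by (auto simp: grid_def)
  then show ?case using Suc by (cases "p = q") auto
qed simp

lemma grid_bounds: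
  assumes g: "grid L \<tau>" and p: "p \<le> L"
  shows "0 \<le> \<tau> p" "\<tau> p \<le> T"
proof -
  have "\<tau> 0 \<le> \<tau> p" using grid_less[OF g, of 0 p] p by (cases "p = 0") auto
  moreover have "\<tau> p \<le> \<tau> L" using grid_less[OF g, of p L] p by (cases "p = L") auto
  ultimately show "0 \<le> \<tau> p" "\<tau> p \<le> T" using g by (auto simp: grid_def)
qed

lemma increment_measurable_F:
  assumes "grid L \<tau>" "fst i < m" "m \<le> L"
  shows "increment \<tau> i \<in> borel_measurable (F (\<tau> m))"
proof -
  have "0 \<le> \<tau> (fst i)" "\<tau> (fst i) \<le> T" "0 \<le> \<tau> (Suc (fst i))" "\<tau> (Suc (fst i)) \<le> T"
    using grid_bounds[OF assms(1)] assms(2,3) by auto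
  moreover have "\<tau> (fst i) \<le> \<tau> m" "\<tau> (Suc (fst i)) \<le> \<tau> m"
    using grid_less[OF assms(1), of "fst i" m] grid_less[OF assms(1), of "Suc (fst i)" m] assms
    by (auto simp: less_imp_le, metis Suc_lessI less_imp_le order_refl)
  ultimately show ?thesis
    unfolding increment_def[abs_def] using W_measurable_F N_measurable_F by (cases "snd i") auto
qed

lemma increment_measurable:
  assumes "grid L \<tau>" "fst i < L"
  shows "increment \<tau> i \<in> borel_measurable M"
  using measurable_F_imp_M[OF increment_measurable_F[OF assms order_refl]] grid_bounds[OF assms(1)] by auto

theorem indep_vars_increments:
  assumes g: "grid L \<tau>" and L: "0 < L"
  shows "indep_vars (\<lambda>_. borel) (increment \<tau>) ({..<L} \<times> UNIV)"
proof -
  have fact: "prob {\<omega>\<in>space M. \<forall>p<m. \<forall>b. increment \<tau> (p, b) \<omega> \<in> A (p, b)}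
      = (\<Prod>p<m. \<Prod>b\<in>UNIV. prob {\<omega>\<in>space M. increment \<tau> (p, b) \<omega> \<in> A (p, b)})"
    if m: "m \<le> L" and A: "\<And>p b. p < L \<Longrightarrow> A (p, b) \<in> sets borel" for m and A :: "nat \<times> bool \<Rightarrow> real set"
    using m
  proof (induction m)
    case 0
    then show ?case by (simp add: prob_space)
  next
    case (Suc m)
    let ?B = "{\<omega>\<in>space M. \<forall>p<m. \<forall>b. increment \<tau> (p, b) \<omega> \<in> A (p, b)}"
    have st: "0 \<le> \<tau> m" "\<tau> m < \<tau> (Suc m)" "\<tau> (Suc m) \<le> T"
      using Suc.prems grid_bounds[OF g] grid_less[OF g, of m "Suc m"] by auto
    have "?B = {\<omega>\<in>space (F (\<tau> m)). \<forall>p\<in>{..<m}. \<forall>b\<in>UNIV. increment \<tau> (p, b) \<omega> \<in> A (p, b)}"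
      using space_F by auto
    also have "\<dots> \<in> sets (F (\<tau> m))"
    proof (intro sets.sets_Collect_finite_All)
      fix p b assume "p \<in> {..<m}"
      then have "increment \<tau> (p, b) \<in> borel_measurable (F (\<tau> m))" "A (p, b) \<in> sets borel"
        using increment_measurable_F[OF g, of "(p, b)" m] Suc.prems A by auto
      then show "{\<omega>\<in>space (F (\<tau> m)). increment \<tau> (p, b) \<omega> \<in> A (p, b)} \<in> sets (F (\<tau> m))"
        by measurable
    qed auto
    finally have B: "?B \<in> sets (F (\<tau> m))" .
    have split: "{\<omega>\<in>space M. \<forall>p<Suc m. \<forall>b. increment \<tau> (p, b) \<omega> \<in> A (p, b)}
        = ?B \<inter> {\<omega>\<in>space M. W (\<tau> (Suc m)) \<omega> - W (\<tau> m) \<omega> \<in> A (m, True)}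
          \<inter> {\<omega>\<in>space M. N (\<tau> (Suc m)) \<omega> - N (\<tau> m) \<omega> \<in> A (m, False)}"
      by (auto simp: increment_def less_Suc_eq all_bool_eq)
    have "A (m, True) \<in> sets borel" "A (m, False) \<in> sets borel"
      using Suc.prems A by auto
    from increments_factorize[OF st B this] Suc show ?case
      unfolding split by (simp add: UNIV_bool increment_def mult_ac)
  qed
  show ?thesis
  proof (subst indep_vars_finite[where E="\<lambda>_. sets borel"])
    show "\<forall>A\<in>({..<L} \<times> UNIV) \<rightarrow> sets borel.
        prob (\<Inter>j\<in>{..<L} \<times> UNIV. increment \<tau> j -` A j \<inter> space M)
        = (\<Prod>j\<in>{..<L} \<times> UNIV. prob (increment \<tau> j -` A j \<inter> space M))"
    proof
      fix A :: "nat \<times> bool \<Rightarrow> real set" assume A: "A \<in> ({..<L} \<times> UNIV) \<rightarrow> sets borel"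
      have eq: "increment \<tau> j -` A j \<inter> space M = {\<omega>\<in>space M. increment \<tau> j \<omega> \<in> A j}" for j
        by auto
      have "(\<Inter>j\<in>{..<L} \<times> UNIV. increment \<tau> j -` A j \<inter> space M)
          = {\<omega>\<in>space M. \<forall>p<L. \<forall>b. increment \<tau> (p, b) \<omega> \<in> A (p, b)}"
        using L by auto
      then show "prob (\<Inter>j\<in>{..<L} \<times> UNIV. increment \<tau> j -` A j \<inter> space M)
          = (\<Prod>j\<in>{..<L} \<times> UNIV. prob (increment \<tau> j -` A j \<inter> space M))"
        using fact[of L A] A unfolding eq by (simp add: prod.cartesian_product Pi_iff)
    qed
  next
    show "random_variable borel (increment \<tau> i)" if "i \<in> {..<L} \<times> UNIV" for i
      using increment_measurable[OF g, of i] that by auto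
    show "sets borel = sigma_sets (space borel) (sets (borel :: real measure))"
      by (rule sets.sigma_sets_eq[symmetric])
  qed (use L in \<open>auto simp: Int_stable_def\<close>)
qed

end

section \<open>The Ito isometry\<close>

context wiener_poisson
begin

lemma
  assumes st: "0 \<le> s" "s \<le> t" "t \<le> T"
    and U: "U \<in> borel_measurable (F s)" "integrable M U"
  shows past_mult_W_incr: "has_bochner_integral M (\<lambda>\<omega>. U \<omega> * (W t \<omega> - W s \<omega>)) 0"
    and past_mult_W_incr_square:
      "has_bochner_integral M (\<lambda>\<omega>. U \<omega> * (W t \<omega> - W s \<omega>)\<^sup>2) (expectation U * (t - s))"
proof -
  have "has_bochner_integral M (\<lambda>\<omega>. U \<omega> * (W t \<omega> - W s \<omega>)) 0 \<and>
    has_bochner_integral M (\<lambda>\<omega>. U \<omega> * (W t \<omega> - W s \<omega>)\<^sup>2) (expectation U * (t - s))"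
  proof (cases "s = t")
    case False
    with st have st': "s < t" by simp
    have 1: "indep_var borel U borel (\<lambda>\<omega>. W t \<omega> - W s \<omega>)"
      using indep_var_past_W[OF st(1) st' st(3) U(1), of "\<lambda>x. x" borel] by simp
    have 2: "indep_var borel U borel (\<lambda>\<omega>. (W t \<omega> - W s \<omega>)\<^sup>2)"
      using indep_var_past_W[OF st(1) st' st(3) U(1), of "\<lambda>x. x\<^sup>2" borel] by simp
    show ?thesis
      using indep_var_integrable[OF 1 U(2)] indep_var_lebesgue_integral[OF 1 U(2)]
        indep_var_integrable[OF 2 U(2)] indep_var_lebesgue_integral[OF 2 U(2)]
        W_incr_first_moment[OF st(1) st' st(3)] W_incr_second_moment[OF st(1) st' st(3)]
      by (auto simp: has_bochner_integral_iff)
  qed (simp add: has_bochner_integral_zero)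
  then show "has_bochner_integral M (\<lambda>\<omega>. U \<omega> * (W t \<omega> - W s \<omega>)) 0"
    and "has_bochner_integral M (\<lambda>\<omega>. U \<omega> * (W t \<omega> - W s \<omega>)\<^sup>2) (expectation U * (t - s))"
    by auto
qed

lemma past_mult_W_incr_sq_integrable:
  assumes st: "0 \<le> s" "s \<le> t" "t \<le> T"
    and U: "U \<in> borel_measurable (F s)" "sq_integrable M U"
  shows "sq_integrable M (\<lambda>\<omega>. U \<omega> * (W t \<omega> - W s \<omega>))"
proof -
  have "integrable M (\<lambda>\<omega>. (U \<omega>)\<^sup>2 * (W t \<omega> - W s \<omega>)\<^sup>2)"
    using past_mult_W_incr_square[OF st, of "\<lambda>\<omega>. (U \<omega>)\<^sup>2"] U
    by (auto simp: sq_integrable_def has_bochner_integral_iff)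
  then show ?thesis
    using W_measurable[of s] W_measurable[of t] U st
    by (auto simp: sq_integrable_def power_mult_distrib)
qed

text \<open>Splitting both intervals at their common endpoints leaves, besides the square over the
  intersection, only products in which the latest increment is independent of all other factors.\<close>

lemma expectation_mult_elementary_ordered:
  assumes ab: "0 \<le> a" "a \<le> b" "b \<le> T" and cd: "c \<le> d" "d \<le> T" and ac: "a \<le> c"
    and \<xi>: "\<xi> \<in> borel_measurable (F a)" "sq_integrable M \<xi>"
    and \<eta>: "\<eta> \<in> borel_measurable (F c)" "sq_integrable M \<eta>"
  shows "expectation (\<lambda>\<omega>. (\<xi> \<omega> * (W b \<omega> - W a \<omega>)) * (\<eta> \<omega> * (W d \<omega> - W c \<omega>)))
    = expectation (\<lambda>\<omega>. \<xi> \<omega> * \<eta> \<omega>) * max 0 (min b d - c)"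
proof (cases "b \<le> c")
  case True
  have "integrable M (\<lambda>\<omega>. (\<xi> \<omega> * (W b \<omega> - W a \<omega>)) * \<eta> \<omega>)"
    using past_mult_W_incr_sq_integrable[OF ab \<xi>] \<eta>(2) by (rule sq_integrable_mult)
  moreover have "(\<lambda>\<omega>. (\<xi> \<omega> * (W b \<omega> - W a \<omega>)) * \<eta> \<omega>) \<in> borel_measurable (F c)"
    using measurable_F_mono[OF \<xi>(1) ac] \<eta>(1) W_measurable_F[of a c] W_measurable_F[of b c] ab ac True
    by auto
  ultimately have "has_bochner_integral M
      (\<lambda>\<omega>. (\<xi> \<omega> * (W b \<omega> - W a \<omega>)) * \<eta> \<omega> * (W d \<omega> - W c \<omega>)) 0"
    using ab ac cd by (intro past_mult_W_incr) auto
  then show ?thesis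
    using True by (simp add: has_bochner_integral_iff mult.assoc)
next
  case False
  define e where "e = min b d"
  have e: "c \<le> e" "e \<le> b" "e \<le> d" "e \<le> T" and c: "0 \<le> c" "c \<le> T"
    using False cd ab ac by (auto simp: e_def)
  let ?D = "\<lambda>s t \<omega>. W t \<omega> - W s \<omega>"
  have \<xi>c: "\<xi> \<in> borel_measurable (F c)" by (rule measurable_F_mono[OF \<xi>(1) ac])
  have i: "integrable M (\<lambda>\<omega>. \<xi> \<omega> * \<eta> \<omega>)" by (rule sq_integrable_mult[OF \<xi>(2) \<eta>(2)])
  have m: "(\<lambda>\<omega>. \<xi> \<omega> * \<eta> \<omega>) \<in> borel_measurable (F c)" using \<xi>c \<eta>(1) by auto
  have 1: "has_bochner_integral M (\<lambda>\<omega>. (\<xi> \<omega> * ?D a c \<omega>) * \<eta> \<omega> * ?D c d \<omega>) 0"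
  proof (rule past_mult_W_incr[OF c(1) cd])
    show "integrable M (\<lambda>\<omega>. (\<xi> \<omega> * ?D a c \<omega>) * \<eta> \<omega>)"
      using past_mult_W_incr_sq_integrable[OF ab(1) ac c(2) \<xi>] \<eta>(2) by (rule sq_integrable_mult)
    show "(\<lambda>\<omega>. (\<xi> \<omega> * ?D a c \<omega>) * \<eta> \<omega>) \<in> borel_measurable (F c)"
      using \<xi>c \<eta>(1) W_measurable_F[of a c] W_measurable_F[of c c] ab ac c by auto
  qed
  have 2: "has_bochner_integral M (\<lambda>\<omega>. (\<xi> \<omega> * \<eta> \<omega>) * (?D c e \<omega>)\<^sup>2) (expectation (\<lambda>\<omega>. \<xi> \<omega> * \<eta> \<omega>) * (e - c))"
    by (rule past_mult_W_incr_square[OF c(1) e(1,4) m i])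
  have iU: "integrable M (\<lambda>\<omega>. (\<xi> \<omega> * \<eta> \<omega>) * ?D c e \<omega>)"
    using past_mult_W_incr[OF c(1) e(1,4) m i] by (simp add: has_bochner_integral_iff)
  have mU: "(\<lambda>\<omega>. (\<xi> \<omega> * \<eta> \<omega>) * ?D c e \<omega>) \<in> borel_measurable (F e)"
    using measurable_F_mono[OF m e(1)] W_measurable_F[of c e] W_measurable_F[of e e] c e by auto
  have 3: "has_bochner_integral M (\<lambda>\<omega>. (\<xi> \<omega> * \<eta> \<omega>) * ?D c e \<omega> * ?D e b \<omega>) 0"
    by (rule past_mult_W_incr) (use mU iU e c ab in auto)
  have 4: "has_bochner_integral M (\<lambda>\<omega>. (\<xi> \<omega> * \<eta> \<omega>) * ?D c e \<omega> * ?D e d \<omega>) 0"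
    by (rule past_mult_W_incr) (use mU iU e c cd in auto)
  have eq: "(\<xi> \<omega> * ?D a b \<omega>) * (\<eta> \<omega> * ?D c d \<omega>)
      = (\<xi> \<omega> * ?D a c \<omega>) * \<eta> \<omega> * ?D c d \<omega> + (\<xi> \<omega> * \<eta> \<omega>) * (?D c e \<omega>)\<^sup>2
        + ((\<xi> \<omega> * \<eta> \<omega>) * ?D c e \<omega> * ?D e b \<omega> + (\<xi> \<omega> * \<eta> \<omega>) * ?D c e \<omega> * ?D e d \<omega>)" for \<omega>
    unfolding e_def by (cases "b \<le> d") (simp_all add: min_def algebra_simps power2_eq_square)
  have "has_bochner_integral M (\<lambda>\<omega>. (\<xi> \<omega> * ?D a b \<omega>) * (\<eta> \<omega> * ?D c d \<omega>))
      (0 + expectation (\<lambda>\<omega>. \<xi> \<omega> * \<eta> \<omega>) * (e - c) + (0 + 0))"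
    unfolding eq by (intro has_bochner_integral_add 1 2 3 4)
  then show ?thesis
    using e by (simp add: has_bochner_integral_iff e_def[symmetric])
qed

lemma expectation_mult_elementary:
  assumes ab: "0 \<le> a" "a \<le> b" "b \<le> T" and cd: "0 \<le> c" "c \<le> d" "d \<le> T"
    and \<xi>: "\<xi> \<in> borel_measurable (F a)" "sq_integrable M \<xi>"
    and \<eta>: "\<eta> \<in> borel_measurable (F c)" "sq_integrable M \<eta>"
  shows "expectation (\<lambda>\<omega>. (\<xi> \<omega> * (W b \<omega> - W a \<omega>)) * (\<eta> \<omega> * (W d \<omega> - W c \<omega>)))
    = expectation (\<lambda>\<omega>. \<xi> \<omega> * \<eta> \<omega>) * max 0 (min b d - max a c)"
proof (cases "a \<le> c")
  case True
  with expectation_mult_elementary_ordered[OF ab cd(2,3) True \<xi> \<eta>] show ?thesis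
    by (simp add: max_absorb2)
next
  case False
  then have "c \<le> a" by simp
  from expectation_mult_elementary_ordered[OF cd ab(2,3) this \<eta> \<xi>] this show ?thesis
    by (simp add: max_absorb1 min.commute mult.commute)
qed

abbreviation time_measure :: "real measure" where
  "time_measure \<equiv> restrict_space lborel {0..T}"

abbreviation process_measure :: "(real \<times> 'a) measure" where
  "process_measure \<equiv> time_measure \<Otimes>\<^sub>M M"

lemma indicator_measurable_time:
  "A \<in> sets borel \<Longrightarrow> (indicator A :: real \<Rightarrow> real) \<in> borel_measurable time_measure"
  by (intro measurable_restrict_space1) auto

lemma integral_time_indicator_mult:
  assumes "0 \<le> a" "b \<le> T" "0 \<le> c" "d \<le> T"
  shows "has_bochner_integral time_measure
    (\<lambda>t. indicator {a<..b} t * indicator {c<..d} t :: real) (max 0 (min b d - max a c))"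
proof -
  have *: "(\<lambda>t. indicator {0..T} t *\<^sub>R (indicator {a<..b} t * indicator {c<..d} t :: real))
      = indicator {max a c<..min b d}"
    using assms by (auto simp: fun_eq_iff indicator_def)
  have "has_bochner_integral lborel (indicator {max a c<..min b d}) (max 0 (min b d - max a c))"
  proof (cases "max a c \<le> min b d")
    case True
    then show ?thesis
      using has_bochner_integral_real_indicator[of "{max a c<..min b d}" lborel] by (simp add: max_absorb2)
  next
    case False
    then have "indicator {max a c<..min b d} = (\<lambda>_. 0 :: real)" "max 0 (min b d - max a c) = 0"
      by (auto simp: fun_eq_iff indicator_def)
    then show ?thesis by (simp add: has_bochner_integral_zero)
  qed
  then show ?thesis
    unfolding has_bochner_integral_restrict_space[of "{0..T}" lborel, simplified] * .
qed

text \<open>Both sides expand into the same double sum.  The intervals may overlap arbitrarily, so that the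
difference of two simple processes on different partitions is covered without a common refinement.\<close>

theorem ito_isometry:
  fixes a b :: "'i \<Rightarrow> real" and \<xi> :: "'i \<Rightarrow> 'a \<Rightarrow> real"
  assumes I: "finite I"
    and ab: "\<And>i. i \<in> I \<Longrightarrow> 0 \<le> a i \<and> a i \<le> b i \<and> b i \<le> T"
    and \<xi>: "\<And>i. i \<in> I \<Longrightarrow> \<xi> i \<in> borel_measurable (F (a i)) \<and> sq_integrable M (\<xi> i)"
  shows "(\<integral>\<^sup>+x. ennreal ((\<Sum>i\<in>I. \<xi> i (snd x) * indicator {a i<..b i} (fst x))\<^sup>2) \<partial>process_measure)
      = (\<integral>\<^sup>+\<omega>. ennreal ((\<Sum>i\<in>I. \<xi> i \<omega> * (W (b i) \<omega> - W (a i) \<omega>))\<^sup>2) \<partial>M)"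
proof -
  have [measurable]: "i \<in> I \<Longrightarrow> \<xi> i \<in> borel_measurable M" for i
    using \<xi> by (auto simp: sq_integrable_def)
  note [measurable] = indicator_measurable_time
  have i\<xi>: "integrable M (\<lambda>\<omega>. \<xi> i \<omega> * \<xi> j \<omega>)" if "i \<in> I" "j \<in> I" for i j
    using \<xi> that by (intro sq_integrable_mult) auto
  let ?c = "\<lambda>i j. expectation (\<lambda>\<omega>. \<xi> i \<omega> * \<xi> j \<omega>)"
  let ?l = "\<lambda>i j. max 0 (min (b i) (b j) - max (a i) (a j))"
  let ?ind = "\<lambda>i t. indicator {a i<..b i} t :: real"
  let ?K = "\<lambda>t. \<Sum>i\<in>I. \<Sum>j\<in>I. ?c i j * (?ind i t * ?ind j t)"
  have inner: "(\<integral>\<^sup>+\<omega>. ennreal ((\<Sum>i\<in>I. \<xi> i \<omega> * ?ind i t)\<^sup>2) \<partial>M) = ennreal (?K t) \<and> 0 \<le> ?K t" for t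
  proof -
    have h: "has_bochner_integral M (\<lambda>\<omega>. \<Sum>i\<in>I. \<Sum>j\<in>I. (\<xi> i \<omega> * \<xi> j \<omega>) * (?ind i t * ?ind j t)) (?K t)"
      by (intro has_bochner_integral_sum has_bochner_integral_mult_left has_bochner_integral_integrable i\<xi>)
    moreover have "(\<Sum>i\<in>I. \<Sum>j\<in>I. (\<xi> i \<omega> * \<xi> j \<omega>) * (?ind i t * ?ind j t)) = (\<Sum>i\<in>I. \<xi> i \<omega> * ?ind i t)\<^sup>2" for \<omega>
      unfolding power2_eq_square sum_product by (intro sum.cong) (auto simp: mult_ac)
    ultimately have h: "has_bochner_integral M (\<lambda>\<omega>. (\<Sum>i\<in>I. \<xi> i \<omega> * ?ind i t)\<^sup>2) (?K t)" by simp
    note i = integrable.intros[OF h] and e = has_bochner_integral_integral_eq[OF h]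
    have "0 \<le> ?K t" unfolding e[symmetric] by simp
    moreover have "(\<integral>\<^sup>+\<omega>. ennreal ((\<Sum>i\<in>I. \<xi> i \<omega> * ?ind i t)\<^sup>2) \<partial>M) = ennreal (?K t)"
      using nn_integral_eq_integral[OF i] unfolding e by simp
    ultimately show ?thesis by blast
  qed
  have "(\<integral>\<^sup>+x. ennreal ((\<Sum>i\<in>I. \<xi> i (snd x) * ?ind i (fst x))\<^sup>2) \<partial>process_measure)
      = (\<integral>\<^sup>+t. \<integral>\<^sup>+\<omega>. ennreal ((\<Sum>i\<in>I. \<xi> i \<omega> * ?ind i t)\<^sup>2) \<partial>M \<partial>time_measure)"
    by (subst nn_integral_fst[symmetric]) auto
  also have "\<dots> = (\<integral>\<^sup>+t. ennreal (?K t) \<partial>time_measure)"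
    using inner by simp
  also have "\<dots> = ennreal (\<Sum>i\<in>I. \<Sum>j\<in>I. ?c i j * ?l i j)"
  proof -
    have "has_bochner_integral time_measure ?K (\<Sum>i\<in>I. \<Sum>j\<in>I. ?c i j * ?l i j)"
      using ab by (intro has_bochner_integral_sum has_bochner_integral_mult_right integral_time_indicator_mult) auto
    note i = integrable.intros[OF this] and e = has_bochner_integral_integral_eq[OF this]
    show ?thesis
      using nn_integral_eq_integral[OF i] inner unfolding e by simp
  qed
  also have "(\<Sum>i\<in>I. \<Sum>j\<in>I. ?c i j * ?l i j)
      = expectation (\<lambda>\<omega>. (\<Sum>i\<in>I. \<xi> i \<omega> * (W (b i) \<omega> - W (a i) \<omega>))\<^sup>2)"
  proof -
    have sq: "sq_integrable M (\<lambda>\<omega>. \<xi> i \<omega> * (W (b i) \<omega> - W (a i) \<omega>))" if "i \<in> I" for i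
      using ab[OF that] \<xi>[OF that] by (intro past_mult_W_incr_sq_integrable) auto
    have "expectation (\<lambda>\<omega>. (\<Sum>i\<in>I. \<xi> i \<omega> * (W (b i) \<omega> - W (a i) \<omega>))\<^sup>2)
        = (\<Sum>i\<in>I. \<Sum>j\<in>I. expectation (\<lambda>\<omega>. (\<xi> i \<omega> * (W (b i) \<omega> - W (a i) \<omega>)) * (\<xi> j \<omega> * (W (b j) \<omega> - W (a j) \<omega>))))"
      unfolding power2_eq_square sum_product
      using sq by (simp add: sq_integrable_mult Bochner_Integration.integral_sum Bochner_Integration.integrable_sum)
    also have "\<dots> = (\<Sum>i\<in>I. \<Sum>j\<in>I. ?c i j * ?l i j)"
      using ab \<xi> by (intro sum.cong expectation_mult_elementary refl) auto
    finally show ?thesis by simp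
  qed
  also have "ennreal \<dots> = (\<integral>\<^sup>+\<omega>. ennreal ((\<Sum>i\<in>I. \<xi> i \<omega> * (W (b i) \<omega> - W (a i) \<omega>))\<^sup>2) \<partial>M)"
  proof -
    have "sq_integrable M (\<lambda>\<omega>. \<Sum>i\<in>I. \<xi> i \<omega> * (W (b i) \<omega> - W (a i) \<omega>))"
      using ab \<xi> by (intro sq_integrable_sum past_mult_W_incr_sq_integrable) auto
    then show ?thesis
      by (intro nn_integral_eq_integral[symmetric]) (auto simp: sq_integrable_def)
  qed
  finally show ?thesis .
qed

lemma ito_isometry_diff:
  fixes s s' :: "nat \<Rightarrow> real"
  assumes s: "grid m s" "\<And>i. i < m \<Longrightarrow> \<xi> i \<in> borel_measurable (F (s i)) \<and> sq_integrable M (\<xi> i)"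
    and s': "grid m' s'" "\<And>i. i < m' \<Longrightarrow> \<xi>' i \<in> borel_measurable (F (s' i)) \<and> sq_integrable M (\<xi>' i)"
  shows "(\<integral>\<^sup>+x. ennreal ((simple_process (m, s, \<xi>) (fst x) (snd x) - simple_process (m', s', \<xi>') (fst x) (snd x))\<^sup>2)
        \<partial>process_measure)
      = (\<integral>\<^sup>+\<omega>. ennreal ((simple_integral W (m, s, \<xi>) \<omega> - simple_integral W (m', s', \<xi>') \<omega>)\<^sup>2) \<partial>M)"
proof -
  let ?I = "{..<m} <+> {..<m'}"
  define a where "a = case_sum s s'"
  define b where "b = case_sum (\<lambda>i. s (Suc i)) (\<lambda>i. s' (Suc i))"
  define \<zeta> where "\<zeta> = case_sum \<xi> (\<lambda>i \<omega>. - \<xi>' i \<omega>)"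
  have "(\<integral>\<^sup>+x. ennreal ((\<Sum>i\<in>?I. \<zeta> i (snd x) * indicator {a i<..b i} (fst x))\<^sup>2) \<partial>process_measure)
      = (\<integral>\<^sup>+\<omega>. ennreal ((\<Sum>i\<in>?I. \<zeta> i \<omega> * (W (b i) \<omega> - W (a i) \<omega>))\<^sup>2) \<partial>M)"
  proof (rule ito_isometry)
    show "0 \<le> a i \<and> a i \<le> b i \<and> b i \<le> T" if "i \<in> ?I" for i
      using that grid_bounds[OF s(1)] grid_bounds[OF s'(1)] grid_less[OF s(1)] grid_less[OF s'(1)]
      by (auto simp: a_def b_def less_imp_le)
    show "\<zeta> i \<in> borel_measurable (F (a i)) \<and> sq_integrable M (\<zeta> i)" if "i \<in> ?I" for i
      using that s(2) s'(2) by (auto simp: \<zeta>_def a_def sq_integrable_def)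
  qed simp
  then show ?thesis
    by (simp only: sum.Plus[OF finite_lessThan finite_lessThan] a_def b_def \<zeta>_def o_def sum.case
      mult_minus_left sum_negf add_uminus_conv_diff simple_process.simps simple_integral.simps)
qed

end

section \<open>The integral of the Poisson process as a limit of grid sums\<close>

lemma nn_integral_square_triangle:
  fixes f g h :: "'b \<Rightarrow> real"
  assumes [measurable]: "f \<in> borel_measurable M" "g \<in> borel_measurable M" "h \<in> borel_measurable M"
  shows "(\<integral>\<^sup>+x. ennreal ((f x - h x)\<^sup>2) \<partial>M)
    \<le> 2 * (\<integral>\<^sup>+x. ennreal ((f x - g x)\<^sup>2) \<partial>M) + 2 * (\<integral>\<^sup>+x. ennreal ((g x - h x)\<^sup>2) \<partial>M)"
proof -
  have "(\<integral>\<^sup>+x. ennreal ((f x - h x)\<^sup>2) \<partial>M)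
      \<le> (\<integral>\<^sup>+x. 2 * ennreal ((f x - g x)\<^sup>2) + 2 * ennreal ((g x - h x)\<^sup>2) \<partial>M)"
  proof (rule nn_integral_mono)
    fix x
    have "(f x - h x)\<^sup>2 \<le> 2 * (f x - g x)\<^sup>2 + 2 * (g x - h x)\<^sup>2"
      using zero_le_power2[of "(f x - g x) - (g x - h x)"] by (simp add: power2_eq_square algebra_simps)
    then have "ennreal ((f x - h x)\<^sup>2) \<le> ennreal (2 * (f x - g x)\<^sup>2 + 2 * (g x - h x)\<^sup>2)"
      by (rule ennreal_leI)
    also have "\<dots> = 2 * ennreal ((f x - g x)\<^sup>2) + 2 * ennreal ((g x - h x)\<^sup>2)"
      by (simp add: ennreal_plus ennreal_mult)
    finally show "ennreal ((f x - h x)\<^sup>2) \<le> 2 * ennreal ((f x - g x)\<^sup>2) + 2 * ennreal ((g x - h x)\<^sup>2)" .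
  qed
  also have "\<dots> = 2 * (\<integral>\<^sup>+x. ennreal ((f x - g x)\<^sup>2) \<partial>M) + 2 * (\<integral>\<^sup>+x. ennreal ((g x - h x)\<^sup>2) \<partial>M)"
    by (simp add: nn_integral_add nn_integral_cmult)
  finally show ?thesis .
qed

lemma borel_measurable_completion_AE:
  fixes f g :: "'b \<Rightarrow> real"
  assumes f: "f \<in> borel_measurable M" and eq: "AE x in M. f x = g x"
  shows "g \<in> borel_measurable (completion M)"
proof (rule measurableI)
  fix A :: "real set" assume A: "A \<in> sets borel"
  have [measurable]: "f \<in> borel_measurable (completion M)" using f by (rule measurable_completion)
  have 1: "Measurable.pred (completion M) (\<lambda>x. f x \<noteq> g x)"
    by (rule sets_completion_AE) (use eq in simp)
  have 2: "Measurable.pred (completion M) (\<lambda>x. g x \<in> A \<and> f x \<noteq> g x)"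
    by (rule sets_completion_AE) (use eq in auto)
  have "Measurable.pred (completion M) (\<lambda>x. (f x \<in> A \<and> \<not> f x \<noteq> g x) \<or> (g x \<in> A \<and> f x \<noteq> g x))"
    using 1 2 A by measurable
  also have "(\<lambda>x. (f x \<in> A \<and> \<not> f x \<noteq> g x) \<or> (g x \<in> A \<and> f x \<noteq> g x)) = (\<lambda>x. g x \<in> A)"
    by auto
  finally show "g -` A \<inter> space (completion M) \<in> sets (completion M)"
    by (simp add: pred_def vimage_def Int_def conj_commute)
qed simp

lemma (in prob_space) bounded_L2_approx:
  assumes f: "sq_integrable M f" and e: "0 < (e::real)"
  obtains c where "expectation (\<lambda>\<omega>. (f \<omega> - max (- c) (min c (f \<omega>)))\<^sup>2) \<le> e"
proof -
  note [measurable] = sq_integrable_measurable[OF f]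
  let ?g = "\<lambda>n \<omega>. (f \<omega> - max (- real n) (min (real n) (f \<omega>)))\<^sup>2"
  have "(\<lambda>n. expectation (?g n)) \<longlonglongrightarrow> (\<integral>\<omega>. 0 \<partial>M)"
  proof (rule integral_dominated_convergence)
    show "integrable M (\<lambda>\<omega>. (f \<omega>)\<^sup>2)" by (rule sq_integrable_integrable[OF f])
    show "AE \<omega> in M. (\<lambda>n. ?g n \<omega>) \<longlonglongrightarrow> 0"
    proof (rule AE_I2)
      fix \<omega>
      obtain n0 where n0: "\<bar>f \<omega>\<bar> \<le> real n0" using real_arch_simple by blast
      show "(\<lambda>n. ?g n \<omega>) \<longlonglongrightarrow> 0"
      proof (rule tendsto_eventually, rule eventually_sequentiallyI[of n0])
        fix n assume "n0 \<le> n"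
        then have "\<bar>f \<omega>\<bar> \<le> real n" using n0 by (meson of_nat_le_iff order_trans)
        then show "?g n \<omega> = 0" by (auto simp: min_def max_def)
      qed
    qed
    show "AE \<omega> in M. norm (?g n \<omega>) \<le> (f \<omega>)\<^sup>2" for n
    proof (rule AE_I2)
      fix \<omega>
      have "\<bar>f \<omega> - max (- real n) (min (real n) (f \<omega>))\<bar> \<le> \<bar>f \<omega>\<bar>"
        by (auto simp: min_def max_def)
      then show "norm (?g n \<omega>) \<le> (f \<omega>)\<^sup>2" by (simp add: abs_le_square_iff)
    qed
  qed auto
  then have "eventually (\<lambda>n. expectation (?g n) < e) sequentially"
    using e by (intro order_tendstoD) auto
  then obtain n where "expectation (?g n) < e" by (auto simp: eventually_sequentially)
  then show ?thesis using that[of "real n"] by simp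
qed

context wiener_poisson
begin

definition full_grid :: "nat \<Rightarrow> (nat \<Rightarrow> real) \<Rightarrow> real \<Rightarrow> bool" where
  "full_grid L \<tau> \<delta> \<longleftrightarrow> grid L \<tau> \<and> \<tau> 0 = 0 \<and> \<tau> L = T \<and> (\<forall>p<L. \<tau> (Suc p) - \<tau> p \<le> \<delta>)"

lemma full_gridD:
  assumes "full_grid L \<tau> \<delta>"
  shows "grid L \<tau>" "\<tau> 0 = 0" "\<tau> L = T" "\<And>p. p < L \<Longrightarrow> \<tau> (Suc p) - \<tau> p \<le> \<delta>"
  using assms by (auto simp: full_grid_def)

lemma sum_indicator_grid:
  assumes g: "grid L \<tau>" and p: "p < L" "\<tau> p < t" "t \<le> \<tau> (Suc p)"
  shows "(\<Sum>q<L. x q * indicator {\<tau> q<..\<tau> (Suc q)} t) = (x p :: real)"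
proof -
  have "(\<Sum>q<L. x q * indicator {\<tau> q<..\<tau> (Suc q)} t) = (\<Sum>q<L. if q = p then x p else 0)"
  proof (intro sum.cong refl)
    fix q assume q: "q \<in> {..<L}"
    show "x q * indicator {\<tau> q<..\<tau> (Suc q)} t = (if q = p then x p else 0)"
    proof (cases q p rule: linorder_cases)
      case less
      then have "\<tau> (Suc q) \<le> \<tau> p"
        using grid_less[OF g, of "Suc q" p] p by (cases "Suc q = p") auto
      then show ?thesis using less p by auto
    next
      case greater
      then have "\<tau> (Suc p) \<le> \<tau> q"
        using grid_less[OF g, of "Suc p" q] p q by (cases "Suc p = q") auto
      then show ?thesis using greater p by auto
    qed (use p in simp)
  qed
  then show ?thesis using p by simp
qed

lemma grid_cell:
  assumes g: "full_grid L \<tau> \<delta>" and t: "0 < t" "t \<le> T"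
  obtains p where "p < L" "\<tau> p < t" "t \<le> \<tau> (Suc p)"
proof -
  let ?q = "LEAST q. t \<le> \<tau> q"
  have "t \<le> \<tau> L" using t full_gridD[OF g] by simp
  then have q: "t \<le> \<tau> ?q" "?q \<le> L" by (rule LeastI, rule Least_le)
  have "?q \<noteq> 0" using q t full_gridD[OF g] by (auto intro: ccontr)
  then obtain p where p: "?q = Suc p" using not0_implies_Suc by blast
  then have "\<not> t \<le> \<tau> p" using not_less_Least[of p "\<lambda>q. t \<le> \<tau> q"] by simp
  then show ?thesis using that[of p] p q by auto
qed

text \<open>The left-endpoint step process of \<open>N\<close> on a grid.  It is encoded like a simple integrand although it is
unbounded, so that the isometry for square-integrable weights applies to it directly.\<close>

definition N_step :: "nat \<Rightarrow> (nat \<Rightarrow> real) \<Rightarrow> 'a simple_data" where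
  "N_step L \<tau> = (L, \<tau>, \<lambda>p. N (\<tau> p))"

lemma N_step_value:
  assumes g: "full_grid L \<tau> \<delta>" and t: "0 < t" "t \<le> T"
  obtains r where "0 \<le> r" "r < t" "t - \<delta> \<le> r" "\<And>\<omega>. simple_process (N_step L \<tau>) t \<omega> = N r \<omega>"
proof -
  obtain p where p: "p < L" "\<tau> p < t" "t \<le> \<tau> (Suc p)" by (rule grid_cell[OF g t])
  show ?thesis
  proof (rule that[of "\<tau> p"])
    show "simple_process (N_step L \<tau>) t \<omega> = N (\<tau> p) \<omega>" for \<omega>
      unfolding N_step_def simple_process.simps
      by (rule sum_indicator_grid[OF full_gridD(1)[OF g] p])
    show "0 \<le> \<tau> p" using grid_bounds[OF full_gridD(1)[OF g], of p] p by simp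
    show "t - \<delta> \<le> \<tau> p" using full_gridD(4)[OF g p(1)] p by simp
  qed (rule p)
qed

lemma simple_process_0:
  fixes \<xi> :: "nat \<Rightarrow> 'a \<Rightarrow> real"
  assumes "grid m s"
  shows "simple_process (m, s, \<xi>) 0 \<omega> = 0"
  unfolding simple_process.simps
proof (rule sum.neutral, rule ballI)
  fix i assume "i \<in> {..<m}"
  then show "\<xi> i \<omega> * indicator {s i<..s (Suc i)} 0 = 0"
    using grid_bounds(1)[OF assms, of i] by simp
qed

lemma N_step_0: "grid L \<tau> \<Longrightarrow> simple_process (N_step L \<tau>) 0 \<omega> = 0"
  unfolding N_step_def by (rule simple_process_0)

lemma simple_process_measurable:
  assumes "\<And>i. i < m \<Longrightarrow> \<xi> i \<in> borel_measurable M"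
  shows "(\<lambda>x. simple_process (m, s, \<xi>) (fst x) (snd x)) \<in> borel_measurable process_measure"
  unfolding simple_process.simps
proof (intro borel_measurable_sum borel_measurable_times)
  fix i assume "i \<in> {..<m}"
  then show "(\<lambda>x. \<xi> i (snd x)) \<in> borel_measurable process_measure"
    using assms by (intro measurable_compose[OF measurable_snd]) auto
  show "(\<lambda>x. indicator {s i<..s (Suc i)} (fst x) :: real) \<in> borel_measurable process_measure"
    by (intro measurable_compose[OF measurable_fst] indicator_measurable_time) auto
qed

lemma N_step_measurable:
  assumes "grid L \<tau>"
  shows "(\<lambda>x. simple_process (N_step L \<tau>) (fst x) (snd x)) \<in> borel_measurable process_measure"
  unfolding N_step_def using grid_bounds[OF assms] by (intro simple_process_measurable N_measurable) auto

text \<open>A Lipschitz constant for \<open>N\<close> on \<open>[0, T]\<close> with respect to the squared \<open>L\<^sup>2\<close>-distance.\<close>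

definition N_Lip :: real where "N_Lip = rate + rate\<^sup>2 * T"

lemma N_Lip_pos: "0 < N_Lip"
  using rate_pos T_pos by (auto simp: N_Lip_def intro!: add_pos_pos mult_pos_pos)

lemma expectation_N_diff_square_le:
  assumes "0 \<le> r" "r \<le> T" "0 \<le> r'" "r' \<le> T" "\<bar>r - r'\<bar> \<le> \<delta>"
  shows "(\<integral>\<^sup>+\<omega>. ennreal ((N r \<omega> - N r' \<omega>)\<^sup>2) \<partial>M) \<le> ennreal (N_Lip * \<delta>)"
proof -
  have *: "(\<integral>\<^sup>+\<omega>. ennreal ((N t \<omega> - N s \<omega>)\<^sup>2) \<partial>M) \<le> ennreal (N_Lip * \<delta>)"
    if st: "0 \<le> s" "s < t" "t \<le> T" "t - s \<le> \<delta>" for s t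
  proof -
    have "(\<integral>\<^sup>+\<omega>. ennreal ((N t \<omega> - N s \<omega>)\<^sup>2) \<partial>M) = ennreal (rate * (t - s) + (rate * (t - s))\<^sup>2)"
      using N_incr_second_moment[OF st(1-3)]
      by (subst nn_integral_eq_integral) (auto simp: has_bochner_integral_iff)
    also have "rate * (t - s) + (rate * (t - s))\<^sup>2 = (rate + rate\<^sup>2 * (t - s)) * (t - s)"
      by (simp add: power2_eq_square algebra_simps)
    also have "\<dots> \<le> N_Lip * \<delta>"
      unfolding N_Lip_def using st rate_pos by (intro mult_mono add_mono mult_left_mono) auto
    finally show ?thesis by (simp add: ennreal_leI)
  qed
  consider "r < r'" | "r' < r" | "r = r'" by linarith
  then show ?thesis
    using *[of r r'] *[of r' r] assms by cases (auto simp: power2_commute)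
qed

lemma nn_integral_process_le:
  assumes f[measurable]: "f \<in> borel_measurable process_measure"
    and le: "\<And>t. 0 < t \<Longrightarrow> t \<le> T \<Longrightarrow> (\<integral>\<^sup>+\<omega>. ennreal ((f (t, \<omega>))\<^sup>2) \<partial>M) \<le> ennreal c" and c: "0 \<le> c"
    and f0: "\<And>\<omega>. f (0, \<omega>) = 0"
  shows "(\<integral>\<^sup>+x. ennreal ((f x)\<^sup>2) \<partial>process_measure) \<le> ennreal (T * c)"
proof -
  have "(\<integral>\<^sup>+x. ennreal ((f x)\<^sup>2) \<partial>process_measure)
      = (\<integral>\<^sup>+t. \<integral>\<^sup>+\<omega>. ennreal ((f (t, \<omega>))\<^sup>2) \<partial>M \<partial>time_measure)"
    by (subst nn_integral_fst[symmetric]) auto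
  also have "\<dots> \<le> (\<integral>\<^sup>+t. ennreal c \<partial>time_measure)"
  proof (rule nn_integral_mono)
    fix t assume "t \<in> space time_measure"
    then have "0 \<le> t" "t \<le> T" by (auto simp: space_restrict_space)
    then show "(\<integral>\<^sup>+\<omega>. ennreal ((f (t, \<omega>))\<^sup>2) \<partial>M) \<le> ennreal c"
      using le[of t] f0 by (cases "t = 0") auto
  qed
  also have "\<dots> = ennreal (T * c)"
    using T_pos c by (simp add: nn_integral_const space_restrict_space emeasure_restrict_space
        ennreal_mult[symmetric] mult.commute)
  finally show ?thesis .
qed

lemma N_step_diff:
  assumes g: "full_grid L \<tau> \<delta>" and g': "full_grid L' \<tau>' \<delta>'" and \<delta>: "0 \<le> \<delta>" "0 \<le> \<delta>'"
  shows "(\<integral>\<^sup>+x. ennreal ((simple_process (N_step L \<tau>) (fst x) (snd x)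
      - simple_process (N_step L' \<tau>') (fst x) (snd x))\<^sup>2) \<partial>process_measure)
    \<le> ennreal (T * (N_Lip * (\<delta> + \<delta>')))"
proof (rule nn_integral_process_le)
  show "(\<lambda>x. simple_process (N_step L \<tau>) (fst x) (snd x) - simple_process (N_step L' \<tau>') (fst x) (snd x))
      \<in> borel_measurable process_measure"
    using N_step_measurable[OF full_gridD(1)[OF g]] N_step_measurable[OF full_gridD(1)[OF g']]
    by (rule borel_measurable_diff)
  fix t assume t: "0 < t" "t \<le> T"
  obtain r where r: "0 \<le> r" "r < t" "t - \<delta> \<le> r" "\<And>\<omega>. simple_process (N_step L \<tau>) t \<omega> = N r \<omega>"
    using N_step_value[OF g t] by blast
  obtain r' where r': "0 \<le> r'" "r' < t" "t - \<delta>' \<le> r'" "\<And>\<omega>. simple_process (N_step L' \<tau>') t \<omega> = N r' \<omega>"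
    using N_step_value[OF g' t] by blast
  show "(\<integral>\<^sup>+\<omega>. ennreal ((simple_process (N_step L \<tau>) (fst (t, \<omega>)) (snd (t, \<omega>))
      - simple_process (N_step L' \<tau>') (fst (t, \<omega>)) (snd (t, \<omega>)))\<^sup>2) \<partial>M) \<le> ennreal (N_Lip * (\<delta> + \<delta>'))"
    unfolding fst_conv snd_conv r(4) r'(4)
    using r r' t \<delta> by (intro expectation_N_diff_square_le) auto
qed (use N_Lip_pos \<delta> N_step_0[OF full_gridD(1)[OF g]] N_step_0[OF full_gridD(1)[OF g']] in auto)

definition uniform_grid :: "nat \<Rightarrow> nat \<Rightarrow> real" where
  "uniform_grid m p = real p * T / real (Suc m)"

lemma full_grid_uniform: "full_grid (Suc m) (uniform_grid m) (T / real (Suc m))"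
proof -
  have d: "uniform_grid m (Suc p) = uniform_grid m p + T / real (Suc m)" for p
    by (simp add: uniform_grid_def add_divide_distrib distrib_right)
  have "uniform_grid m (Suc m) = T"
    unfolding uniform_grid_def by (simp del: of_nat_Suc)
  with d show ?thesis
    using T_pos by (auto simp: full_grid_def grid_def uniform_grid_def[of m 0] simp del: of_nat_Suc)
qed

text \<open>The cells of a grid are open on the left, so the step process at time \<open>t\<close> shows \<open>N\<close> at a grid point strictly before
\<open>t\<close>, and refinement leads to the left limit.\<close>

lemma AE_left_limit_tendsto:
  "AE \<omega> in M. \<forall>t\<in>{0..T}. (\<lambda>m. simple_process (N_step (Suc m) (uniform_grid m)) t \<omega>)
    \<longlonglongrightarrow> left_limit_process N t \<omega>"
proof -
  have "AE \<omega> in M. cadlag_on T (\<lambda>t. N t \<omega>)"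
    using poisson by (simp add: poisson_process_def)
  then show ?thesis
  proof eventually_elim
    case (elim \<omega>)
    show ?case
    proof
      fix t assume t: "t \<in> {0..T}"
      show "(\<lambda>m. simple_process (N_step (Suc m) (uniform_grid m)) t \<omega>) \<longlonglongrightarrow> left_limit_process N t \<omega>"
      proof (cases "t = 0")
        case True
        then show ?thesis
          using N_step_0[OF full_gridD(1)[OF full_grid_uniform]]
          by (simp add: left_limit_process_def)
      next
        case False
        with t have t: "0 < t" "t \<le> T" by auto
        have "\<exists>l. ((\<lambda>s. N s \<omega>) \<longlongrightarrow> l) (at_left t)"
          using elim t by (auto simp: cadlag_on_def)
        then obtain l where l: "((\<lambda>s. N s \<omega>) \<longlongrightarrow> l) (at_left t)" by blast
        have "\<exists>r. r < t \<and> t - T / real (Suc m) \<le> r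
          \<and> simple_process (N_step (Suc m) (uniform_grid m)) t \<omega> = N r \<omega>" for m
          using N_step_value[OF full_grid_uniform t] by metis
        then obtain r where r: "\<And>m. r m < t" "\<And>m. t - T / real (Suc m) \<le> r m"
          "\<And>m. simple_process (N_step (Suc m) (uniform_grid m)) t \<omega> = N (r m) \<omega>"
          by metis
        have "r \<longlonglongrightarrow> t"
        proof (rule real_tendsto_sandwich)
          show "(\<lambda>m. t - T / real (Suc m)) \<longlonglongrightarrow> t"
            using tendsto_diff[OF tendsto_const[of t] lim_const_over_n[THEN LIMSEQ_Suc, of T]] by simp
          show "(\<lambda>m. t) \<longlonglongrightarrow> t" by simp
          show "\<forall>\<^sub>F m in sequentially. t - T / real (Suc m) \<le> r m" "\<forall>\<^sub>F m in sequentially. r m \<le> t"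
            using r(1,2) by (auto intro!: always_eventually less_imp_le)
        qed
        then have "filterlim r (at_left t) sequentially"
          using r(1) by (intro filterlim_at_withinI) auto
        then have "(\<lambda>m. N (r m) \<omega>) \<longlonglongrightarrow> l"
          by (rule filterlim_compose[OF l])
        moreover have "left_limit_process N t \<omega> = l"
          using False tendsto_Lim[OF _ l] by (simp add: left_limit_process_def)
        ultimately show ?thesis by (simp only: r(3))
      qed
    qed
  qed
qed

lemma AE_process_measure:
  assumes "AE \<omega> in M. \<forall>t\<in>{0..T}. P t \<omega>"
  shows "AE x in process_measure. P (fst x) (snd x)"
proof -
  obtain Z where Z: "{\<omega>\<in>space M. \<not> (\<forall>t\<in>{0..T}. P t \<omega>)} \<subseteq> Z" "Z \<in> events" "emeasure M Z = 0"
    using assms by (rule AE_E)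
  show ?thesis
  proof (rule AE_I)
    show "{x \<in> space process_measure. \<not> P (fst x) (snd x)} \<subseteq> {0..T} \<times> Z"
      using Z(1) by (fastforce simp: space_pair_measure space_restrict_space)
    have T: "{0..T} \<in> sets time_measure" by (simp add: sets_restrict_space_iff)
    show "{0..T} \<times> Z \<in> sets process_measure" using T Z(2) by (rule pair_measureI)
    show "emeasure process_measure ({0..T} \<times> Z) = 0"
      using emeasure_pair_measure_Times[OF T Z(2)] Z(3) by simp
  qed
qed

lemma left_limit_process_measurable:
  "(\<lambda>(t, \<omega>). left_limit_process N t \<omega>) \<in> borel_measurable (completion process_measure)"
proof (rule borel_measurable_completion_AE)
  let ?G = "\<lambda>m x. simple_process (N_step (Suc m) (uniform_grid m)) (fst x) (snd x)"
  have "\<And>m. ?G m \<in> borel_measurable process_measure"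
    by (rule N_step_measurable[OF full_gridD(1)[OF full_grid_uniform]])
  then show "(\<lambda>x. lim (\<lambda>m. ?G m x)) \<in> borel_measurable process_measure"
    by (intro borel_measurable_lim_metric)
  \<comment> \<open>The pointwise limit of the step processes is measurable and agrees with the left limits almost everywhere.\<close>
  show "AE x in process_measure. lim (\<lambda>m. ?G m x) = (case x of (t, \<omega>) \<Rightarrow> left_limit_process N t \<omega>)"
    using AE_process_measure[OF AE_left_limit_tendsto]
    by eventually_elim (auto dest: limI simp: split_beta)
qed

text \<open>By Fatou's lemma, since the left limits are limits of step processes on uniform grids, whose
distance to the given one is controlled by the Lipschitz constant.\<close>

lemma left_limit_process_approx:
  assumes g: "full_grid L \<tau> \<delta>" and \<delta>: "0 \<le> \<delta>"
  shows "(\<integral>\<^sup>+x. ennreal ((left_limit_process N (fst x) (snd x)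
      - simple_process (N_step L \<tau>) (fst x) (snd x))\<^sup>2) \<partial>process_measure) \<le> ennreal (T * (N_Lip * \<delta>))"
proof -
  let ?G = "\<lambda>m x. simple_process (N_step (Suc m) (uniform_grid m)) (fst x) (snd x)"
  let ?S = "\<lambda>x. simple_process (N_step L \<tau>) (fst x) (snd x)"
  have [measurable]: "?G m \<in> borel_measurable process_measure" for m
    by (rule N_step_measurable[OF full_gridD(1)[OF full_grid_uniform]])
  have [measurable]: "?S \<in> borel_measurable process_measure"
    by (rule N_step_measurable[OF full_gridD(1)[OF g]])
  have "(\<integral>\<^sup>+x. ennreal ((left_limit_process N (fst x) (snd x) - ?S x)\<^sup>2) \<partial>process_measure)
      = (\<integral>\<^sup>+x. liminf (\<lambda>m. ennreal ((?G m x - ?S x)\<^sup>2)) \<partial>process_measure)"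
  proof (rule nn_integral_cong_AE, use AE_process_measure[OF AE_left_limit_tendsto] in eventually_elim)
    case (elim x)
    then have "(\<lambda>m. ennreal ((?G m x - ?S x)\<^sup>2)) \<longlonglongrightarrow> ennreal ((left_limit_process N (fst x) (snd x) - ?S x)\<^sup>2)"
      by (intro tendsto_intros)
    then show ?case by (intro lim_imp_Liminf[symmetric]) auto
  qed
  also have "\<dots> \<le> liminf (\<lambda>m. \<integral>\<^sup>+x. ennreal ((?G m x - ?S x)\<^sup>2) \<partial>process_measure)"
    by (intro nn_integral_liminf) measurable
  also have "\<dots> \<le> liminf (\<lambda>m. ennreal (T * (N_Lip * (T / real (Suc m) + \<delta>))))"
  proof (intro Liminf_mono always_eventually allI)
    show "(\<integral>\<^sup>+x. ennreal ((?G m x - ?S x)\<^sup>2) \<partial>process_measure) \<le> ennreal (T * (N_Lip * (T / real (Suc m) + \<delta>)))" for m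
      by (rule N_step_diff[OF full_grid_uniform g]) (use T_pos \<delta> in auto)
  qed
  also have "\<dots> = ennreal (T * (N_Lip * \<delta>))"
  proof (rule lim_imp_Liminf)
    have "(\<lambda>m. T * (N_Lip * (T / real (Suc m) + \<delta>))) \<longlonglongrightarrow> T * (N_Lip * (0 + \<delta>))"
      by (intro tendsto_intros lim_const_over_n[THEN LIMSEQ_Suc])
    then show "(\<lambda>m. ennreal (T * (N_Lip * (T / real (Suc m) + \<delta>)))) \<longlonglongrightarrow> ennreal (T * (N_Lip * \<delta>))"
      by (intro tendsto_ennrealI) simp
  qed simp
  finally show ?thesis .
qed

lemma N_step_truncation:
  assumes g: "full_grid L \<tau> \<delta>" and \<epsilon>: "0 < \<epsilon>"
  obtains \<xi> where "(L, \<tau>, \<xi>) \<in> simple_integrands M F T"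
    "(\<integral>\<^sup>+x. ennreal ((simple_process (N_step L \<tau>) (fst x) (snd x)
      - simple_process (L, \<tau>, \<xi>) (fst x) (snd x))\<^sup>2) \<partial>process_measure) \<le> ennreal (T * \<epsilon>)"
proof -
  note gr = full_gridD(1)[OF g]
  have "\<exists>c. expectation (\<lambda>\<omega>. (N (\<tau> p) \<omega> - max (- c) (min c (N (\<tau> p) \<omega>)))\<^sup>2) \<le> \<epsilon>" if "p < L" for p
    using bounded_L2_approx[OF N_sq_integrable \<epsilon>] grid_bounds[OF gr] that by (metis less_imp_le)
  then obtain c where c: "\<And>p. p < L \<Longrightarrow> expectation (\<lambda>\<omega>. (N (\<tau> p) \<omega> - max (- c p) (min (c p) (N (\<tau> p) \<omega>)))\<^sup>2) \<le> \<epsilon>"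
    by metis
  define \<xi> where "\<xi> p \<omega> = max (- c p) (min (c p) (N (\<tau> p) \<omega>))" for p \<omega>
  have N_meas: "p < L \<Longrightarrow> N (\<tau> p) \<in> borel_measurable (F (\<tau> p))" for p
    using grid_bounds[OF gr, of p] by (intro N_measurable_F) auto
  have \<xi>_meas: "p < L \<Longrightarrow> \<xi> p \<in> borel_measurable (F (\<tau> p))" for p
    unfolding \<xi>_def[abs_def] using N_meas by (intro borel_measurable_max borel_measurable_min) auto
  have \<xi>_M: "p < L \<Longrightarrow> \<xi> p \<in> borel_measurable M" for p
    using measurable_F_imp_M[OF \<xi>_meas] grid_bounds[OF gr, of p] by auto
  show ?thesis
  proof (rule that)
    have "\<bar>\<xi> p \<omega>\<bar> \<le> \<bar>c p\<bar>" for p \<omega> by (auto simp: \<xi>_def min_def max_def)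
    then show "(L, \<tau>, \<xi>) \<in> simple_integrands M F T"
      using gr \<xi>_meas by (auto simp: simple_integrands_def grid_def)
    show "(\<integral>\<^sup>+x. ennreal ((simple_process (N_step L \<tau>) (fst x) (snd x)
      - simple_process (L, \<tau>, \<xi>) (fst x) (snd x))\<^sup>2) \<partial>process_measure) \<le> ennreal (T * \<epsilon>)"
    proof (rule nn_integral_process_le)
      show "(\<lambda>x. simple_process (N_step L \<tau>) (fst x) (snd x) - simple_process (L, \<tau>, \<xi>) (fst x) (snd x))
          \<in> borel_measurable process_measure"
        by (intro borel_measurable_diff N_step_measurable[OF gr] simple_process_measurable \<xi>_M)
      fix t assume t: "0 < t" "t \<le> T"
      obtain p where p: "p < L" "\<tau> p < t" "t \<le> \<tau> (Suc p)" by (rule grid_cell[OF g t])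
      have \<tau>: "0 \<le> \<tau> p" "\<tau> p \<le> T" using grid_bounds[OF gr, of p] p by auto
      have eq: "simple_process (L, \<tau>, \<zeta>) t \<omega> = \<zeta> p \<omega>" for \<zeta> :: "nat \<Rightarrow> 'a \<Rightarrow> real" and \<omega>
        unfolding simple_process.simps by (rule sum_indicator_grid[OF gr p])
      have bd: "\<bar>N (\<tau> p) \<omega> - \<xi> p \<omega>\<bar> \<le> \<bar>N (\<tau> p) \<omega>\<bar> + \<bar>c p\<bar>" for \<omega>
        by (auto simp: \<xi>_def min_def max_def)
      have "sq_integrable M (\<xi> p)"
        unfolding sq_integrable_def
      proof
        show "integrable M (\<lambda>\<omega>. (\<xi> p \<omega>)\<^sup>2)"
        proof (rule integrable_const_bound[where B="(c p)\<^sup>2"])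
          show "AE \<omega> in M. norm ((\<xi> p \<omega>)\<^sup>2) \<le> (c p)\<^sup>2"
            using \<open>\<And>p \<omega>. \<bar>\<xi> p \<omega>\<bar> \<le> \<bar>c p\<bar>\<close> by (simp add: abs_le_square_iff)
        qed (use \<xi>_M[OF p(1)] in auto)
      qed (rule \<xi>_M[OF p(1)])
      then have "sq_integrable M (\<lambda>\<omega>. N (\<tau> p) \<omega> - \<xi> p \<omega>)"
        using N_sq_integrable[OF \<tau>] by (intro sq_integrable_diff)
      then have "(\<integral>\<^sup>+\<omega>. ennreal ((N (\<tau> p) \<omega> - \<xi> p \<omega>)\<^sup>2) \<partial>M) = ennreal (expectation (\<lambda>\<omega>. (N (\<tau> p) \<omega> - \<xi> p \<omega>)\<^sup>2))"
        by (intro nn_integral_eq_integral) (auto simp: sq_integrable_def)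
      also have "\<dots> \<le> ennreal \<epsilon>"
        using c[OF p(1)] by (intro ennreal_leI) (simp add: \<xi>_def)
      finally show "(\<integral>\<^sup>+\<omega>. ennreal ((simple_process (N_step L \<tau>) (fst (t, \<omega>)) (snd (t, \<omega>))
          - simple_process (L, \<tau>, \<xi>) (fst (t, \<omega>)) (snd (t, \<omega>)))\<^sup>2) \<partial>M) \<le> ennreal \<epsilon>"
        by (simp add: N_step_def eq del: simple_process.simps)
    qed (use \<epsilon> simple_process_0[OF gr] N_step_0[OF gr] in auto)
  qed
qed

lemma simple_integrandsD:
  assumes "(m, s, \<xi>) \<in> simple_integrands M F T"
  shows "grid m s" "\<And>i. i < m \<Longrightarrow> \<xi> i \<in> borel_measurable (F (s i)) \<and> sq_integrable M (\<xi> i)"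
proof -
  show g: "grid m s" using assms by (auto simp: simple_integrands_def grid_def)
  fix i assume i: "i < m"
  then have *: "\<xi> i \<in> borel_measurable (F (s i))" using assms by (auto simp: simple_integrands_def)
  then have m: "\<xi> i \<in> borel_measurable M"
    using measurable_F_imp_M[OF *] grid_bounds[OF g, of i] i by auto
  have "\<exists>C. \<forall>\<omega>\<in>space M. \<bar>\<xi> i \<omega>\<bar> \<le> C"
    using assms i by (auto simp: simple_integrands_def)
  then obtain C where C: "\<And>\<omega>. \<omega> \<in> space M \<Longrightarrow> \<bar>\<xi> i \<omega>\<bar> \<le> C" by blast
  have "integrable M (\<lambda>\<omega>. (\<xi> i \<omega>)\<^sup>2)"
  proof (rule integrable_const_bound[where B="C\<^sup>2"])
    show "AE \<omega> in M. norm ((\<xi> i \<omega>)\<^sup>2) \<le> C\<^sup>2"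
      using C by (auto simp: abs_le_square_iff[symmetric] intro: order_trans[OF _ abs_ge_self])
  qed (use m in auto)
  with m * show "\<xi> i \<in> borel_measurable (F (s i)) \<and> sq_integrable M (\<xi> i)"
    by (simp add: sq_integrable_def)
qed

lemma simple_integral_sq_integrable:
  assumes "grid m s" "\<And>i. i < m \<Longrightarrow> \<xi> i \<in> borel_measurable (F (s i)) \<and> sq_integrable M (\<xi> i)"
  shows "sq_integrable M (simple_integral W (m, s, \<xi>))"
proof -
  have eq: "simple_integral W (m, s, \<xi>) = (\<lambda>\<omega>. \<Sum>i<m. \<xi> i \<omega> * (W (s (Suc i)) \<omega> - W (s i) \<omega>))"
    by (rule ext) simp
  show ?thesis
    unfolding eq using assms(2) grid_bounds[OF assms(1)] grid_less[OF assms(1)]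
    by (intro sq_integrable_sum past_mult_W_incr_sq_integrable) (auto intro: less_imp_le)
qed

lemma N_step_integrand:
  assumes "grid L \<tau>" "i < L"
  shows "N (\<tau> i) \<in> borel_measurable (F (\<tau> i)) \<and> sq_integrable M (N (\<tau> i))"
  using grid_bounds[OF assms(1), of i] assms(2) N_sq_integrable N_measurable_F by auto

end

lemma ennreal_double_add: "0 \<le> x \<Longrightarrow> 0 \<le> y \<Longrightarrow> 2 * ennreal x + 2 * ennreal y = ennreal (2 * x + 2 * y)"
  by (simp add: ennreal_plus ennreal_mult)

context wiener_poisson
begin

lemma left_limit_process_measurable':
  "(\<lambda>x. left_limit_process N (fst x) (snd x)) \<in> borel_measurable (completion process_measure)"
  using left_limit_process_measurable by (simp add: case_prod_beta')

lemma ex_simple_approx: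
  assumes e: "0 < e"
  obtains S where "S \<in> simple_integrands M F T"
    "(\<integral>\<^sup>+x. ennreal ((left_limit_process N (fst x) (snd x) - simple_process S (fst x) (snd x))\<^sup>2) \<partial>process_measure)
      \<le> ennreal e"
proof -
  \<comment> \<open>Half of \<open>e\<close> is spent on the grid, the other half on the truncation; the triangle inequality for squares doubles both.\<close>
  have pos: "0 < 4 * T * N_Lip * T" using T_pos N_Lip_pos by simp
  obtain m where "4 * T * N_Lip * T / e < real m" using reals_Archimedean2 by blast
  then have "4 * T * N_Lip * T / e < real (Suc m)" by simp
  then have "4 * T * N_Lip * T < real (Suc m) * e" using e by (simp only: pos_divide_less_eq)
  then have m: "4 * T * N_Lip * T / real (Suc m) < e"
    by (subst pos_divide_less_eq) (simp_all only: of_nat_0_less_iff zero_less_Suc mult.commute[of e])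
  let ?L = "Suc m" and ?\<tau> = "uniform_grid m"
  obtain \<xi> where \<xi>: "(?L, ?\<tau>, \<xi>) \<in> simple_integrands M F T"
    "(\<integral>\<^sup>+x. ennreal ((simple_process (N_step ?L ?\<tau>) (fst x) (snd x)
      - simple_process (?L, ?\<tau>, \<xi>) (fst x) (snd x))\<^sup>2) \<partial>process_measure) \<le> ennreal (T * (e / (4 * T)))"
    using N_step_truncation[OF full_grid_uniform, of "e / (4 * T)" m] e T_pos by auto
  note D = simple_integrandsD[OF \<xi>(1)]
  have \<xi>_M: "i < ?L \<Longrightarrow> \<xi> i \<in> borel_measurable M" for i using D(2) by (auto simp: sq_integrable_def)
  let ?H = "\<lambda>x. left_limit_process N (fst x) (snd x)"
  have "(\<integral>\<^sup>+x. ennreal ((?H x - simple_process (?L, ?\<tau>, \<xi>) (fst x) (snd x))\<^sup>2) \<partial>completion process_measure)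
    \<le> 2 * (\<integral>\<^sup>+x. ennreal ((?H x - simple_process (N_step ?L ?\<tau>) (fst x) (snd x))\<^sup>2) \<partial>completion process_measure)
    + 2 * (\<integral>\<^sup>+x. ennreal ((simple_process (N_step ?L ?\<tau>) (fst x) (snd x) - simple_process (?L, ?\<tau>, \<xi>) (fst x) (snd x))\<^sup>2)
        \<partial>completion process_measure)"
    by (intro nn_integral_square_triangle left_limit_process_measurable' measurable_completion
        N_step_measurable D(1) simple_process_measurable \<xi>_M)
  also have "\<dots> \<le> 2 * ennreal (T * (N_Lip * (T / real (Suc m)))) + 2 * ennreal (T * (e / (4 * T)))"
    unfolding nn_integral_completion
    by (intro add_mono mult_left_mono left_limit_process_approx[OF full_grid_uniform] \<xi>(2)) (use T_pos in auto)
  also have "\<dots> = ennreal (2 * (T * (N_Lip * (T / real (Suc m)))) + 2 * (T * (e / (4 * T))))"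
    using T_pos N_Lip_pos e by (intro ennreal_double_add) auto
  also have "\<dots> \<le> ennreal e"
    using m T_pos by (intro ennreal_leI) (simp add: field_simps)
  finally show ?thesis
    unfolding nn_integral_completion by (rule that[OF \<xi>(1)])
qed

text \<open>The integrals of approximating simple processes form a Cauchy sequence by the isometry.\<close>

lemma ex_ito_integral: "\<exists>I. has_ito_integral M F T W (left_limit_process N) I"
proof -
  let ?H = "\<lambda>x. left_limit_process N (fst x) (snd x)"
  let ?P = "\<lambda>S x. simple_process S (fst x) (snd x)"
  let ?Q = "\<lambda>k S. S \<in> simple_integrands M F T
      \<and> (\<integral>\<^sup>+x. ennreal ((?H x - ?P S x)\<^sup>2) \<partial>process_measure) \<le> ennreal (1 / real (Suc k))"
  have "\<forall>k. \<exists>S. ?Q k S"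
  proof
    fix k
    have "0 < 1 / real (Suc k)" by simp
    then show "\<exists>S. ?Q k S" by (rule ex_simple_approx) blast
  qed
  then have "\<exists>S. \<forall>k. ?Q k (S k)" by (rule choice)
  then obtain S where "\<forall>k. ?Q k (S k)" ..
  then have S: "\<And>k. S k \<in> simple_integrands M F T"
    and H: "\<And>k. (\<integral>\<^sup>+x. ennreal ((?H x - ?P (S k) x)\<^sup>2) \<partial>process_measure) \<le> ennreal (1 / real (Suc k))"
    by blast+
  have sq: "sq_integrable M (simple_integral W (S k))" for k
  proof -
    obtain m s \<xi> where Sk: "S k = (m, s, \<xi>)" by (cases "S k")
    show ?thesis
      using simple_integral_sq_integrable[OF simple_integrandsD[OF S[of k, unfolded Sk]]] unfolding Sk .
  qed
  have P_meas: "?P (S k) \<in> borel_measurable process_measure" for k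
  proof -
    obtain m s \<xi> where Sk: "S k = (m, s, \<xi>)" by (cases "S k")
    show ?thesis
      using simple_integrandsD(2)[OF S[of k, unfolded Sk]] unfolding Sk
      by (intro simple_process_measurable) (auto simp: sq_integrable_def)
  qed
  have dist: "(\<integral>\<omega>. (simple_integral W (S i) \<omega> - simple_integral W (S j) \<omega>)\<^sup>2 \<partial>M)
      \<le> 2 / real (Suc i) + 2 / real (Suc j)" for i j
  proof -
    have "ennreal (\<integral>\<omega>. (simple_integral W (S i) \<omega> - simple_integral W (S j) \<omega>)\<^sup>2 \<partial>M)
        = (\<integral>\<^sup>+\<omega>. ennreal ((simple_integral W (S i) \<omega> - simple_integral W (S j) \<omega>)\<^sup>2) \<partial>M)"
      using sq_integrable_diff[OF sq sq, of i j]
      by (intro nn_integral_eq_integral[symmetric]) (auto simp: sq_integrable_def)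
    also have "\<dots> = (\<integral>\<^sup>+x. ennreal ((?P (S i) x - ?P (S j) x)\<^sup>2) \<partial>process_measure)"
    proof -
      obtain m s \<xi> where eq1: "S i = (m, s, \<xi>)" by (cases "S i")
      obtain m' s' \<xi>' where eq2: "S j = (m', s', \<xi>')" by (cases "S j")
      note eq = eq1 eq2
      show ?thesis
        unfolding eq using simple_integrandsD[OF S[of i, unfolded eq]] simple_integrandsD[OF S[of j, unfolded eq]]
        by (intro ito_isometry_diff[symmetric]) auto
    qed
    also have "\<dots> = (\<integral>\<^sup>+x. ennreal ((?P (S i) x - ?P (S j) x)\<^sup>2) \<partial>completion process_measure)"
      by (simp only: nn_integral_completion)
    also have "\<dots> \<le> 2 * (\<integral>\<^sup>+x. ennreal ((?P (S i) x - ?H x)\<^sup>2) \<partial>completion process_measure)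
        + 2 * (\<integral>\<^sup>+x. ennreal ((?H x - ?P (S j) x)\<^sup>2) \<partial>completion process_measure)"
      by (intro nn_integral_square_triangle left_limit_process_measurable' measurable_completion P_meas)
    also have "\<dots> \<le> 2 * ennreal (1 / real (Suc i)) + 2 * ennreal (1 / real (Suc j))"
      unfolding nn_integral_completion power2_commute[of "?P (S i) _"]
      by (intro add_mono mult_left_mono H) auto
    also have "\<dots> = ennreal (2 / real (Suc i) + 2 / real (Suc j))"
      by (subst ennreal_double_add) auto
    finally show ?thesis
      by (subst (asm) ennreal_le_iff) auto
  qed
  have Cauchy: "\<exists>n0. \<forall>i\<ge>n0. \<forall>j\<ge>n0. (\<integral>\<omega>. (simple_integral W (S i) \<omega> - simple_integral W (S j) \<omega>)\<^sup>2 \<partial>M) < e"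
    if e: "e > 0" for e :: real
  proof -
    obtain n0 where "inverse (real (Suc n0)) < e / 4" using reals_Archimedean[of "e / 4"] e by auto
    then have n0: "1 / real (Suc n0) < e / 4" by (simp add: inverse_eq_divide)
    have "2 / real (Suc i) < e / 2" if "i \<ge> n0" for i
    proof -
      have "1 / real (Suc i) \<le> 1 / real (Suc n0)" using that by (intro divide_left_mono) auto
      then show ?thesis using n0 by linarith
    qed
    then have "2 / real (Suc i) + 2 / real (Suc j) < e" if "i \<ge> n0" "j \<ge> n0" for i j
    proof -
      have "2 / real (Suc i) + 2 / real (Suc j) < e / 2 + e / 2"
        using that by (intro add_strict_mono \<open>\<And>i. i \<ge> n0 \<Longrightarrow> 2 / real (Suc i) < e / 2\<close>)
      then show ?thesis by simp
    qed
    then show ?thesis using le_less_trans[OF dist] by blast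
  qed
  obtain r I where r: "strict_mono r" and I: "I \<in> borel_measurable M"
    and lim: "(\<lambda>k. \<integral>\<^sup>+\<omega>. ennreal ((I \<omega> - simple_integral W (S (r k)) \<omega>)\<^sup>2) \<partial>M) \<longlonglongrightarrow> 0"
    using L2_Cauchy_imp_convergent_subseq[OF sq Cauchy] by blast
  have "has_ito_integral M F T W (left_limit_process N) I"
    unfolding has_ito_integral_def
  proof (intro conjI exI[of _ "S \<circ> r"] allI)
    show "(\<lambda>k. L2_norm M (\<lambda>\<omega>. I \<omega> - simple_integral W ((S \<circ> r) k) \<omega>)) \<longlonglongrightarrow> 0"
      unfolding L2_norm_tendsto_zero_iff using lim by simp
    show "(\<lambda>k. L2_norm (completion process_measure) (\<lambda>(t, \<omega>). left_limit_process N t \<omega> - simple_process ((S \<circ> r) k) t \<omega>)) \<longlonglongrightarrow> 0"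
      unfolding L2_norm_tendsto_zero_iff nn_integral_completion case_prod_beta'
    proof (rule tendsto_sandwich[where f="\<lambda>_. 0" and h="\<lambda>k. ennreal (1 / real (Suc (r k)))"])
      show "\<forall>\<^sub>F k in sequentially. (\<integral>\<^sup>+x. ennreal ((?H x - ?P ((S \<circ> r) k) x)\<^sup>2) \<partial>process_measure)
          \<le> ennreal (1 / real (Suc (r k)))"
        using H by (simp add: o_def)
      have "(\<lambda>k. 1 / real (Suc k)) \<longlonglongrightarrow> 0"
        using LIMSEQ_inverse_real_of_nat by (simp add: inverse_eq_divide)
      from LIMSEQ_subseq_LIMSEQ[OF this r] have "(\<lambda>k. ennreal (1 / real (Suc (r k)))) \<longlonglongrightarrow> ennreal 0"
        by (intro tendsto_ennrealI) (simp add: o_def)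
      then show "(\<lambda>k. ennreal (1 / real (Suc (r k)))) \<longlonglongrightarrow> 0" by simp
    qed auto
  qed (use S I left_limit_process_measurable in auto)
  then show ?thesis by blast
qed

lemma levy_area_has_ito_integral:
  "has_ito_integral M F T W (left_limit_process N) (levy_area M F T N W)"
  unfolding levy_area_def ito_integral_def using ex_ito_integral by (rule someI_ex)

lemma levy_area_measurable: "levy_area M F T N W \<in> borel_measurable M"
  using levy_area_has_ito_integral by (simp add: has_ito_integral_def)

definition N_sum :: "nat \<Rightarrow> (nat \<Rightarrow> real) \<Rightarrow> 'a \<Rightarrow> real" where
  "N_sum L \<tau> \<omega> = (\<Sum>p<L. N (\<tau> p) \<omega> * (W (\<tau> (Suc p)) \<omega> - W (\<tau> p) \<omega>))"

lemma N_sum_eq: "N_sum L \<tau> = simple_integral W (N_step L \<tau>)"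
  by (rule ext) (simp add: N_sum_def N_step_def)

lemma N_sum_sq_integrable: "grid L \<tau> \<Longrightarrow> sq_integrable M (N_sum L \<tau>)"
  unfolding N_sum_eq N_step_def using N_step_integrand by (intro simple_integral_sq_integrable) auto

text \<open>This holds for every version of the integral, hence for the one chosen in the definition of the Levy
area.  The factor \<open>4\<close> comes from applying \<open>(x + y)\<^sup>2 \<le> 2 * x\<^sup>2 + 2 * y\<^sup>2\<close> twice.\<close>

theorem levy_area_approx:
  assumes g: "full_grid L \<tau> \<delta>" and \<delta>: "0 \<le> \<delta>"
  shows "(\<integral>\<^sup>+\<omega>. ennreal ((levy_area M F T N W \<omega> - N_sum L \<tau> \<omega>)\<^sup>2) \<partial>M) \<le> ennreal (4 * T * N_Lip * \<delta>)"
proof -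
  let ?J = "levy_area M F T N W"
  let ?H = "\<lambda>x. left_limit_process N (fst x) (snd x)"
  let ?P = "\<lambda>S x. simple_process S (fst x) (snd x)"
  note gr = full_gridD(1)[OF g]
  obtain S where S: "\<And>k. S k \<in> simple_integrands M F T"
    and SH: "(\<lambda>k. L2_norm (completion process_measure) (\<lambda>(t, \<omega>). left_limit_process N t \<omega> - simple_process (S k) t \<omega>)) \<longlonglongrightarrow> 0"
    and SJ: "(\<lambda>k. L2_norm M (\<lambda>\<omega>. ?J \<omega> - simple_integral W (S k) \<omega>)) \<longlonglongrightarrow> 0"
    using levy_area_has_ito_integral unfolding has_ito_integral_def by blast
  define \<alpha> where "\<alpha> k = (\<integral>\<^sup>+\<omega>. ennreal ((?J \<omega> - simple_integral W (S k) \<omega>)\<^sup>2) \<partial>M)" for k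
  define \<beta> where "\<beta> k = (\<integral>\<^sup>+x. ennreal ((?H x - ?P (S k) x)\<^sup>2) \<partial>process_measure)" for k
  have \<alpha>: "\<alpha> \<longlonglongrightarrow> 0" using SJ unfolding L2_norm_tendsto_zero_iff \<alpha>_def[abs_def] .
  have \<beta>: "\<beta> \<longlonglongrightarrow> 0"
    using SH unfolding L2_norm_tendsto_zero_iff \<beta>_def[abs_def] nn_integral_completion case_prod_beta' .
  have le: "(\<integral>\<^sup>+\<omega>. ennreal ((?J \<omega> - N_sum L \<tau> \<omega>)\<^sup>2) \<partial>M)
      \<le> 2 * \<alpha> k + 2 * (2 * \<beta> k + 2 * ennreal (T * (N_Lip * \<delta>)))" for k
  proof -
    obtain m s \<xi> where Sk: "S k = (m, s, \<xi>)" by (cases "S k")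
    note D = simple_integrandsD[OF S[of k, unfolded Sk]]
    have P_meas: "?P (S k) \<in> borel_measurable process_measure"
      using D(2) unfolding Sk by (intro simple_process_measurable) (auto simp: sq_integrable_def)
    have I_meas: "simple_integral W (S k) \<in> borel_measurable M"
      using simple_integral_sq_integrable[OF D] unfolding Sk by (auto simp: sq_integrable_def)
    have "(\<integral>\<^sup>+\<omega>. ennreal ((?J \<omega> - N_sum L \<tau> \<omega>)\<^sup>2) \<partial>M)
        \<le> 2 * \<alpha> k + 2 * (\<integral>\<^sup>+\<omega>. ennreal ((simple_integral W (S k) \<omega> - N_sum L \<tau> \<omega>)\<^sup>2) \<partial>M)"
      unfolding \<alpha>_def by (intro nn_integral_square_triangle levy_area_measurable I_meas
          sq_integrable_measurable[OF N_sum_sq_integrable[OF gr]])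
    also have "(\<integral>\<^sup>+\<omega>. ennreal ((simple_integral W (S k) \<omega> - N_sum L \<tau> \<omega>)\<^sup>2) \<partial>M)
        = (\<integral>\<^sup>+x. ennreal ((?P (S k) x - ?P (N_step L \<tau>) x)\<^sup>2) \<partial>process_measure)"
      unfolding Sk N_sum_eq N_step_def
      by (intro ito_isometry_diff[symmetric] D gr N_step_integrand[OF gr])
    also have "\<dots> = (\<integral>\<^sup>+x. ennreal ((?P (S k) x - ?P (N_step L \<tau>) x)\<^sup>2) \<partial>completion process_measure)"
      by (simp only: nn_integral_completion)
    also have "\<dots> \<le> 2 * (\<integral>\<^sup>+x. ennreal ((?P (S k) x - ?H x)\<^sup>2) \<partial>completion process_measure)
        + 2 * (\<integral>\<^sup>+x. ennreal ((?H x - ?P (N_step L \<tau>) x)\<^sup>2) \<partial>completion process_measure)"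
      by (intro nn_integral_square_triangle left_limit_process_measurable' measurable_completion P_meas
          N_step_measurable gr)
    also have "\<dots> \<le> 2 * \<beta> k + 2 * ennreal (T * (N_Lip * \<delta>))"
      unfolding nn_integral_completion power2_commute[of "?P (S k) _"] \<beta>_def
      by (intro add_mono mult_left_mono left_limit_process_approx[OF g \<delta>]) auto
    finally show ?thesis by (simp add: add_left_mono mult_left_mono)
  qed
  have "(\<integral>\<^sup>+\<omega>. ennreal ((?J \<omega> - N_sum L \<tau> \<omega>)\<^sup>2) \<partial>M)
      \<le> 2 * 0 + 2 * (2 * 0 + 2 * ennreal (T * (N_Lip * \<delta>)))"
    by (rule LIMSEQ_le_const[OF tendsto_add[OF ennreal_tendsto_cmult[OF _ \<alpha>]
          ennreal_tendsto_cmult[OF _ tendsto_add[OF ennreal_tendsto_cmult[OF _ \<beta>] tendsto_const]]]])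
      (use le in auto)
  also have "\<dots> = ennreal (4 * T * N_Lip * \<delta>)"
    using T_pos N_Lip_pos \<delta> by (simp add: ennreal_mult'[symmetric] mult.assoc[symmetric] flip: ennreal_numeral)
  finally show ?thesis .
qed

lemma levy_area_sq_integrable: "sq_integrable M (levy_area M F T N W)"
proof -
  let ?J = "levy_area M F T N W"
  \<comment> \<open>A grid with a single cell suffices: \<open>J\<close> is at finite distance from a square-integrable function.\<close>
  have S: "sq_integrable M (N_sum (Suc 0) (uniform_grid 0))"
    by (rule N_sum_sq_integrable[OF full_gridD(1)[OF full_grid_uniform]])
  have "(\<integral>\<^sup>+\<omega>. ennreal ((?J \<omega> - N_sum (Suc 0) (uniform_grid 0) \<omega>)\<^sup>2) \<partial>M) \<le> ennreal (4 * T * N_Lip * (T / real (Suc 0)))"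
    using T_pos by (intro levy_area_approx[OF full_grid_uniform]) auto
  also have "\<dots> < \<infinity>" by simp
  finally have "sq_integrable M (\<lambda>\<omega>. ?J \<omega> - N_sum (Suc 0) (uniform_grid 0) \<omega>)"
    using levy_area_measurable sq_integrable_measurable[OF S]
    by (subst sq_integrable_iff_nn_integral) auto
  from sq_integrable_add[OF this S] show ?thesis by simp
qed

end

section \<open>Reversal of the increments inside the cells of a mesh\<close>

text \<open>The indices of the refined grid are cut into blocks of \<open>K\<close> consecutive ones, one block for each cell of
the mesh; the order is reversed inside each block.\<close>

definition block_reverse :: "nat \<Rightarrow> nat \<Rightarrow> nat" where
  "block_reverse K p = p div K * K + (K - 1 - p mod K)"

text \<open>Twice the difference between \<open>N\<close> at the grid point \<open>p\<close> and the mean of \<open>N\<close> over the two ends of the cell is the sum of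
the increments in the cell that precede \<open>p\<close> minus the sum of the remaining ones.\<close>

definition block_sign :: "nat \<Rightarrow> nat \<Rightarrow> nat \<Rightarrow> real" where
  "block_sign K q p = (if q div K \<noteq> p div K then 0 else if q < p then 1 else - 1)"

context
  fixes K :: nat
  assumes K: "0 < K"
begin

lemma block_reverse_div [simp]: "block_reverse K p div K = p div K"
  using K by (simp add: block_reverse_def)

lemma block_reverse_mod [simp]: "block_reverse K p mod K = K - 1 - p mod K"
  using K by (simp add: block_reverse_def)

lemma block_reverse_involution [simp]: "block_reverse K (block_reverse K p) = p"
proof -
  have "p mod K \<le> K - 1" using K mod_less_divisor[OF K, of p] by linarith
  then have "K - 1 - (K - 1 - p mod K) = p mod K" by simp
  then have "block_reverse K (block_reverse K p) = p div K * K + p mod K"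
    unfolding block_reverse_def[of K "block_reverse K p"] block_reverse_div block_reverse_mod by simp
  then show ?thesis by simp
qed

lemma div_less_iff_less_mult': "p div K < n \<longleftrightarrow> p < n * K"
  using K by (simp add: div_less_iff_less_mult)

lemma block_reverse_less_iff [simp]: "block_reverse K p < n * K \<longleftrightarrow> p < n * K"
  by (simp flip: div_less_iff_less_mult')

lemma block_reverse_bij: "bij_betw (block_reverse K) {..<n * K} {..<n * K}"
  by (rule bij_betw_byWitness[where f'="block_reverse K"]) auto

lemma block_reverse_order:
  assumes "q div K = p div K"
  shows "block_reverse K q < block_reverse K p \<longleftrightarrow> p < q"
proof -
  have "q mod K < K" "p mod K < K" using K by auto
  moreover have "q = p div K * K + q mod K" "p = p div K * K + p mod K"
    using assms by (metis div_mult_mod_eq)+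
  ultimately show ?thesis unfolding block_reverse_def assms by linarith
qed

lemma block_sign_reverse:
  "block_sign K q p + block_sign K (block_reverse K q) (block_reverse K p) = (if q = p then - 2 else 0)"
  by (auto simp: block_sign_def block_reverse_order)

lemma sum_block_reverse: "(\<Sum>p<n * K. f (block_reverse K p)) = (\<Sum>p<n * K. f p)"
  by (rule sum.reindex_bij_betw[OF block_reverse_bij])

lemma sum_block_sign:
  fixes f :: "nat \<Rightarrow> real"
  assumes "p < n * K"
  defines "i \<equiv> p div K"
  shows "(\<Sum>q<n * K. block_sign K q p * (f (Suc q) - f q)) = (f p - f (i * K)) - (f (Suc i * K) - f p)"
proof -
  have ip: "i * K \<le> p" "p < Suc i * K"
    using K by (auto simp: i_def dividend_less_div_times)
  have "Suc i \<le> n" using assms div_less_iff_less_mult'[of p n] by simp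
  then have iL: "Suc i * K \<le> n * K" by (rule mult_le_mono1)
  have mem: "q div K = p div K \<longleftrightarrow> i * K \<le> q \<and> q < Suc i * K" for q
  proof -
    have "q div K = p div K \<longleftrightarrow> i \<le> q div K \<and> q div K < Suc i" by (auto simp: i_def)
    then show ?thesis
      using K by (simp only: less_eq_div_iff_mult_less_eq div_less_iff_less_mult)
  qed
  have "(\<Sum>q<n * K. block_sign K q p * (f (Suc q) - f q))
      = (\<Sum>q<n * K. (if q \<in> {i * K..<p} then f (Suc q) - f q else 0)
          - (if q \<in> {p..<Suc i * K} then f (Suc q) - f q else 0))"
    using ip by (intro sum.cong) (auto simp: block_sign_def mem)
  also have "\<dots> = (\<Sum>q<n * K. if q \<in> {i * K..<p} then f (Suc q) - f q else 0)
          - (\<Sum>q<n * K. if q \<in> {p..<Suc i * K} then f (Suc q) - f q else 0)"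
    by (rule sum_subtractf)
  also have "\<dots> = (\<Sum>q\<in>{..<n * K} \<inter> {i * K..<p}. f (Suc q) - f q)
      - (\<Sum>q\<in>{..<n * K} \<inter> {p..<Suc i * K}. f (Suc q) - f q)"
    unfolding sum.inter_restrict[OF finite_lessThan] ..
  also have "{..<n * K} \<inter> {i * K..<p} = {i * K..<p}" using ip iL by auto
  also have "{..<n * K} \<inter> {p..<Suc i * K} = {p..<Suc i * K}" using iL by auto
  finally show ?thesis using ip by (simp add: sum_Suc_diff')
qed

end

text \<open>The left-endpoint sum on the refined grid minus the trapezoidal sum on the mesh, as a bilinear form in
the increments of \<open>N\<close> and \<open>W\<close>.\<close>

definition cross_sum :: "nat \<Rightarrow> nat \<Rightarrow> (nat \<times> bool \<Rightarrow> real) \<Rightarrow> real" where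
  "cross_sum L K x = (\<Sum>p<L. (1 / 2 * (\<Sum>q<L. block_sign K q p * x (q, False))) * x (p, True))"

text \<open>The discrete quadratic covariation of \<open>N\<close> and \<open>W\<close>.\<close>

definition diagonal_sum :: "nat \<Rightarrow> (nat \<times> bool \<Rightarrow> real) \<Rightarrow> real" where
  "diagonal_sum L x = (\<Sum>p<L. x (p, False) * x (p, True))"

definition reverse_vector :: "nat \<Rightarrow> nat \<Rightarrow> (nat \<times> bool \<Rightarrow> real) \<Rightarrow> nat \<times> bool \<Rightarrow> real" where
  "reverse_vector L K x = (\<lambda>i\<in>{..<L} \<times> UNIV. x (block_reverse K (fst i), snd i))"

text \<open>Exchanging predecessors and successors inside a cell changes the sign of every term of the bilinear
form except those with equal indices, which are counted as successors in both orders.\<close>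

lemma cross_sum_reverse:
  assumes K: "0 < K"
  shows "cross_sum (n * K) K x + cross_sum (n * K) K (reverse_vector (n * K) K x) = - diagonal_sum (n * K) x"
proof -
  let ?r = "block_reverse K" and ?L = "n * K"
  have form: "cross_sum ?L K y = (\<Sum>p<?L. \<Sum>q<?L. block_sign K q p / 2 * y (q, False) * y (p, True))" for y
    unfolding cross_sum_def by (simp add: sum_distrib_left sum_distrib_right mult_ac)
  have "cross_sum ?L K (reverse_vector ?L K x)
      = (\<Sum>p<?L. \<Sum>q<?L. block_sign K q p / 2 * x (?r q, False) * x (?r p, True))"
    unfolding form by (simp add: reverse_vector_def)
  also have "\<dots> = (\<Sum>p<?L. \<Sum>q<?L. block_sign K (?r (?r q)) (?r (?r p)) / 2 * x (?r q, False) * x (?r p, True))"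
    by (simp add: K)
  also have "\<dots> = (\<Sum>p<?L. \<Sum>q<?L. block_sign K (?r q) (?r p) / 2 * x (q, False) * x (p, True))"
    unfolding sum_block_reverse[OF K, of "\<lambda>q. block_sign K (?r q) (?r (?r p)) / 2 * x (q, False) * x (?r p, True)" for p]
    by (rule sum_block_reverse[OF K])
  finally have "cross_sum ?L K x + cross_sum ?L K (reverse_vector ?L K x)
      = (\<Sum>p<?L. \<Sum>q<?L. (block_sign K q p + block_sign K (?r q) (?r p)) / 2 * x (q, False) * x (p, True))"
    unfolding form by (simp add: sum.distrib[symmetric] add_divide_distrib distrib_right)
  also have "\<dots> = (\<Sum>p<?L. \<Sum>q<?L. if q = p then - (x (p, False) * x (p, True)) else 0)"
    unfolding block_sign_reverse[OF K] by (intro sum.cong) auto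
  also have "\<dots> = - diagonal_sum ?L x"
    by (simp add: diagonal_sum_def sum_negf)
  finally show ?thesis .
qed

text \<open>At the right end \<open>p = n * K\<close> the remainder is \<open>0\<close>, so that the value of \<open>t\<close> beyond the mesh does not enter.\<close>

definition refine :: "(nat \<Rightarrow> real) \<Rightarrow> nat \<Rightarrow> nat \<Rightarrow> real" where
  "refine t K p = t (p div K) + real (p mod K) * ((t (Suc (p div K)) - t (p div K)) / real K)"

lemma refine_mult [simp]: "0 < K \<Longrightarrow> refine t K (i * K) = t i"
  by (simp add: refine_def)

lemma refine_Suc:
  assumes K: "0 < K"
  shows "refine t K (Suc p) - refine t K p = (t (Suc (p div K)) - t (p div K)) / real K"
proof (cases "Suc (p mod K) = K")
  case True
  then have "Suc p mod K = 0" "Suc p div K = Suc (p div K)"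
    by (simp_all add: mod_Suc div_Suc)
  moreover have "real (p mod K) = real K - 1" using True by linarith
  moreover have "real K * ((t (Suc (p div K)) - t (p div K)) / real K) = t (Suc (p div K)) - t (p div K)"
    using K by simp
  ultimately show ?thesis
    unfolding refine_def by (simp only: left_diff_distrib)
next
  case False
  then have "Suc p mod K = Suc (p mod K)" "Suc p div K = p div K"
    by (simp_all add: mod_Suc div_Suc)
  then show ?thesis
    unfolding refine_def by (simp add: distrib_right add_divide_distrib)
qed

definition sample_of_increments :: "nat \<Rightarrow> nat \<Rightarrow> (nat \<times> bool \<Rightarrow> real) \<Rightarrow> nat \<Rightarrow> real" where
  "sample_of_increments n K x =
     (\<lambda>i\<in>{1..2 * n}. if i \<le> n then \<Sum>p<i * K. x (p, False) else \<Sum>p<(i - n) * K. x (p, True))"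

lemma sample_of_increments_reverse:
  assumes K: "0 < K"
  shows "sample_of_increments n K (reverse_vector (n * K) K x) = sample_of_increments n K x"
proof -
  have "(\<Sum>p<j * K. reverse_vector (n * K) K x (p, b)) = (\<Sum>p<j * K. x (p, b))" if "j \<le> n" for j b
  proof -
    have "p < n * K" if "p < j * K" for p
      using that mult_le_mono1[OF \<open>j \<le> n\<close>, of K] by (rule less_le_trans)
    then have "(\<Sum>p<j * K. reverse_vector (n * K) K x (p, b)) = (\<Sum>p<j * K. x (block_reverse K p, b))"
      by (intro sum.cong) (auto simp: reverse_vector_def)
    then show ?thesis by (simp add: sum_block_reverse[OF K, of "\<lambda>p. x (p, b)"])
  qed
  then show ?thesis
    by (auto simp: sample_of_increments_def fun_eq_iff restrict_def)
qed

abbreviation increment_space :: "nat \<Rightarrow> (nat \<times> bool \<Rightarrow> real) measure" where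
  "increment_space L \<equiv> Pi\<^sub>M ({..<L} \<times> UNIV) (\<lambda>_. borel)"

abbreviation sample_space :: "nat \<Rightarrow> (nat \<Rightarrow> real) measure" where
  "sample_space n \<equiv> Pi\<^sub>M {1..2 * n} (\<lambda>_. borel)"

lemma coord_measurable: "p < L \<Longrightarrow> (\<lambda>x. x (p, b)) \<in> borel_measurable (increment_space L)"
  by (rule measurable_component_singleton) auto

lemma cross_sum_measurable: "cross_sum L K \<in> borel_measurable (increment_space L)"
  unfolding cross_sum_def[abs_def]
  by (intro borel_measurable_sum borel_measurable_times borel_measurable_const coord_measurable) auto

lemma diagonal_sum_measurable: "diagonal_sum L \<in> borel_measurable (increment_space L)"
  unfolding diagonal_sum_def[abs_def]
  by (intro borel_measurable_sum borel_measurable_times coord_measurable) auto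

lemma reverse_vector_measurable:
  assumes "0 < K"
  shows "reverse_vector (n * K) K \<in> measurable (increment_space (n * K)) (increment_space (n * K))"
  unfolding reverse_vector_def[abs_def]
  by (intro measurable_restrict coord_measurable) (auto simp: assms)

lemma sample_of_increments_measurable:
  "sample_of_increments n K \<in> measurable (increment_space (n * K)) (sample_space n)"
  unfolding sample_of_increments_def[abs_def]
proof (intro measurable_restrict)
  fix i assume i: "i \<in> {1..2 * n}"
  show "(\<lambda>x. if i \<le> n then \<Sum>p<i * K. x (p, False) else \<Sum>p<(i - n) * K. x (p, True))
      \<in> borel_measurable (increment_space (n * K))"
  proof (cases "i \<le> n")
    case True
    then have "p < n * K" if "p < i * K" for p
      using that mult_le_mono1[of i n K] by (auto intro: less_le_trans)
    then have "(\<lambda>x. \<Sum>p<i * K. x (p, False)) \<in> borel_measurable (increment_space (n * K))"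
      by (intro borel_measurable_sum coord_measurable) auto
    with True show ?thesis by simp
  next
    case False
    have "p < n * K" if "p < (i - n) * K" for p
    proof -
      have "i - n \<le> n" using i by auto
      with that show ?thesis using mult_le_mono1[of "i - n" n K] by (blast intro: less_le_trans)
    qed
    then have "(\<lambda>x. \<Sum>p<(i - n) * K. x (p, True)) \<in> borel_measurable (increment_space (n * K))"
      by (intro borel_measurable_sum coord_measurable) auto
    with False show ?thesis by simp
  qed
qed

context wiener_poisson
begin

lemma discretization_grid:
  assumes "t \<in> discretizations T n"
  shows "grid n t"
  using assms by (auto simp: discretizations_def grid_def)

lemma full_grid_refine:
  assumes t: "t \<in> discretizations T n" and K: "0 < K"
  shows "full_grid (n * K) (refine t K) (T / real K)"
proof -
  note g = discretization_grid[OF t]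
  have t0: "t 0 = 0" "t n = T" using t by (auto simp: discretizations_def)
  have less: "p div K < n" if "p < n * K" for p
    using that K by (simp add: less_mult_imp_div_less)
  have "refine t K p < refine t K (Suc p)" if "p < n * K" for p
  proof -
    have "0 < (t (Suc (p div K)) - t (p div K)) / real K"
      using grid_less[OF g, of "p div K" "Suc (p div K)"] less[OF that] K by simp
    then show ?thesis using refine_Suc[OF K, of t p] by linarith
  qed
  moreover have "refine t K (Suc p) - refine t K p \<le> T / real K" if "p < n * K" for p
  proof -
    have "t (Suc (p div K)) \<le> T" "0 \<le> t (p div K)"
      using grid_bounds[OF g, of "p div K"] grid_bounds[OF g, of "Suc (p div K)"] less[OF that] by auto
    then show ?thesis unfolding refine_Suc[OF K] using K by (intro divide_right_mono) auto
  qed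
  moreover have "refine t K 0 = 0" "refine t K (n * K) = T"
    using t0 K refine_mult[OF K, of t 0] by auto
  ultimately show ?thesis by (auto simp: full_grid_def grid_def)
qed

definition trapezoid_sum :: "nat \<Rightarrow> (nat \<Rightarrow> real) \<Rightarrow> 'a \<Rightarrow> real" where
  "trapezoid_sum n t \<omega> = (\<Sum>i<n. 1 / 2 * (W (t (i + 1)) \<omega> - W (t i) \<omega>) * (N (t (i + 1)) \<omega> + N (t i) \<omega>))"

definition increment_vector :: "nat \<Rightarrow> (nat \<Rightarrow> real) \<Rightarrow> 'a \<Rightarrow> nat \<times> bool \<Rightarrow> real" where
  "increment_vector L \<tau> \<omega> = (\<lambda>i\<in>{..<L} \<times> UNIV. increment \<tau> i \<omega>)"

lemma increment_vector_measurable: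
  "grid L \<tau> \<Longrightarrow> increment_vector L \<tau> \<in> measurable M (increment_space L)"
  unfolding increment_vector_def[abs_def] using increment_measurable[of L \<tau>]
  by (intro measurable_restrict) auto

lemma sum_block_sign_increment:
  assumes K: "0 < K" and p: "p < n * K"
  shows "1 / 2 * (\<Sum>q<n * K. block_sign K q p * increment_vector (n * K) (refine t K) \<omega> (q, False))
    = N (refine t K p) \<omega> - (N (t (Suc (p div K))) \<omega> + N (t (p div K)) \<omega>) / 2"
proof -
  have "(\<Sum>q<n * K. block_sign K q p * increment_vector (n * K) (refine t K) \<omega> (q, False))
      = (\<Sum>q<n * K. block_sign K q p * (N (refine t K (Suc q)) \<omega> - N (refine t K q) \<omega>))"
    by (intro sum.cong) (auto simp: increment_vector_def increment_def)
  also have "\<dots> = (N (refine t K p) \<omega> - N (refine t K (p div K * K)) \<omega>)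
      - (N (refine t K (Suc (p div K) * K)) \<omega> - N (refine t K p) \<omega>)"
    by (rule sum_block_sign[OF K p])
  also have "\<dots> = 2 * N (refine t K p) \<omega> - N (t (p div K)) \<omega> - N (t (Suc (p div K))) \<omega>"
    unfolding refine_mult[OF K] by simp
  finally show ?thesis by (simp add: field_simps)
qed

lemma N_sum_minus_trapezoid:
  assumes K: "0 < K"
  shows "N_sum (n * K) (refine t K) \<omega> - trapezoid_sum n t \<omega>
    = cross_sum (n * K) K (increment_vector (n * K) (refine t K) \<omega>)"
proof -
  let ?\<tau> = "refine t K" and ?L = "n * K"
  let ?V = "\<lambda>p. W (?\<tau> (Suc p)) \<omega> - W (?\<tau> p) \<omega>"
  let ?a = "\<lambda>i. (N (t (Suc i)) \<omega> + N (t i) \<omega>) / 2"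
  have "(\<Sum>p<?L. ?a (p div K) * ?V p) = (\<Sum>i<n. \<Sum>p\<in>{i * K..<i * K + K}. ?a (p div K) * ?V p)"
    by (rule sum.nat_group[symmetric])
  also have "\<dots> = (\<Sum>i<n. ?a i * (\<Sum>p\<in>{i * K..<i * K + K}. ?V p))"
  proof (intro sum.cong refl)
    fix i
    have "p div K = i" if "p \<in> {i * K..<i * K + K}" for p
      using that by (intro div_nat_eqI) (auto simp: mult.commute)
    then show "(\<Sum>p\<in>{i * K..<i * K + K}. ?a (p div K) * ?V p) = ?a i * (\<Sum>p\<in>{i * K..<i * K + K}. ?V p)"
      unfolding sum_distrib_left by (intro sum.cong) auto
  qed
  also have "\<dots> = (\<Sum>i<n. ?a i * (W (t (Suc i)) \<omega> - W (t i) \<omega>))"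
  proof (intro sum.cong refl arg_cong2[where f="(*)"])
    fix i
    have "(\<Sum>p\<in>{i * K..<i * K + K}. ?V p) = W (?\<tau> (i * K + K)) \<omega> - W (?\<tau> (i * K)) \<omega>"
      by (rule sum_Suc_diff') simp
    also have "\<dots> = W (t (Suc i)) \<omega> - W (t i) \<omega>"
      using refine_mult[OF K, of t "Suc i"] refine_mult[OF K, of t i] by (simp add: add.commute)
    finally show "(\<Sum>p\<in>{i * K..<i * K + K}. ?V p) = W (t (Suc i)) \<omega> - W (t i) \<omega>" .
  qed
  also have "\<dots> = trapezoid_sum n t \<omega>"
    unfolding trapezoid_sum_def by (intro sum.cong) (auto simp: field_simps)
  finally have trap: "trapezoid_sum n t \<omega> = (\<Sum>p<?L. ?a (p div K) * ?V p)" by simp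
  have "cross_sum ?L K (increment_vector ?L ?\<tau> \<omega>) = (\<Sum>p<?L. (N (?\<tau> p) \<omega> - ?a (p div K)) * ?V p)"
    unfolding cross_sum_def
    by (intro sum.cong refl arg_cong2[where f="(*)"] sum_block_sign_increment[OF K])
      (auto simp: increment_vector_def increment_def)
  then show ?thesis
    unfolding trap N_sum_def by (simp add: sum_subtractf left_diff_distrib)
qed

lemma increment_distr_cong:
  assumes g: "grid L \<tau>" and p: "p < L" "p' < L" and eq: "\<tau> (Suc p) - \<tau> p = \<tau> (Suc p') - \<tau> p'"
  shows "distr M borel (increment \<tau> (p, b)) = distr M borel (increment \<tau> (p', b))"
proof -
  have st: "0 \<le> \<tau> q" "\<tau> q < \<tau> (Suc q)" "\<tau> (Suc q) \<le> T" if "q < L" for q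
    using grid_bounds[OF g, of q] grid_bounds[OF g, of "Suc q"] grid_less[OF g, of q "Suc q"] that by auto
  show ?thesis
  proof (cases b)
    case True
    have "distr M borel (increment \<tau> (q, b)) = density lborel (normal_density 0 (sqrt (\<tau> (Suc q) - \<tau> q)))"
      if "q < L" for q
    proof -
      have "distr M borel (increment \<tau> (q, b)) = distr M lborel (\<lambda>\<omega>. W (\<tau> (Suc q)) \<omega> - W (\<tau> q) \<omega>)"
        using True by (intro distr_cong) (auto simp: increment_def)
      then show ?thesis
        using distributed_distr_eq_density[OF W_incr_distributed[OF st[OF that]]] by simp
    qed
    then show ?thesis using p eq by simp
  next
    case False
    have "increment \<tau> (q, b) = (\<lambda>\<omega>. N (\<tau> (Suc q)) \<omega> - N (\<tau> q) \<omega>)" for q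
      using False by (auto simp: increment_def)
    then show ?thesis using N_incr_distr[OF st[OF p(1)]] N_incr_distr[OF st[OF p(2)]] eq by simp
  qed
qed

text \<open>The increments have a product law whose factors depend only on the length of the grid interval, and this
is the same for all intervals of one cell.\<close>

lemma distr_reverse_increments:
  assumes t: "t \<in> discretizations T n" and n: "0 < n" and K: "0 < K"
  defines "L \<equiv> n * K" and "\<tau> \<equiv> refine t K"
  shows "distr M (increment_space L) (\<lambda>\<omega>. reverse_vector L K (increment_vector L \<tau> \<omega>))
    = distr M (increment_space L) (increment_vector L \<tau>)"
proof -
  let ?I = "{..<L} \<times> (UNIV :: bool set)"
  let ?\<mu> = "\<lambda>i. distr M borel (increment \<tau> i)"
  let ?r = "\<lambda>i :: nat \<times> bool. (block_reverse K (fst i), snd i)"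
  have g: "grid L \<tau>" unfolding L_def \<tau>_def by (rule full_gridD(1)[OF full_grid_refine[OF t K]])
  have L: "0 < L" using n K by (simp add: L_def)
  have rv: "random_variable borel (increment \<tau> i)" if "i \<in> ?I" for i
    using increment_measurable[OF g, of i] that by auto
  have law: "distr M (increment_space L) (increment_vector L \<tau>) = Pi\<^sub>M ?I ?\<mu>"
    using indep_vars_increments[OF g L] rv L unfolding increment_vector_def[abs_def]
    by (subst (asm) indep_vars_iff_distr_eq_PiM') auto
  have \<mu>r: "?\<mu> (?r i) = ?\<mu> i" if "i \<in> ?I" for i
  proof -
    have "increment \<tau> i = increment \<tau> (fst i, snd i)" by simp
    then show ?thesis
      using increment_distr_cong[OF g, of "block_reverse K (fst i)" "fst i" "snd i"] that K
      by (auto simp: L_def \<tau>_def refine_Suc)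
  qed
  have [measurable]: "increment_vector L \<tau> \<in> measurable M (increment_space L)"
    by (rule increment_vector_measurable[OF g])
  have [measurable]: "reverse_vector L K \<in> measurable (increment_space L) (increment_space L)"
    unfolding L_def by (rule reverse_vector_measurable[OF K])
  have "distr M (increment_space L) (\<lambda>\<omega>. reverse_vector L K (increment_vector L \<tau> \<omega>))
      = distr (distr M (increment_space L) (increment_vector L \<tau>)) (increment_space L) (reverse_vector L K)"
    by (subst distr_distr) (auto simp: o_def)
  also have "\<dots> = distr (Pi\<^sub>M ?I ?\<mu>) (\<Pi>\<^sub>M i\<in>?I. ?\<mu> (?r i)) (\<lambda>x. \<lambda>i\<in>?I. x (?r i))"
    unfolding law by (rule distr_cong) (auto simp: reverse_vector_def intro!: sets_PiM_cong)
  also have "\<dots> = (\<Pi>\<^sub>M i\<in>?I. ?\<mu> (?r i))"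
  proof (rule distr_PiM_reindex)
    show "prob_space (?\<mu> i)" if "i \<in> ?I" for i using rv[OF that] by (rule prob_space_distr)
    show "inj_on ?r ?I"
      by (rule inj_on_inverseI[where g="?r"]) (simp add: K)
    show "?r \<in> ?I \<rightarrow> ?I" using K by (auto simp: L_def)
  qed
  also have "\<dots> = Pi\<^sub>M ?I ?\<mu>" by (intro PiM_cong refl \<mu>r)
  finally show ?thesis unfolding law .
qed

lemma sample_vector_eq_AE:
  assumes t: "t \<in> discretizations T n" and K: "0 < K"
  shows "AE \<omega> in M. sample_vector n t N W \<omega>
    = sample_of_increments n K (increment_vector (n * K) (refine t K) \<omega>)"
  using N_0 W_0
proof eventually_elim
  case (elim \<omega>)
  let ?x = "increment_vector (n * K) (refine t K) \<omega>"
  have t0: "t 0 = 0" using t by (auto simp: discretizations_def)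
  have "(\<Sum>p<j * K. ?x (p, b)) = (if b then W (t j) \<omega> else N (t j) \<omega>)" if j: "j \<le> n" for j b
  proof -
    have "p < n * K" if "p < j * K" for p
      using that mult_le_mono1[OF j, of K] by (rule less_le_trans)
    then have "(\<Sum>p<j * K. ?x (p, b)) = (\<Sum>p<j * K. (if b then W (refine t K (Suc p)) \<omega> - W (refine t K p) \<omega>
        else N (refine t K (Suc p)) \<omega> - N (refine t K p) \<omega>))"
      by (intro sum.cong) (auto simp: increment_vector_def increment_def)
    also have "\<dots> = (if b then W (refine t K (j * K)) \<omega> - W (refine t K (0 * K)) \<omega>
        else N (refine t K (j * K)) \<omega> - N (refine t K (0 * K)) \<omega>)"
      using sum_lessThan_telescope[of "\<lambda>p. W (refine t K p) \<omega>" "j * K"]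
        sum_lessThan_telescope[of "\<lambda>p. N (refine t K p) \<omega>" "j * K"] by (cases b) simp_all
    finally show ?thesis unfolding refine_mult[OF K] using elim t0 by simp
  qed
  then show ?case
    by (auto simp: sample_vector_def sample_of_increments_def fun_eq_iff restrict_def)
qed

lemma sample_vector_measurable:
  assumes t: "t \<in> discretizations T n"
  shows "sample_vector n t N W \<in> measurable M (sample_space n)"
  unfolding sample_vector_def[abs_def]
proof (intro measurable_restrict)
  fix i assume i: "i \<in> {1..2 * n}"
  have "0 \<le> t j \<and> t j \<le> T" if "j \<le> n" for j
    using grid_bounds[OF discretization_grid[OF t] that] by simp
  then show "(\<lambda>\<omega>. if i \<le> n then N (t i) \<omega> else W (t (i - n)) \<omega>) \<in> borel_measurable M"
    using i by (cases "i \<le> n") (auto intro!: N_measurable W_measurable)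
qed

text \<open>The reversal changes neither the joint law of the increments nor the samples, so the correlation of
a sample function with the bilinear form equals its correlation with the reversed form; the two
forms add up to minus the diagonal.\<close>

lemma cross_sum_correlation:
  assumes t: "t \<in> discretizations T n" and n: "0 < n" and K: "0 < K"
    and g: "g \<in> borel_measurable (sample_space n)"
    and Y: "sq_integrable M (\<lambda>\<omega>. g (sample_vector n t N W \<omega>))"
  defines "x \<equiv> increment_vector (n * K) (refine t K)"
  assumes C: "sq_integrable M (\<lambda>\<omega>. cross_sum (n * K) K (x \<omega>))"
    and D: "sq_integrable M (\<lambda>\<omega>. diagonal_sum (n * K) (x \<omega>))"
  shows "expectation (\<lambda>\<omega>. cross_sum (n * K) K (x \<omega>) * g (sample_vector n t N W \<omega>))
    = - (1 / 2) * expectation (\<lambda>\<omega>. diagonal_sum (n * K) (x \<omega>) * g (sample_vector n t N W \<omega>))"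
proof -
  let ?L = "n * K"
  let ?f = "\<lambda>y. cross_sum ?L K y * g (sample_of_increments n K y)"
  have gr: "grid ?L (refine t K)" by (rule full_gridD(1)[OF full_grid_refine[OF t K]])
  have [measurable]: "x \<in> measurable M (increment_space ?L)"
    unfolding x_def by (rule increment_vector_measurable[OF gr])
  note [measurable] = cross_sum_measurable diagonal_sum_measurable g sample_of_increments_measurable
    reverse_vector_measurable[OF K] sample_vector_measurable[OF t]
  have f[measurable]: "?f \<in> borel_measurable (increment_space ?L)" by measurable
  have s: "AE \<omega> in M. sample_vector n t N W \<omega> = sample_of_increments n K (x \<omega>)"
    unfolding x_def by (rule sample_vector_eq_AE[OF t K])
  let ?Y = "\<lambda>\<omega>. g (sample_vector n t N W \<omega>)"
  have "expectation (\<lambda>\<omega>. cross_sum ?L K (x \<omega>) * ?Y \<omega>) = expectation (\<lambda>\<omega>. ?f (x \<omega>))"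
    by (rule integral_cong_AE) (use s in \<open>auto elim!: AE_mp\<close>)
  also have "\<dots> = (\<integral>y. ?f y \<partial>distr M (increment_space ?L) x)"
    by (rule integral_distr[symmetric]) measurable
  also have "\<dots> = (\<integral>y. ?f y \<partial>distr M (increment_space ?L) (\<lambda>\<omega>. reverse_vector ?L K (x \<omega>)))"
    unfolding x_def distr_reverse_increments[OF t n K] ..
  also have "\<dots> = expectation (\<lambda>\<omega>. ?f (reverse_vector ?L K (x \<omega>)))"
    by (rule integral_distr) measurable
  also have "\<dots> = expectation (\<lambda>\<omega>. cross_sum ?L K (reverse_vector ?L K (x \<omega>)) * g (sample_of_increments n K (x \<omega>)))"
    unfolding sample_of_increments_reverse[OF K] ..
  also have "\<dots> = expectation (\<lambda>\<omega>. cross_sum ?L K (reverse_vector ?L K (x \<omega>)) * ?Y \<omega>)"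
    by (rule integral_cong_AE) (use s in \<open>auto elim!: AE_mp\<close>)
  also have "\<dots> = expectation (\<lambda>\<omega>. - (diagonal_sum ?L (x \<omega>) * ?Y \<omega>) - cross_sum ?L K (x \<omega>) * ?Y \<omega>)"
  proof -
    have "cross_sum ?L K (reverse_vector ?L K y) = - diagonal_sum ?L y - cross_sum ?L K y" for y
      using cross_sum_reverse[OF K, of n y] by linarith
    then show ?thesis by (simp add: left_diff_distrib)
  qed
  also have "\<dots> = - expectation (\<lambda>\<omega>. diagonal_sum ?L (x \<omega>) * ?Y \<omega>) - expectation (\<lambda>\<omega>. cross_sum ?L K (x \<omega>) * ?Y \<omega>)"
    using sq_integrable_mult[OF C Y] sq_integrable_mult[OF D Y] by simp
  finally show ?thesis by simp
qed

end

section \<open>Second moments of the discrete error\<close>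

context wiener_poisson
begin

lemma expectation_W_incr_mult:
  assumes g: "grid L \<tau>" and p: "p < L" and q: "q < L"
  shows "expectation (\<lambda>\<omega>. (W (\<tau> (Suc p)) \<omega> - W (\<tau> p) \<omega>) * (W (\<tau> (Suc q)) \<omega> - W (\<tau> q) \<omega>))
    = (if p = q then \<tau> (Suc p) - \<tau> p else 0)"
proof -
  have st: "0 \<le> \<tau> j" "\<tau> j < \<tau> (Suc j)" "\<tau> (Suc j) \<le> T" if "j < L" for j
    using grid_bounds[OF g, of j] grid_bounds[OF g, of "Suc j"] grid_less[OF g, of j "Suc j"] that by auto
  have one: "sq_integrable M (\<lambda>_. 1)" by (simp add: sq_integrable_def)
  have "expectation (\<lambda>\<omega>. (1 * (W (\<tau> (Suc p)) \<omega> - W (\<tau> p) \<omega>)) * (1 * (W (\<tau> (Suc q)) \<omega> - W (\<tau> q) \<omega>)))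
    = expectation (\<lambda>\<omega>. 1 * 1) * max 0 (min (\<tau> (Suc p)) (\<tau> (Suc q)) - max (\<tau> p) (\<tau> q))"
    using st[OF p] st[OF q] by (intro expectation_mult_elementary one) auto
  also have "max 0 (min (\<tau> (Suc p)) (\<tau> (Suc q)) - max (\<tau> p) (\<tau> q)) = (if p = q then \<tau> (Suc p) - \<tau> p else 0)"
  proof (cases p q rule: linorder_cases)
    case less
    then have "\<tau> (Suc p) \<le> \<tau> q" using grid_less[OF g, of "Suc p" q] q by (cases "Suc p = q") auto
    then show ?thesis using less by auto
  next
    case greater
    then have "\<tau> (Suc q) \<le> \<tau> p" using grid_less[OF g, of "Suc q" p] p by (cases "Suc q = p") auto
    then show ?thesis using greater by auto
  qed (use st[OF p] in auto)
  finally show ?thesis by (simp add: prob_space)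
qed

text \<open>Weights that are functions of the increments of \<open>N\<close> are independent of the increments of \<open>W\<close>, which are
centred and pairwise uncorrelated; the weights may look into the future.\<close>

lemma
  fixes c :: "nat \<Rightarrow> (nat \<times> bool \<Rightarrow> real) \<Rightarrow> real"
  assumes g: "grid L \<tau>" and L: "0 < L"
    and c: "\<And>p. p < L \<Longrightarrow> c p \<in> borel_measurable (Pi\<^sub>M ({..<L} \<times> {False}) (\<lambda>_. borel))"
    and C: "\<And>p \<omega>. p < L \<Longrightarrow> C p \<omega> = c p (\<lambda>i\<in>{..<L} \<times> {False}. increment \<tau> i \<omega>)"
    and sq: "\<And>p. p < L \<Longrightarrow> sq_integrable M (C p)"
  shows weighted_W_sum_sq_integrable: "sq_integrable M (\<lambda>\<omega>. \<Sum>p<L. C p \<omega> * increment \<tau> (p, True) \<omega>)"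
    and weighted_W_sum_second_moment: "expectation (\<lambda>\<omega>. (\<Sum>p<L. C p \<omega> * increment \<tau> (p, True) \<omega>)\<^sup>2)
      = (\<Sum>p<L. expectation (\<lambda>\<omega>. (C p \<omega>)\<^sup>2) * (\<tau> (Suc p) - \<tau> p))"
proof -
  let ?F = "{..<L} \<times> {False}" and ?T = "{..<L} \<times> {True}"
  let ?V = "\<lambda>p. increment \<tau> (p, True)"
  have V: "?V p = (\<lambda>\<omega>. W (\<tau> (Suc p)) \<omega> - W (\<tau> p) \<omega>)" for p by (auto simp: increment_def)
  have Vsq: "sq_integrable M (?V p)" if "p < L" for p
    unfolding V using grid_bounds[OF g, of p] grid_bounds[OF g, of "Suc p"] grid_less[OF g, of p "Suc p"] that
    by (intro W_incr_sq_integrable) auto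
  have ind: "indep_var (Pi\<^sub>M ?F (\<lambda>_. borel)) (\<lambda>\<omega>. \<lambda>i\<in>?F. increment \<tau> i \<omega>)
      (Pi\<^sub>M ?T (\<lambda>_. borel)) (\<lambda>\<omega>. \<lambda>i\<in>?T. increment \<tau> i \<omega>)"
    by (rule indep_var_restrict[OF indep_vars_increments[OF g L]]) auto
  have pair: "indep_var borel (\<lambda>\<omega>. C p \<omega> * C q \<omega>) borel (\<lambda>\<omega>. ?V p \<omega> * ?V q \<omega>)" if p: "p < L" and q: "q < L" for p q
  proof -
    have 1: "(\<lambda>x. c p x * c q x) \<in> borel_measurable (Pi\<^sub>M ?F (\<lambda>_. borel))"
      using c[OF p] c[OF q] by (rule borel_measurable_times)
    have 2: "(\<lambda>x. x (p, True) * x (q, True) :: real) \<in> borel_measurable (Pi\<^sub>M ?T (\<lambda>_. borel))"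
      by (intro borel_measurable_times measurable_component_singleton) (use p q in auto)
    show ?thesis
      using indep_var_compose[OF ind 1 2] p q by (simp add: o_def C)
  qed
  have CC: "integrable M (\<lambda>\<omega>. C p \<omega> * C q \<omega>)" if "p < L" "q < L" for p q
    using sq that by (intro sq_integrable_mult) auto
  have VV: "integrable M (\<lambda>\<omega>. ?V p \<omega> * ?V q \<omega>)" if "p < L" "q < L" for p q
    using Vsq that by (intro sq_integrable_mult) auto
  have int: "integrable M (\<lambda>\<omega>. (C p \<omega> * ?V p \<omega>) * (C q \<omega> * ?V q \<omega>))" if "p < L" "q < L" for p q
    using indep_var_integrable[OF pair[OF that] CC[OF that] VV[OF that]] by (simp add: mult_ac)
  have eq: "expectation (\<lambda>\<omega>. (C p \<omega> * ?V p \<omega>) * (C q \<omega> * ?V q \<omega>))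
      = (if p = q then expectation (\<lambda>\<omega>. (C p \<omega>)\<^sup>2) * (\<tau> (Suc p) - \<tau> p) else 0)" if "p < L" "q < L" for p q
  proof -
    have "expectation (\<lambda>\<omega>. (C p \<omega> * ?V p \<omega>) * (C q \<omega> * ?V q \<omega>)) = expectation (\<lambda>\<omega>. (C p \<omega> * C q \<omega>) * (?V p \<omega> * ?V q \<omega>))"
      by (simp add: mult_ac)
    also have "\<dots> = expectation (\<lambda>\<omega>. C p \<omega> * C q \<omega>) * expectation (\<lambda>\<omega>. ?V p \<omega> * ?V q \<omega>)"
      by (rule indep_var_lebesgue_integral[OF pair[OF that] CC[OF that] VV[OF that]])
    also have "expectation (\<lambda>\<omega>. ?V p \<omega> * ?V q \<omega>) = (if p = q then \<tau> (Suc p) - \<tau> p else 0)"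
      unfolding V by (rule expectation_W_incr_mult[OF g that])
    finally show ?thesis by (simp add: power2_eq_square)
  qed
  have CV: "sq_integrable M (\<lambda>\<omega>. C p \<omega> * ?V p \<omega>)" if p: "p < L" for p
    using int[OF p p] sq_integrable_measurable[OF sq[OF p]] sq_integrable_measurable[OF Vsq[OF p]]
    by (auto simp: sq_integrable_def power2_eq_square)
  show "sq_integrable M (\<lambda>\<omega>. \<Sum>p<L. C p \<omega> * ?V p \<omega>)"
    using CV by (intro sq_integrable_sum) auto
  have "expectation (\<lambda>\<omega>. (\<Sum>p<L. C p \<omega> * ?V p \<omega>)\<^sup>2)
      = (\<Sum>p<L. \<Sum>q<L. expectation (\<lambda>\<omega>. (C p \<omega> * ?V p \<omega>) * (C q \<omega> * ?V q \<omega>)))"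
    unfolding power2_eq_square sum_product
    by (intro has_bochner_integral_integral_eq has_bochner_integral_sum has_bochner_integral_integrable int) auto
  also have "\<dots> = (\<Sum>p<L. \<Sum>q<L. if q = p then expectation (\<lambda>\<omega>. (C p \<omega>)\<^sup>2) * (\<tau> (Suc p) - \<tau> p) else 0)"
    by (intro sum.cong refl) (auto simp: eq)
  also have "\<dots> = (\<Sum>p<L. expectation (\<lambda>\<omega>. (C p \<omega>)\<^sup>2) * (\<tau> (Suc p) - \<tau> p))"
    by simp
  finally show "expectation (\<lambda>\<omega>. (\<Sum>p<L. C p \<omega> * ?V p \<omega>)\<^sup>2)
      = (\<Sum>p<L. expectation (\<lambda>\<omega>. (C p \<omega>)\<^sup>2) * (\<tau> (Suc p) - \<tau> p))" .
qed

lemma N_second_difference_moment: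
  assumes "0 \<le> a" "a \<le> b" "b < c" "c \<le> T"
  shows "has_bochner_integral M (\<lambda>\<omega>. ((N b \<omega> - N a \<omega>) - (N c \<omega> - N b \<omega>))\<^sup>2)
    (rate * (c - a) + rate\<^sup>2 * ((b - a) - (c - b))\<^sup>2)"
proof (cases "a = b")
  case True
  have "has_bochner_integral M (\<lambda>\<omega>. (N c \<omega> - N b \<omega>)\<^sup>2) (rate * (c - b) + (rate * (c - b))\<^sup>2)"
    by (rule N_incr_second_moment) (use assms in auto)
  then show ?thesis
    using True by (simp add: power_mult_distrib power2_commute[of b c] power2_commute[of "N b _"])
next
  case False
  let ?U = "\<lambda>\<omega>. N b \<omega> - N a \<omega>" and ?U' = "\<lambda>\<omega>. N c \<omega> - N b \<omega>"
  have ab: "0 \<le> a" "a < b" "b \<le> T" and bc: "0 \<le> b" "b < c" "c \<le> T" using assms False by auto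
  have "?U \<in> borel_measurable (F b)"
    using N_measurable_F[of a b] N_measurable_F[of b b] assms by auto
  then have ind: "indep_var borel ?U borel ?U'"
    using indep_var_past_N[OF bc, of ?U borel "\<lambda>x. x" borel] by simp
  note i = N_incr_first_moment[OF ab] N_incr_first_moment[OF bc]
  have "has_bochner_integral M (\<lambda>\<omega>. ?U \<omega> * ?U' \<omega>) (rate * (b - a) * (rate * (c - b)))"
    using indep_var_integrable[OF ind] indep_var_lebesgue_integral[OF ind] i
    by (simp add: has_bochner_integral_iff)
  then have "has_bochner_integral M (\<lambda>\<omega>. (?U \<omega>)\<^sup>2 + (?U' \<omega>)\<^sup>2 - 2 * (?U \<omega> * ?U' \<omega>))
      ((rate * (b - a) + (rate * (b - a))\<^sup>2) + (rate * (c - b) + (rate * (c - b))\<^sup>2)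
        - 2 * (rate * (b - a) * (rate * (c - b))))"
    by (intro has_bochner_integral_diff has_bochner_integral_add has_bochner_integral_mult_right
        N_incr_second_moment ab bc)
  moreover have "(?U \<omega>)\<^sup>2 + (?U' \<omega>)\<^sup>2 - 2 * (?U \<omega> * ?U' \<omega>) = (?U \<omega> - ?U' \<omega>)\<^sup>2" for \<omega>
    by (simp add: power2_eq_square algebra_simps)
  moreover have "(rate * (b - a) + (rate * (b - a))\<^sup>2) + (rate * (c - b) + (rate * (c - b))\<^sup>2)
        - 2 * (rate * (b - a) * (rate * (c - b))) = rate * (c - a) + rate\<^sup>2 * ((b - a) - (c - b))\<^sup>2"
    by (simp add: power2_eq_square algebra_simps)
  ultimately show ?thesis by simp
qed

context
  fixes t :: "nat \<Rightarrow> real" and n K :: nat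
  assumes t: "t \<in> discretizations T n" and n: "0 < n" and K: "0 < K"
begin

lemma refine_grid: "grid (n * K) (refine t K)"
  by (rule full_gridD(1)[OF full_grid_refine[OF t K]])

lemma mesh_cell:
  assumes "i < n"
  shows "0 \<le> t i" "t i < t (Suc i)" "t (Suc i) \<le> T"
  using grid_bounds[OF discretization_grid[OF t], of i] grid_bounds[OF discretization_grid[OF t], of "Suc i"]
    grid_less[OF discretization_grid[OF t], of i "Suc i"] assms by auto

lemma refine_in_cell:
  assumes "p < n * K"
  shows "t (p div K) \<le> refine t K p" "refine t K p < t (Suc (p div K))"
proof -
  let ?i = "p div K"
  have "?i < n" using assms K by (simp add: less_mult_imp_div_less)
  note c = mesh_cell[OF this]
  let ?h = "(t (Suc ?i) - t ?i) / real K"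
  have h: "0 < ?h" using c K by simp
  then have "0 \<le> real (p mod K) * ?h" by (intro mult_nonneg_nonneg) auto
  then show "t ?i \<le> refine t K p" unfolding refine_def by linarith
  have "real (p mod K) * ?h < real K * ?h"
    using h K by (intro mult_strict_right_mono) auto
  also have "real K * ?h = t (Suc ?i) - t ?i" using K by simp
  finally show "refine t K p < t (Suc ?i)" unfolding refine_def by linarith
qed

definition cell_weight :: "nat \<Rightarrow> 'a \<Rightarrow> real" where
  "cell_weight p \<omega> = 1 / 2 * (\<Sum>q<n * K. block_sign K q p * increment (refine t K) (q, False) \<omega>)"

lemma cell_weight_eq:
  assumes p: "p < n * K"
  shows "cell_weight p \<omega> = 1 / 2 * ((N (refine t K p) \<omega> - N (t (p div K)) \<omega>) - (N (t (Suc (p div K))) \<omega> - N (refine t K p) \<omega>))"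
proof -
  have "cell_weight p \<omega> = 1 / 2 * (\<Sum>q<n * K. block_sign K q p * increment_vector (n * K) (refine t K) \<omega> (q, False))"
    unfolding cell_weight_def by (intro arg_cong[where f="(*) (1/2)"] sum.cong) (auto simp: increment_vector_def)
  then show ?thesis
    unfolding sum_block_sign_increment[OF K p] by (simp add: field_simps)
qed

lemma cell_weight_moment:
  assumes p: "p < n * K"
  defines "i \<equiv> p div K"
  shows "sq_integrable M (cell_weight p)"
    and "rate / 4 * (t (Suc i) - t i) \<le> expectation (\<lambda>\<omega>. (cell_weight p \<omega>)\<^sup>2)"
    and "expectation (\<lambda>\<omega>. (cell_weight p \<omega>)\<^sup>2) \<le> rate / 4 * (t (Suc i) - t i) + rate\<^sup>2 / 4 * (t (Suc i) - t i)\<^sup>2"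
proof -
  let ?h = "t (Suc i) - t i" and ?s = "refine t K p"
  have i: "i < n" using p K by (simp add: i_def less_mult_imp_div_less)
  note c = mesh_cell[OF i] and r = refine_in_cell[OF p, folded i_def]
  let ?d = "(?s - t i) - (t (Suc i) - ?s)"
  have hb: "has_bochner_integral M (\<lambda>\<omega>. (1 / 2)\<^sup>2 * ((N ?s \<omega> - N (t i) \<omega>) - (N (t (Suc i)) \<omega> - N ?s \<omega>))\<^sup>2)
      ((1 / 2)\<^sup>2 * (rate * ?h + rate\<^sup>2 * ?d\<^sup>2))"
    using c r by (intro has_bochner_integral_mult_right N_second_difference_moment) auto
  have eq: "(cell_weight p \<omega>)\<^sup>2 = (1 / 2)\<^sup>2 * ((N ?s \<omega> - N (t i) \<omega>) - (N (t (Suc i)) \<omega> - N ?s \<omega>))\<^sup>2" for \<omega>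
    unfolding cell_weight_eq[OF p, folded i_def] power_mult_distrib ..
  have meas: "cell_weight p \<in> borel_measurable M"
    unfolding cell_weight_def[abs_def] using increment_measurable[OF refine_grid]
    by (intro borel_measurable_sum borel_measurable_times borel_measurable_const) auto
  show "sq_integrable M (cell_weight p)"
    unfolding sq_integrable_def eq using meas hb by (simp add: has_bochner_integral_iff)
  have e: "expectation (\<lambda>\<omega>. (cell_weight p \<omega>)\<^sup>2) = rate / 4 * ?h + rate\<^sup>2 / 4 * ?d\<^sup>2"
    unfolding eq has_bochner_integral_integral_eq[OF hb] by (simp add: power2_eq_square field_simps)
  have "0 \<le> rate\<^sup>2 / 4 * ?d\<^sup>2" by simp
  then show "rate / 4 * ?h \<le> expectation (\<lambda>\<omega>. (cell_weight p \<omega>)\<^sup>2)" unfolding e by linarith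
  have "\<bar>?d\<bar> \<le> \<bar>?h\<bar>" using c r by linarith
  then have "?d\<^sup>2 \<le> ?h\<^sup>2" by (simp add: abs_le_square_iff)
  then have "rate\<^sup>2 / 4 * ?d\<^sup>2 \<le> rate\<^sup>2 / 4 * ?h\<^sup>2" by (intro mult_left_mono) auto
  then show "expectation (\<lambda>\<omega>. (cell_weight p \<omega>)\<^sup>2) \<le> rate / 4 * ?h + rate\<^sup>2 / 4 * ?h\<^sup>2"
    unfolding e by linarith
qed

lemma cross_sum_increments:
  "cross_sum (n * K) K (increment_vector (n * K) (refine t K) \<omega>)
    = (\<Sum>p<n * K. cell_weight p \<omega> * increment (refine t K) (p, True) \<omega>)"
  unfolding cross_sum_def cell_weight_def
  by (intro sum.cong refl arg_cong2[where f="(*)"]) (auto simp: increment_vector_def)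

lemma diagonal_sum_increments:
  "diagonal_sum (n * K) (increment_vector (n * K) (refine t K) \<omega>)
    = (\<Sum>p<n * K. increment (refine t K) (p, False) \<omega> * increment (refine t K) (p, True) \<omega>)"
  unfolding diagonal_sum_def by (intro sum.cong) (auto simp: increment_vector_def)

lemma sum_cells: "(\<Sum>p<n * K. f (p div K)) = real K * (\<Sum>i<n. f i)"
proof -
  have "(\<Sum>p<n * K. f (p div K)) = (\<Sum>i<n. \<Sum>p\<in>{i * K..<i * K + K}. f (p div K))"
    by (rule sum.nat_group[symmetric])
  also have "\<dots> = (\<Sum>i<n. \<Sum>p\<in>{i * K..<i * K + K}. f i)"
  proof (intro sum.cong refl)
    fix i p assume "p \<in> {i * K..<i * K + K}"
    then have "p div K = i" by (intro div_nat_eqI) (auto simp: mult.commute)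
    then show "f (p div K) = f i" by simp
  qed
  finally show ?thesis by (simp add: sum_distrib_left)
qed

text \<open>Each weight has second moment \<open>rate / 4 * h + rate\<^sup>2 / 4 * d\<^sup>2\<close>, where \<open>h\<close> is the length of its cell and \<open>d\<close>, between
\<open>- h\<close> and \<open>h\<close>, is the difference of the distances from the grid point to the two ends of the cell.\<close>

lemma cross_sum_moments:
  defines "Q \<equiv> \<lambda>\<omega>. cross_sum (n * K) K (increment_vector (n * K) (refine t K) \<omega>)"
  shows "sq_integrable M Q"
    and "rate / 4 * (\<Sum>i<n. (t (Suc i) - t i)\<^sup>2) \<le> expectation (\<lambda>\<omega>. (Q \<omega>)\<^sup>2)"
    and "expectation (\<lambda>\<omega>. (Q \<omega>)\<^sup>2)
      \<le> rate / 4 * (\<Sum>i<n. (t (Suc i) - t i)\<^sup>2) + rate\<^sup>2 / 4 * (\<Sum>i<n. (t (Suc i) - t i) ^ 3)"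
proof -
  let ?c = "\<lambda>p x. 1 / 2 * (\<Sum>q<n * K. block_sign K q p * x (q, False))"
  have L: "0 < n * K" using n K by simp
  have c: "?c p \<in> borel_measurable (Pi\<^sub>M ({..<n * K} \<times> {False}) (\<lambda>_. borel))" if "p < n * K" for p
    by (intro borel_measurable_sum borel_measurable_times borel_measurable_const measurable_component_singleton) auto
  have C: "cell_weight p \<omega> = ?c p (\<lambda>i\<in>{..<n * K} \<times> {False}. increment (refine t K) i \<omega>)" for p \<omega>
    unfolding cell_weight_def by (intro arg_cong[where f="(*) (1/2)"] sum.cong) auto
  note hyps = refine_grid L c C cell_weight_moment(1)
  show "sq_integrable M Q"
    unfolding Q_def cross_sum_increments by (rule weighted_W_sum_sq_integrable[OF hyps])
  have E: "expectation (\<lambda>\<omega>. (Q \<omega>)\<^sup>2)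
      = (\<Sum>p<n * K. expectation (\<lambda>\<omega>. (cell_weight p \<omega>)\<^sup>2) * ((t (Suc (p div K)) - t (p div K)) / real K))"
    unfolding Q_def cross_sum_increments refine_Suc[OF K, symmetric]
    by (rule weighted_W_sum_second_moment[OF hyps])
  let ?h = "\<lambda>i. t (Suc i) - t i"
  have h0: "0 \<le> ?h (p div K) / real K" if "p < n * K" for p
    using mesh_cell[of "p div K"] that K by (simp add: less_mult_imp_div_less)
  have "rate / 4 * (\<Sum>i<n. (?h i)\<^sup>2) = real K * (\<Sum>i<n. rate / 4 * ?h i * (?h i / real K))"
    using K by (simp add: sum_distrib_left power2_eq_square mult_ac)
  also have "\<dots> = (\<Sum>p<n * K. rate / 4 * ?h (p div K) * (?h (p div K) / real K))"
    by (rule sum_cells[symmetric])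
  also have "\<dots> \<le> expectation (\<lambda>\<omega>. (Q \<omega>)\<^sup>2)"
    unfolding E by (intro sum_mono mult_right_mono cell_weight_moment h0) auto
  finally show "rate / 4 * (\<Sum>i<n. (?h i)\<^sup>2) \<le> expectation (\<lambda>\<omega>. (Q \<omega>)\<^sup>2)" .
  have "expectation (\<lambda>\<omega>. (Q \<omega>)\<^sup>2)
      \<le> (\<Sum>p<n * K. (rate / 4 * ?h (p div K) + rate\<^sup>2 / 4 * (?h (p div K))\<^sup>2) * (?h (p div K) / real K))"
    unfolding E by (intro sum_mono mult_right_mono cell_weight_moment h0) auto
  also have "\<dots> = real K * (\<Sum>i<n. (rate / 4 * ?h i + rate\<^sup>2 / 4 * (?h i)\<^sup>2) * (?h i / real K))"
    by (rule sum_cells)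
  also have "\<dots> = (\<Sum>i<n. rate / 4 * (?h i)\<^sup>2 + rate\<^sup>2 / 4 * (?h i) ^ 3)"
    unfolding sum_distrib_left using K
    by (intro sum.cong) (auto simp: power2_eq_square power3_eq_cube field_simps)
  also have "\<dots> = rate / 4 * (\<Sum>i<n. (?h i)\<^sup>2) + rate\<^sup>2 / 4 * (\<Sum>i<n. (?h i) ^ 3)"
    by (simp add: sum.distrib sum_distrib_left)
  finally show "expectation (\<lambda>\<omega>. (Q \<omega>)\<^sup>2) \<le> \<dots>" .
qed

text \<open>A product of two increments over an interval of length \<open>\<delta>\<close> has second moment of order \<open>\<delta>\<^sup>2\<close>, so the sum over
the grid is of the order of the mesh size.\<close>

lemma diagonal_sum_moments:
  defines "D \<equiv> \<lambda>\<omega>. diagonal_sum (n * K) (increment_vector (n * K) (refine t K) \<omega>)"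
  shows "sq_integrable M D" and "expectation (\<lambda>\<omega>. (D \<omega>)\<^sup>2) \<le> N_Lip * T\<^sup>2 / real K"
proof -
  let ?\<tau> = "refine t K"
  let ?X = "\<lambda>p. increment ?\<tau> (p, False)"
  note fg = full_grid_refine[OF t K]
  have L: "0 < n * K" using n K by simp
  have st: "0 \<le> ?\<tau> p" "?\<tau> p < ?\<tau> (Suc p)" "?\<tau> (Suc p) \<le> T" if "p < n * K" for p
    using grid_bounds[OF refine_grid, of p] grid_bounds[OF refine_grid, of "Suc p"]
      grid_less[OF refine_grid, of p "Suc p"] that by auto
  have X: "?X p = (\<lambda>\<omega>. N (?\<tau> (Suc p)) \<omega> - N (?\<tau> p) \<omega>)" for p by (auto simp: increment_def)
  have Xsq: "sq_integrable M (?X p)" if "p < n * K" for p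
    unfolding X by (rule N_incr_sq_integrable[OF st[OF that]])
  have c: "(\<lambda>x. x (p, False)) \<in> borel_measurable (Pi\<^sub>M ({..<n * K} \<times> {False}) (\<lambda>_. borel))" if "p < n * K" for p
    using that by (intro measurable_component_singleton) auto
  have C: "?X p \<omega> = (\<lambda>x. x (p, False)) (\<lambda>i\<in>{..<n * K} \<times> {False}. increment ?\<tau> i \<omega>)" if "p < n * K" for p \<omega>
    using that by simp
  note hyps = refine_grid L c C Xsq
  show "sq_integrable M D"
    unfolding D_def diagonal_sum_increments by (rule weighted_W_sum_sq_integrable[OF hyps])
  have "expectation (\<lambda>\<omega>. (D \<omega>)\<^sup>2) = (\<Sum>p<n * K. expectation (\<lambda>\<omega>. (?X p \<omega>)\<^sup>2) * (?\<tau> (Suc p) - ?\<tau> p))"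
    unfolding D_def diagonal_sum_increments by (rule weighted_W_sum_second_moment[OF hyps])
  also have "\<dots> \<le> (\<Sum>p<n * K. N_Lip * (T / real K) * (?\<tau> (Suc p) - ?\<tau> p))"
  proof (intro sum_mono mult_right_mono)
    fix p assume "p \<in> {..<n * K}"
    then have p: "p < n * K" by simp
    show "0 \<le> ?\<tau> (Suc p) - ?\<tau> p" using st[OF p] by simp
    have "ennreal (expectation (\<lambda>\<omega>. (?X p \<omega>)\<^sup>2)) = (\<integral>\<^sup>+\<omega>. ennreal ((?X p \<omega>)\<^sup>2) \<partial>M)"
      using sq_integrable_integrable[OF Xsq[OF p]] by (intro nn_integral_eq_integral[symmetric]) auto
    also have "\<dots> \<le> ennreal (N_Lip * (T / real K))"
      unfolding X using st[OF p] full_gridD(4)[OF fg p]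
      by (intro expectation_N_diff_square_le) auto
    finally show "expectation (\<lambda>\<omega>. (?X p \<omega>)\<^sup>2) \<le> N_Lip * (T / real K)"
      using N_Lip_pos T_pos by (subst (asm) ennreal_le_iff) auto
  qed
  also have "\<dots> = N_Lip * (T / real K) * (?\<tau> (n * K) - ?\<tau> 0)"
    unfolding sum_distrib_left[symmetric] using sum_lessThan_telescope[of ?\<tau> "n * K"] by simp
  also have "\<dots> = N_Lip * T\<^sup>2 / real K"
    using full_gridD(2,3)[OF fg] by (simp add: power2_eq_square)
  finally show "expectation (\<lambda>\<omega>. (D \<omega>)\<^sup>2) \<le> N_Lip * T\<^sup>2 / real K" .
qed

end

end

section \<open>The error on an arbitrary mesh\<close>

context wiener_poisson
begin

context
  fixes t :: "nat \<Rightarrow> real" and n :: nat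
  assumes t: "t \<in> discretizations T n" and n: "0 < n"
begin

definition trapezoid_error :: "'a \<Rightarrow> real" where
  "trapezoid_error \<omega> = levy_area M F T N W \<omega> - trapezoid_sum n t \<omega>"

definition discrete_error :: "nat \<Rightarrow> 'a \<Rightarrow> real" where
  "discrete_error k \<omega> = cross_sum (n * Suc k) (Suc k) (increment_vector (n * Suc k) (refine t (Suc k)) \<omega>)"

lemma N_sum_eq_discrete_error:
  "N_sum (n * Suc k) (refine t (Suc k)) \<omega> = trapezoid_sum n t \<omega> + discrete_error k \<omega>"
  using N_sum_minus_trapezoid[of "Suc k" n t \<omega>] by (simp add: discrete_error_def)

lemma discrete_error_sq_integrable: "sq_integrable M (discrete_error k)"
  using cross_sum_moments(1)[OF t n, of "Suc k"] by (simp add: discrete_error_def[abs_def])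

lemma trapezoid_sum_sq_integrable: "sq_integrable M (trapezoid_sum n t)"
proof -
  have "sq_integrable M (\<lambda>\<omega>. N_sum (n * Suc 0) (refine t (Suc 0)) \<omega> - discrete_error 0 \<omega>)"
    by (intro sq_integrable_diff discrete_error_sq_integrable N_sum_sq_integrable
        full_gridD(1)[OF full_grid_refine[OF t]]) simp
  then show ?thesis unfolding N_sum_eq_discrete_error by simp
qed

lemma trapezoid_error_sq_integrable: "sq_integrable M trapezoid_error"
  unfolding trapezoid_error_def[abs_def]
  by (rule sq_integrable_diff[OF levy_area_sq_integrable trapezoid_sum_sq_integrable])

lemma discrete_error_tendsto:
  "(\<lambda>k. \<integral>\<omega>. (discrete_error k \<omega> - trapezoid_error \<omega>)\<^sup>2 \<partial>M) \<longlonglongrightarrow> 0"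
proof (rule real_tendsto_sandwich[of "\<lambda>_. 0"])
  show "\<forall>\<^sub>F k in sequentially. (\<integral>\<omega>. (discrete_error k \<omega> - trapezoid_error \<omega>)\<^sup>2 \<partial>M)
      \<le> 4 * T * N_Lip * T / real (Suc k)"
  proof (intro always_eventually allI)
    fix k
    have "sq_integrable M (\<lambda>\<omega>. discrete_error k \<omega> - trapezoid_error \<omega>)"
      by (rule sq_integrable_diff[OF discrete_error_sq_integrable trapezoid_error_sq_integrable])
    then have "ennreal (\<integral>\<omega>. (discrete_error k \<omega> - trapezoid_error \<omega>)\<^sup>2 \<partial>M)
        = (\<integral>\<^sup>+\<omega>. ennreal ((discrete_error k \<omega> - trapezoid_error \<omega>)\<^sup>2) \<partial>M)"
      by (intro nn_integral_eq_integral[symmetric]) (auto simp: sq_integrable_def)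
    also have "\<dots> = (\<integral>\<^sup>+\<omega>. ennreal ((levy_area M F T N W \<omega> - N_sum (n * Suc k) (refine t (Suc k)) \<omega>)\<^sup>2) \<partial>M)"
      unfolding N_sum_eq_discrete_error trapezoid_error_def
      by (intro nn_integral_cong arg_cong[where f=ennreal]) (simp add: power2_eq_square algebra_simps)
    also have "\<dots> \<le> ennreal (4 * T * N_Lip * (T / real (Suc k)))"
      using T_pos by (intro levy_area_approx[OF full_grid_refine[OF t]]) auto
    finally show "(\<integral>\<omega>. (discrete_error k \<omega> - trapezoid_error \<omega>)\<^sup>2 \<partial>M) \<le> 4 * T * N_Lip * T / real (Suc k)"
      using T_pos N_Lip_pos by (subst (asm) ennreal_le_iff) auto
  qed
  show "(\<lambda>k. 4 * T * N_Lip * T / real (Suc k)) \<longlonglongrightarrow> 0"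
    by (rule lim_const_over_n[THEN LIMSEQ_Suc])
qed auto

lemma trapezoid_error_bounds:
  shows "rate / 4 * (\<Sum>i<n. (t (Suc i) - t i)\<^sup>2) \<le> expectation (\<lambda>\<omega>. (trapezoid_error \<omega>)\<^sup>2)"
    and "expectation (\<lambda>\<omega>. (trapezoid_error \<omega>)\<^sup>2)
      \<le> rate / 4 * (\<Sum>i<n. (t (Suc i) - t i)\<^sup>2) + rate\<^sup>2 / 4 * (\<Sum>i<n. (t (Suc i) - t i) ^ 3)"
proof -
  have lim: "(\<lambda>k. expectation (\<lambda>\<omega>. (discrete_error k \<omega>)\<^sup>2)) \<longlonglongrightarrow> expectation (\<lambda>\<omega>. (trapezoid_error \<omega>)\<^sup>2)"
    by (rule L2_tendsto_second_moment[OF discrete_error_sq_integrable trapezoid_error_sq_integrable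
          discrete_error_tendsto])
  show "rate / 4 * (\<Sum>i<n. (t (Suc i) - t i)\<^sup>2) \<le> expectation (\<lambda>\<omega>. (trapezoid_error \<omega>)\<^sup>2)"
    using cross_sum_moments(2)[OF t n zero_less_Suc]
    by (intro LIMSEQ_le_const[OF lim] exI[of _ 0] allI impI) (simp only: discrete_error_def)
  show "expectation (\<lambda>\<omega>. (trapezoid_error \<omega>)\<^sup>2)
      \<le> rate / 4 * (\<Sum>i<n. (t (Suc i) - t i)\<^sup>2) + rate\<^sup>2 / 4 * (\<Sum>i<n. (t (Suc i) - t i) ^ 3)"
    using cross_sum_moments(3)[OF t n zero_less_Suc]
    by (intro LIMSEQ_le_const2[OF lim] exI[of _ 0] allI impI) (simp only: discrete_error_def)
qed

text \<open>For the approximating left-endpoint sums the correlation is bounded, by the Cauchy-Schwarz inequality,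
in terms of the diagonal sum, which vanishes in the limit.\<close>

lemma trapezoid_error_orthogonal:
  assumes g: "g \<in> borel_measurable (sample_space n)"
    and Y: "sq_integrable M (\<lambda>\<omega>. g (sample_vector n t N W \<omega>))"
  shows "expectation (\<lambda>\<omega>. trapezoid_error \<omega> * g (sample_vector n t N W \<omega>)) = 0"
proof (rule LIMSEQ_unique)
  let ?Y = "\<lambda>\<omega>. g (sample_vector n t N W \<omega>)"
  let ?D = "\<lambda>k \<omega>. diagonal_sum (n * Suc k) (increment_vector (n * Suc k) (refine t (Suc k)) \<omega>)"
  show "(\<lambda>k. expectation (\<lambda>\<omega>. discrete_error k \<omega> * ?Y \<omega>)) \<longlonglongrightarrow> expectation (\<lambda>\<omega>. trapezoid_error \<omega> * ?Y \<omega>)"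
    by (rule L2_tendsto_integral_mult[OF discrete_error_sq_integrable trapezoid_error_sq_integrable
          discrete_error_tendsto Y])
  show "(\<lambda>k. expectation (\<lambda>\<omega>. discrete_error k \<omega> * ?Y \<omega>)) \<longlonglongrightarrow> 0"
  proof (rule Lim_null_comparison)
    let ?b = "\<lambda>k. 1 / 2 * (sqrt (N_Lip * T\<^sup>2 / real (Suc k)) * sqrt (expectation (\<lambda>\<omega>. (?Y \<omega>)\<^sup>2)))"
    show "\<forall>\<^sub>F k in sequentially. norm (expectation (\<lambda>\<omega>. discrete_error k \<omega> * ?Y \<omega>)) \<le> ?b k"
    proof (intro always_eventually allI)
      fix k
      have D: "sq_integrable M (?D k)" and D2: "expectation (\<lambda>\<omega>. (?D k \<omega>)\<^sup>2) \<le> N_Lip * T\<^sup>2 / real (Suc k)"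
        using diagonal_sum_moments[OF t n, of "Suc k"] by auto
      have "expectation (\<lambda>\<omega>. discrete_error k \<omega> * ?Y \<omega>) = - (1 / 2) * expectation (\<lambda>\<omega>. ?D k \<omega> * ?Y \<omega>)"
        unfolding discrete_error_def
        using cross_sum_correlation[OF t n _ g Y cross_sum_moments(1)[OF t n] D] by simp
      moreover have "\<bar>expectation (\<lambda>\<omega>. ?D k \<omega> * ?Y \<omega>)\<bar>
          \<le> sqrt (expectation (\<lambda>\<omega>. (?D k \<omega>)\<^sup>2)) * sqrt (expectation (\<lambda>\<omega>. (?Y \<omega>)\<^sup>2))"
        by (rule Cauchy_Schwarz_integral[OF D Y])
      moreover have "\<dots> \<le> sqrt (N_Lip * T\<^sup>2 / real (Suc k)) * sqrt (expectation (\<lambda>\<omega>. (?Y \<omega>)\<^sup>2))"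
        using D2 by (intro mult_right_mono real_sqrt_le_mono) auto
      ultimately show "norm (expectation (\<lambda>\<omega>. discrete_error k \<omega> * ?Y \<omega>)) \<le> ?b k"
        by (simp add: abs_mult)
    qed
    have "(\<lambda>k. sqrt (N_Lip * T\<^sup>2 / real (Suc k))) \<longlonglongrightarrow> sqrt 0"
      by (intro tendsto_real_sqrt lim_const_over_n[THEN LIMSEQ_Suc])
    then show "?b \<longlonglongrightarrow> 0"
      by (intro tendsto_mult_right_zero tendsto_mult_left_zero) simp
  qed
qed

text \<open>The coordinates \<open>1, \<dots>, n\<close> carry the samples of \<open>N\<close> and \<open>n + 1, \<dots>, 2 * n\<close> those of \<open>W\<close>; both processes start
at \<open>0\<close>, which replaces the missing sample at time \<open>0\<close>.\<close>

definition trapezoid_function :: "(nat \<Rightarrow> real) \<Rightarrow> real" where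
  "trapezoid_function v = (\<Sum>i<n. 1 / 2 * (v (n + Suc i) - (if i = 0 then 0 else v (n + i)))
      * (v (Suc i) + (if i = 0 then 0 else v i)))"

lemma trapezoid_function_measurable: "trapezoid_function \<in> borel_measurable (sample_space n)"
  unfolding trapezoid_function_def[abs_def]
proof (intro borel_measurable_sum)
  fix i assume i: "i \<in> {..<n}"
  show "(\<lambda>v. 1 / 2 * (v (n + Suc i) - (if i = 0 then 0 else v (n + i))) * (v (Suc i) + (if i = 0 then 0 else v i)))
      \<in> borel_measurable (sample_space n)"
  proof (cases "i = 0")
    case True
    with i show ?thesis
      by (simp only: if_True, intro borel_measurable_times borel_measurable_add borel_measurable_diff
          borel_measurable_const measurable_component_singleton) auto
  next
    case False
    with i show ?thesis
      by (simp only: if_False, intro borel_measurable_times borel_measurable_add borel_measurable_diff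
          borel_measurable_const measurable_component_singleton) auto
  qed
qed

lemma trapezoid_method: "(t, trapezoid_function) \<in> methods T n"
  using t trapezoid_function_measurable by (simp add: methods_def)

lemma trapezoid_sum_eq_method_value:
  "AE \<omega> in M. trapezoid_sum n t \<omega> = trapezoid_function (sample_vector n t N W \<omega>)"
  using N_0 W_0
proof eventually_elim
  case (elim \<omega>)
  have t0: "t 0 = 0" using t by (auto simp: discretizations_def)
  show ?case
    unfolding trapezoid_sum_def trapezoid_function_def
    by (intro sum.cong) (use elim t0 in \<open>auto simp: sample_vector_def\<close>)
qed

text \<open>Pythagoras: a competing method differs from the trapezoidal sum by a function of the samples, which is
orthogonal to the error.\<close>

theorem method_error_ge:
  assumes \<phi>: "\<phi> \<in> borel_measurable (sample_space n)"
  shows "ennreal (sqrt (expectation (\<lambda>\<omega>. (trapezoid_error \<omega>)\<^sup>2)))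
    \<le> L2_norm M (\<lambda>\<omega>. levy_area M F T N W \<omega> - \<phi> (sample_vector n t N W \<omega>))"
proof -
  let ?Z = "\<lambda>\<omega>. levy_area M F T N W \<omega> - \<phi> (sample_vector n t N W \<omega>)"
  let ?g = "\<lambda>v. trapezoid_function v - \<phi> v"
  let ?Y = "\<lambda>\<omega>. ?g (sample_vector n t N W \<omega>)"
  note [measurable] = \<phi> trapezoid_function_measurable sample_vector_measurable[OF t] levy_area_measurable
  have Zm: "?Z \<in> borel_measurable M" by measurable
  show ?thesis
  proof (cases "sq_integrable M ?Z")
    case False
    then show ?thesis using L2_norm_eq_top[OF Zm] by simp
  next
    case True
    have eq: "AE \<omega> in M. ?Z \<omega> - trapezoid_error \<omega> = ?Y \<omega>"
      using trapezoid_sum_eq_method_value by eventually_elim (simp add: trapezoid_error_def)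
    have Y: "sq_integrable M ?Y"
      by (rule sq_integrable_cong_AE[OF sq_integrable_diff[OF True trapezoid_error_sq_integrable] _ eq]) measurable
    have g: "?g \<in> borel_measurable (sample_space n)" by measurable
    note iE = sq_integrable_integrable[OF trapezoid_error_sq_integrable]
      and iEY = sq_integrable_mult[OF trapezoid_error_sq_integrable Y]
      and iY = sq_integrable_integrable[OF Y]
    have [measurable]: "trapezoid_error \<in> borel_measurable M"
      by (rule sq_integrable_measurable[OF trapezoid_error_sq_integrable])
    have "expectation (\<lambda>\<omega>. (?Z \<omega>)\<^sup>2) = expectation (\<lambda>\<omega>. (trapezoid_error \<omega>)\<^sup>2 + 2 * (trapezoid_error \<omega> * ?Y \<omega>) + (?Y \<omega>)\<^sup>2)"
    proof (rule integral_cong_AE)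
      show "AE \<omega> in M. (?Z \<omega>)\<^sup>2 = (trapezoid_error \<omega>)\<^sup>2 + 2 * (trapezoid_error \<omega> * ?Y \<omega>) + (?Y \<omega>)\<^sup>2"
        using eq
      proof eventually_elim
        case (elim \<omega>)
        then have "?Z \<omega> = trapezoid_error \<omega> + ?Y \<omega>" by simp
        then show ?case by (simp only: power2_sum)
      qed
    qed measurable
    also have "\<dots> = expectation (\<lambda>\<omega>. (trapezoid_error \<omega>)\<^sup>2) + 2 * expectation (\<lambda>\<omega>. trapezoid_error \<omega> * ?Y \<omega>)
        + expectation (\<lambda>\<omega>. (?Y \<omega>)\<^sup>2)"
      using iE iEY iY by simp
    also have "\<dots> \<ge> expectation (\<lambda>\<omega>. (trapezoid_error \<omega>)\<^sup>2)"
      unfolding trapezoid_error_orthogonal[OF g Y] by simp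
    finally show ?thesis
      unfolding L2_norm_eq_sqrt_integral[OF True] by (intro ennreal_leI real_sqrt_le_mono)
  qed
qed

text \<open>The Cauchy-Schwarz inequality for the cell lengths, which add up to \<open>T\<close>.\<close>

lemma sum_square_mesh_ge: "T\<^sup>2 / real n \<le> (\<Sum>i<n. (t (Suc i) - t i)\<^sup>2)"
proof -
  have "(\<Sum>i<n. t (Suc i) - t i) = T"
    using t sum_lessThan_telescope[of t n] by (simp add: discretizations_def)
  then have "T\<^sup>2 \<le> (\<Sum>i<n. (t (Suc i) - t i)\<^sup>2) * real n"
    using sum_squared_le_sum_of_squares[of "\<lambda>i. t (Suc i) - t i" "{..<n}"] by simp
  then show ?thesis using n by (simp add: pos_divide_le_eq)
qed

end

section \<open>The equidistant mesh and the limit\<close>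

definition equidistant :: "nat \<Rightarrow> nat \<Rightarrow> real" where
  "equidistant n i = real i * T / real n"

lemma equidistant_discretization: "0 < n \<Longrightarrow> equidistant n \<in> discretizations T n"
  using T_pos by (auto simp: discretizations_def equidistant_def divide_strict_right_mono)

lemma trapezoidal_eq: "trapezoidal T n N W = trapezoid_sum n (equidistant n)"
  by (rule ext) (simp add: trapezoidal_def trapezoid_sum_def equidistant_def Let_def)

lemma equidistant_cell: "equidistant n (Suc i) - equidistant n i = T / real n"
  by (simp add: equidistant_def diff_divide_distrib[symmetric] distrib_right)

lemma equidistant_error_le:
  assumes n: "0 < n"
  shows "real n * expectation (\<lambda>\<omega>. (trapezoid_error (equidistant n) n \<omega>)\<^sup>2)
    \<le> rate * T\<^sup>2 / 4 + rate\<^sup>2 * T ^ 3 / 4 / real n"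
proof -
  have "expectation (\<lambda>\<omega>. (trapezoid_error (equidistant n) n \<omega>)\<^sup>2)
      \<le> rate / 4 * (\<Sum>i<n. (T / real n)\<^sup>2) + rate\<^sup>2 / 4 * (\<Sum>i<n. (T / real n) ^ 3)"
    using trapezoid_error_bounds(2)[OF equidistant_discretization[OF n] n] unfolding equidistant_cell .
  then have "real n * expectation (\<lambda>\<omega>. (trapezoid_error (equidistant n) n \<omega>)\<^sup>2)
      \<le> real n * (rate / 4 * (\<Sum>i<n. (T / real n)\<^sup>2) + rate\<^sup>2 / 4 * (\<Sum>i<n. (T / real n) ^ 3))"
    by (rule mult_left_mono) simp
  also have "\<dots> = rate * T\<^sup>2 / 4 + rate\<^sup>2 * T ^ 3 / 4 / real n"
    using n by (simp add: power2_eq_square power3_eq_cube field_simps)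
  finally show ?thesis .
qed

theorem trapezoidal_and_optimal_limits:
  "(\<lambda>n. ennreal (sqrt (real n)) * L2_norm M (\<lambda>\<omega>. levy_area M F T N W \<omega> - trapezoidal T n N W \<omega>))
      \<longlonglongrightarrow> ennreal (sqrt rate * T / 2)" (is "?trap \<longlonglongrightarrow> ?c")
  "(\<lambda>n. ennreal (sqrt (real n)) *
      (INF A\<in>methods T n. L2_norm M (\<lambda>\<omega>. levy_area M F T N W \<omega> - method_value n A N W \<omega>)))
      \<longlonglongrightarrow> ennreal (sqrt rate * T / 2)" (is "?opt \<longlonglongrightarrow> ?c")
proof -
  let ?J = "levy_area M F T N W"
  have c: "sqrt rate * T / 2 = sqrt (rate * T\<^sup>2 / 4)"
    using T_pos by (simp add: real_sqrt_mult real_sqrt_divide)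
  have lower: "?c \<le> ennreal (sqrt (real n)) * ennreal (sqrt (expectation (\<lambda>\<omega>. (trapezoid_error t n \<omega>)\<^sup>2)))"
    if n: "0 < n" and t: "t \<in> discretizations T n" for n t
  proof -
    have "rate / 4 * (T\<^sup>2 / real n) \<le> rate / 4 * (\<Sum>i<n. (t (Suc i) - t i)\<^sup>2)"
      using sum_square_mesh_ge[OF t n] rate_pos by (intro mult_left_mono) auto
    also have "\<dots> \<le> expectation (\<lambda>\<omega>. (trapezoid_error t n \<omega>)\<^sup>2)"
      by (rule trapezoid_error_bounds(1)[OF t n])
    finally have "real n * (rate / 4 * (T\<^sup>2 / real n)) \<le> real n * expectation (\<lambda>\<omega>. (trapezoid_error t n \<omega>)\<^sup>2)"
      by (rule mult_left_mono) simp
    then have "rate * T\<^sup>2 / 4 \<le> real n * expectation (\<lambda>\<omega>. (trapezoid_error t n \<omega>)\<^sup>2)"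
      using n by simp
    then show ?thesis
      unfolding c by (simp add: ennreal_mult[symmetric] real_sqrt_mult[symmetric] ennreal_leI)
  qed
  have opt_ge: "?c \<le> ?opt n" if n: "0 < n" for n
  proof -
    define l where "l = ?c / ennreal (sqrt (real n))"
    have sn: "0 < ennreal (sqrt (real n))" "ennreal (sqrt (real n)) < \<top>" using n by auto
    have "l \<le> L2_norm M (\<lambda>\<omega>. ?J \<omega> - method_value n A N W \<omega>)" if A: "A \<in> methods T n" for A
    proof -
      have t: "fst A \<in> discretizations T n" and \<phi>: "snd A \<in> borel_measurable (sample_space n)"
        using A by (auto simp: methods_def)
      have "?c \<le> L2_norm M (\<lambda>\<omega>. ?J \<omega> - method_value n A N W \<omega>) * ennreal (sqrt (real n))"
        unfolding method_value_def
        using order_trans[OF lower[OF n t] mult_left_mono[OF method_error_ge[OF t n \<phi>]]]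
        by (simp add: mult.commute)
      then show ?thesis unfolding l_def using sn by (intro divide_le_posI_ennreal) (auto simp: mult.commute)
    qed
    then have "l \<le> (INF A\<in>methods T n. L2_norm M (\<lambda>\<omega>. ?J \<omega> - method_value n A N W \<omega>))"
      by (intro INF_greatest)
    then have "ennreal (sqrt (real n)) * l \<le> ?opt n" by (intro mult_left_mono) auto
    moreover have "ennreal (sqrt (real n)) * l = ?c"
      unfolding l_def using n T_pos rate_pos by (simp add: divide_ennreal ennreal_mult[symmetric])
    ultimately show ?thesis by simp
  qed
  have trap_eq: "L2_norm M (\<lambda>\<omega>. ?J \<omega> - trapezoidal T n N W \<omega>)
      = ennreal (sqrt (expectation (\<lambda>\<omega>. (trapezoid_error (equidistant n) n \<omega>)\<^sup>2)))" if n: "0 < n" for n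
    using L2_norm_eq_sqrt_integral[OF trapezoid_error_sq_integrable[OF equidistant_discretization[OF n] n]]
    unfolding trapezoidal_eq trapezoid_error_def[OF equidistant_discretization[OF n] n] .
  have opt_le: "?opt n \<le> ?trap n" if n: "0 < n" for n
  proof (rule mult_left_mono)
    note t = equidistant_discretization[OF n]
    have "(INF A\<in>methods T n. L2_norm M (\<lambda>\<omega>. ?J \<omega> - method_value n A N W \<omega>))
        \<le> L2_norm M (\<lambda>\<omega>. ?J \<omega> - method_value n (equidistant n, trapezoid_function n) N W \<omega>)"
      by (rule INF_lower[OF trapezoid_method[OF t n]])
    also have "\<dots> = L2_norm M (\<lambda>\<omega>. ?J \<omega> - trapezoidal T n N W \<omega>)"
      unfolding trapezoidal_eq method_value_def
      by (rule L2_norm_cong_AE) (use trapezoid_sum_eq_method_value[OF t n] in \<open>auto elim!: AE_mp\<close>)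
    finally show "(INF A\<in>methods T n. L2_norm M (\<lambda>\<omega>. ?J \<omega> - method_value n A N W \<omega>))
        \<le> L2_norm M (\<lambda>\<omega>. ?J \<omega> - trapezoidal T n N W \<omega>)" .
  qed simp
  have trap_le: "?trap n \<le> ennreal (sqrt (rate * T\<^sup>2 / 4 + rate\<^sup>2 * T ^ 3 / 4 / real n))" if n: "0 < n" for n
    unfolding trap_eq[OF n] using equidistant_error_le[OF n]
    by (simp add: ennreal_mult[symmetric] real_sqrt_mult[symmetric] ennreal_leI)
  have upper: "(\<lambda>n. ennreal (sqrt (rate * T\<^sup>2 / 4 + rate\<^sup>2 * T ^ 3 / 4 / real n))) \<longlonglongrightarrow> ?c"
  proof -
    have "(\<lambda>n. sqrt (rate * T\<^sup>2 / 4 + rate\<^sup>2 * T ^ 3 / 4 / real n)) \<longlonglongrightarrow> sqrt (rate * T\<^sup>2 / 4 + 0)"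
      by (intro tendsto_real_sqrt tendsto_add tendsto_const lim_const_over_n)
    then show ?thesis unfolding c by (intro tendsto_ennrealI) simp
  qed
  show "?trap \<longlonglongrightarrow> ?c"
  proof (rule tendsto_sandwich[OF _ _ tendsto_const upper])
    show "\<forall>\<^sub>F n in sequentially. ?c \<le> ?trap n"
      by (rule eventually_sequentiallyI[of 1], rule order_trans[OF opt_ge opt_le]) simp_all
    show "\<forall>\<^sub>F n in sequentially. ?trap n \<le> ennreal (sqrt (rate * T\<^sup>2 / 4 + rate\<^sup>2 * T ^ 3 / 4 / real n))"
      by (rule eventually_sequentiallyI[of 1], rule trap_le) simp
  qed
  show "?opt \<longlonglongrightarrow> ?c"
  proof (rule tendsto_sandwich[OF _ _ tendsto_const upper])
    show "\<forall>\<^sub>F n in sequentially. ?c \<le> ?opt n"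
      by (rule eventually_sequentiallyI[of 1], rule opt_ge) simp
    show "\<forall>\<^sub>F n in sequentially. ?opt n \<le> ennreal (sqrt (rate * T\<^sup>2 / 4 + rate\<^sup>2 * T ^ 3 / 4 / real n))"
      by (rule eventually_sequentiallyI[of 1], rule order_trans[OF opt_le trap_le]) simp_all
  qed
qed

end

theorem theorem4p3:
  fixes M :: "'a measure" and F :: "real \<Rightarrow> 'a measure"
    and N W :: "real \<Rightarrow> 'a \<Rightarrow> real" and T rate :: real
  assumes "filtered_prob_space M F" and "usual_conditions M F"
    and "0 < T" and "0 < rate"
    and "wiener_process M F T W" and "poisson_process M F T rate N"
  shows "(\<lambda>n. ennreal (sqrt (real n)) *
            L2_norm M (\<lambda>\<omega>. levy_area M F T N W \<omega> - trapezoidal T n N W \<omega>))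
          \<longlonglongrightarrow> ennreal (sqrt rate * T / 2)
       \<and> (\<lambda>n. ennreal (sqrt (real n)) *
            (INF A\<in>methods T n. L2_norm M (\<lambda>\<omega>. levy_area M F T N W \<omega> - method_value n A N W \<omega>)))
          \<longlonglongrightarrow> ennreal (sqrt rate * T / 2)"
proof -
  interpret wiener_poisson M F W N T rate
    by (intro wiener_poisson.intro wiener_poisson_axioms.intro assms)
  show ?thesis
    using trapezoidal_and_optimal_limits by blast
qed

end
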